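(* Let $\aleph$ be an uncountable cardinal and let $p\in(0,1]$. If $$0\longrightarrow H\longrightarrow \ell_p(\aleph)\longrightarrow L_p(2^{\aleph})\longrightarrow 0$$ is any exact sequence, then $H$ is not isomorphic to any $\ell_p$-sum $\ell_p(I,X_i)$ of a family $(X_i)_{i\in I}$ of separable $p$-Banach spaces.
   Context: Scalars are real. A $p$-norm ($0<p\le1$) is a quasinorm satisfying $\|x+y\|^p\le\|x\|^p+\|y\|^p$; a $p$-Banach space is a complete $p$-normed space (a Banach space when $p=1$). $\ell_p(\aleph)$ is the space of functions $x:\aleph\to\mathbb R$ with $\|x\|_p=\left(\sum_{i\in\aleph}|x(i)|^p\right)^{1/p}<\infty$. $2^{\aleph}$ denotes the product of $\aleph$ many copies of the two-element group, equipped with its Haar probability measure, and $L_p(2^\aleph)$ is the corresponding $L_p$-space. An exact sequence is one of $p$-Banach spaces and bounded linear operators in which the kernel of each operator equals the range of the preceding one; thus $H$ is (isomorphic to) the kernel of a bounded linear surjection $\ell_p(\aleph)\to L_p(2^\aleph)$. For a family $(X_i)_{i\in I}$ of $p$-Banach spaces, $\ell_p(I,X_i)$ is the space of families $(x_i)_{i\in I}$, $x_i\in X_i$, with $\sum_{i\in I}\|x_i\|^p<\infty$, with the quasinorm $\left(\sum_{i}\|x_i\|^p\right)^{1/p}$. "Isomorphic" means linearly homeomorphic. *)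

theory Defs
  imports "HOL-Probability.Probability" "HOL-Library.Function_Algebras"
begin

section \<open>Quasinormed and p-Banach spaces\<close>

text \<open>
  For p < 1 these spaces are not normed, so the library classes of normed spaces do not apply. A
  space is a linear subspace of an ambient \<^class>\<open>real_vector\<close> type together with a quasinorm;
  only the values of the quasinorm on the subspace matter.
\<close>

record 'a qspace =
  points :: "'a set"
  qnorm :: "'a \<Rightarrow> real"

definition quasinormed :: "'a::real_vector qspace \<Rightarrow> bool" where
  "quasinormed X \<longleftrightarrow>
     subspace (points X) \<and>
     (\<forall>x\<in>points X. 0 \<le> qnorm X x \<and> (qnorm X x = 0 \<longleftrightarrow> x = 0)) \<and>
     (\<forall>x\<in>points X. \<forall>c. qnorm X (c *\<^sub>R x) = \<bar>c\<bar> * qnorm X x) \<and>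
     (\<exists>C. \<forall>x\<in>points X. \<forall>y\<in>points X. qnorm X (x + y) \<le> C * (qnorm X x + qnorm X y))"

definition p_normed :: "real \<Rightarrow> 'a::real_vector qspace \<Rightarrow> bool" where
  "p_normed p X \<longleftrightarrow>
     quasinormed X \<and>
     (\<forall>x\<in>points X. \<forall>y\<in>points X.
        qnorm X (x + y) powr p \<le> qnorm X x powr p + qnorm X y powr p)"

text \<open>
  The p-th power of a p-norm is a translation-invariant metric inducing the topology (and the
  Cauchy sequences) of the p-norm. It is cut off outside the space because
  \<^locale>\<open>Metric_space\<close> asks for symmetry on the whole type.
\<close>

definition pdist :: "real \<Rightarrow> 'a::real_vector qspace \<Rightarrow> 'a \<Rightarrow> 'a \<Rightarrow> real" where
  "pdist p X x y = (if x \<in> points X \<and> y \<in> points X then qnorm X (x - y) powr p else 0)"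

lemma Metric_space_pdist:
  assumes "p_normed p X"
  shows "Metric_space (points X) (pdist p X)"
proof
  have X: "subspace (points X)" and pos: "\<And>x. x \<in> points X \<Longrightarrow> qnorm X x = 0 \<longleftrightarrow> x = 0"
    and scale: "\<And>x c. x \<in> points X \<Longrightarrow> qnorm X (c *\<^sub>R x) = \<bar>c\<bar> * qnorm X x"
    and tri: "\<And>x y. x \<in> points X \<Longrightarrow> y \<in> points X \<Longrightarrow>
                qnorm X (x + y) powr p \<le> qnorm X x powr p + qnorm X y powr p"
    using assms by (auto simp: p_normed_def quasinormed_def)
  have diff: "x - y \<in> points X" if "x \<in> points X" "y \<in> points X" for x y
    using subspace_diff[OF X that] .
  show "0 \<le> pdist p X x y" for x y by (simp add: pdist_def)
  show "pdist p X x y = pdist p X y x" for x y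
    using scale[OF diff, of x y "-1"] by (simp add: pdist_def)
  show "pdist p X x y = 0 \<longleftrightarrow> x = y" if "x \<in> points X" "y \<in> points X" for x y
    using that pos[OF diff[OF that]] by (simp add: pdist_def)
  show "pdist p X x z \<le> pdist p X x y + pdist p X y z"
    if "x \<in> points X" "y \<in> points X" "z \<in> points X" for x y z
    using tri[OF diff diff, of x y y z] that by (simp add: pdist_def)
qed

definition p_topology :: "real \<Rightarrow> 'a::real_vector qspace \<Rightarrow> 'a topology" where
  "p_topology p X = Metric_space.mtopology (points X) (pdist p X)"

definition p_Banach :: "real \<Rightarrow> 'a::real_vector qspace \<Rightarrow> bool" where
  "p_Banach p X \<longleftrightarrow> p_normed p X \<and> Metric_space.mcomplete (points X) (pdist p X)"

definition p_separable :: "real \<Rightarrow> 'a::real_vector qspace \<Rightarrow> bool" where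
  "p_separable p X \<longleftrightarrow> separable_space (p_topology p X)"


section \<open>Operators, exact sequences, isomorphisms\<close>

definition linear_operator ::
  "'a::real_vector qspace \<Rightarrow> 'b::real_vector qspace \<Rightarrow> ('a \<Rightarrow> 'b) \<Rightarrow> bool" where
  "linear_operator X Y T \<longleftrightarrow>
     T ` points X \<subseteq> points Y \<and>
     (\<forall>x\<in>points X. \<forall>y\<in>points X. T (x + y) = T x + T y) \<and>
     (\<forall>c. \<forall>x\<in>points X. T (c *\<^sub>R x) = c *\<^sub>R T x)"

definition bounded_operator ::
  "'a::real_vector qspace \<Rightarrow> 'b::real_vector qspace \<Rightarrow> ('a \<Rightarrow> 'b) \<Rightarrow> bool" where
  "bounded_operator X Y T \<longleftrightarrow>
     linear_operator X Y T \<and> (\<exists>C. \<forall>x\<in>points X. qnorm Y (T x) \<le> C * qnorm X x)"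

text \<open>Exactness of \<open>0 \<longrightarrow> X \<longrightarrow> Y \<longrightarrow> Z \<longrightarrow> 0\<close> at X, Y and Z, in this order.\<close>

definition short_exact ::
  "'a::real_vector qspace \<Rightarrow> 'b::real_vector qspace \<Rightarrow> 'c::real_vector qspace \<Rightarrow>
   ('a \<Rightarrow> 'b) \<Rightarrow> ('b \<Rightarrow> 'c) \<Rightarrow> bool" where
  "short_exact X Y Z j q \<longleftrightarrow>
     bounded_operator X Y j \<and> bounded_operator Y Z q \<and>
     {x \<in> points X. j x = 0} = {0} \<and>
     {y \<in> points Y. q y = 0} = j ` points X \<and>
     q ` points Y = points Z"

definition isomorphic :: "real \<Rightarrow> 'a::real_vector qspace \<Rightarrow> 'b::real_vector qspace \<Rightarrow> bool" where
  "isomorphic p X Y \<longleftrightarrow>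
     (\<exists>T. linear_operator X Y T \<and> homeomorphic_map (p_topology p X) (p_topology p Y) T)"


section \<open>The spaces of p-summable functions and families\<close>

instantiation "fun" :: (type, real_vector) real_vector
begin

definition scaleR_fun :: "real \<Rightarrow> ('a \<Rightarrow> 'b) \<Rightarrow> 'a \<Rightarrow> 'b" where
  "scaleR_fun c f = (\<lambda>x. c *\<^sub>R f x)"

instance
  by standard (auto simp: scaleR_fun_def plus_fun_def scaleR_add_right scaleR_add_left)

end

text \<open>The cardinal is that of the index type.\<close>

definition ell_p :: "real \<Rightarrow> ('k \<Rightarrow> real) qspace" where
  "ell_p p =
     \<lparr>points = {x. (\<lambda>i. \<bar>x i\<bar> powr p) summable_on UNIV},
      qnorm = (\<lambda>x. (\<Sum>\<^sub>\<infinity>i\<in>UNIV. \<bar>x i\<bar> powr p) powr (1 / p))\<rparr>"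

text \<open>Families indexed by \<open>I\<close> are functions on the index type that vanish outside \<open>I\<close>.\<close>

definition ell_p_sum :: "real \<Rightarrow> 'i set \<Rightarrow> ('i \<Rightarrow> 'a::real_vector qspace) \<Rightarrow> ('i \<Rightarrow> 'a) qspace" where
  "ell_p_sum p I X =
     \<lparr>points = {x. (\<forall>i\<in>I. x i \<in> points (X i)) \<and> (\<forall>i. i \<notin> I \<longrightarrow> x i = 0) \<and>
                   (\<lambda>i. qnorm (X i) (x i) powr p) summable_on I},
      qnorm = (\<lambda>x. (\<Sum>\<^sub>\<infinity>i\<in>I. qnorm (X i) (x i) powr p) powr (1 / p))\<rparr>"


section \<open>Haar measure on powers of the two-element group\<close>

text \<open>
  The two-element group is \<^typ>\<open>bool\<close> with addition \<^term>\<open>(\<noteq>)\<close>. As usual, the Haar probability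
  measure of its power is taken to be the product of the uniform measures, on the product
  sigma-algebra; theorem \<open>haar_iff\<close> below shows that it is the only translation-invariant
  probability measure there. (On the Borel sets of an uncountable power the Haar measure is the
  completion-regular extension of this one; it has the same classes of measurable functions
  modulo null sets.)
\<close>

definition haar :: "('k \<Rightarrow> bool) measure" where
  "haar = PiM UNIV (\<lambda>_. uniform_count_measure UNIV)"

lemma sets_haar: "sets haar = sets (PiM UNIV (\<lambda>_. count_space UNIV))"
  unfolding haar_def by (intro sets_PiM_cong) (auto simp: sets_uniform_count_measure)

lemma space_haar [simp]: "space haar = UNIV"
  by (simp add: haar_def space_PiM space_uniform_count_measure)

lemma emeasure_uniform_bool:
  "emeasure (uniform_count_measure (UNIV :: bool set)) F = ennreal (real (card F) / 2)"
  by (simp add: emeasure_uniform_count_measure)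

lemma product_prob_space_bool: "product_prob_space (\<lambda>_. uniform_count_measure (UNIV :: bool set))"
  unfolding product_prob_space_def product_sigma_finite_def product_prob_space_axioms_def
  by (simp add: prob_space_uniform_count_measure prob_space_imp_sigma_finite)

lemma cylinder_in_sets_haar: "finite J \<Longrightarrow> {x. \<forall>j\<in>J. x j \<in> F j} \<in> sets haar"
proof -
  assume "finite J"
  have "{x \<in> space (PiM UNIV (\<lambda>_. count_space UNIV)). \<forall>j\<in>J. x j \<in> F j}
          \<in> sets (PiM UNIV (\<lambda>_. count_space UNIV))"
    using \<open>finite J\<close> by (intro sets.sets_Collect_finite_All) measurable
  then show ?thesis by (simp add: sets_haar space_PiM)
qed

lemma haar_eqI:
  fixes N :: "('k \<Rightarrow> bool) measure"
  assumes "sets N = sets haar"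
    and "\<And>J F. finite J \<Longrightarrow>
          emeasure N {x. \<forall>j\<in>J. x j \<in> F j} = (\<Prod>j\<in>J. ennreal (real (card (F j)) / 2))"
  shows "N = haar"
  unfolding haar_def
proof (rule product_prob_space.PiM_eq[OF product_prob_space_bool])
  show "sets N = sets (PiM UNIV (\<lambda>_. uniform_count_measure UNIV))"
    using assms(1) by (simp add: haar_def)
  fix J :: "'k set" and F :: "'k \<Rightarrow> bool set"
  assume "finite J"
  moreover have "prod_emb UNIV (\<lambda>_. uniform_count_measure UNIV) J (Pi\<^sub>E J F) = {x. \<forall>j\<in>J. x j \<in> F j}"
    by (auto simp: prod_emb_def PiE_def Pi_def space_uniform_count_measure)
  ultimately show "emeasure N (prod_emb UNIV (\<lambda>_. uniform_count_measure UNIV) J (Pi\<^sub>E J F)) =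
      (\<Prod>j\<in>J. emeasure (uniform_count_measure UNIV) (F j))"
    using assms(2) by (simp add: emeasure_uniform_bool)
qed

lemma emeasure_haar_cylinder:
  fixes J :: "'k set"
  assumes "finite J"
  shows "emeasure haar {x. \<forall>j\<in>J. x j \<in> F j} = (\<Prod>j\<in>J. ennreal (real (card (F j)) / 2))"
proof -
  interpret product_prob_space "\<lambda>_. uniform_count_measure (UNIV :: bool set)" "UNIV :: 'k set"
    by (rule product_prob_space_bool)
  have "prod_emb UNIV (\<lambda>_. uniform_count_measure UNIV) J (Pi\<^sub>E J F) = {x. \<forall>j\<in>J. x j \<in> F j}"
    by (auto simp: prod_emb_def PiE_def Pi_def space_uniform_count_measure)
  then show ?thesis
    using emeasure_PiM_emb[of J F] assms by (simp add: haar_def emeasure_uniform_bool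
        sets_uniform_count_measure)
qed

lemma measurable_translation:
  fixes a :: "'k \<Rightarrow> bool"
  shows "(\<lambda>x i. x i \<noteq> a i) \<in> measurable haar haar"
proof -
  have "(\<lambda>x i. x i \<noteq> a i) \<in> measurable (PiM UNIV (\<lambda>_. count_space UNIV)) (PiM UNIV (\<lambda>_. count_space UNIV))"
  proof (rule measurable_PiM_single')
    show "(\<lambda>x. x i \<noteq> a i) \<in> measurable (PiM UNIV (\<lambda>_. count_space UNIV)) (count_space UNIV)" for i
      by (rule measurable_compose[OF measurable_component_singleton]) auto
  qed (auto simp: space_PiM)
  then show ?thesis
    by (simp add: measurable_cong_sets[OF sets_haar sets_haar])
qed

theorem haar_iff:
  fixes N :: "('k \<Rightarrow> bool) measure"
  shows "N = haar \<longleftrightarrow>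
    sets N = sets (PiM UNIV (\<lambda>_. count_space UNIV)) \<and> prob_space N \<and>
    (\<forall>a. distr N N (\<lambda>x i. x i \<noteq> a i) = N)"
proof (intro iffI)
  assume N: "N = haar"
  have "prob_space N"
    unfolding N haar_def by (intro prob_space_PiM prob_space_uniform_count_measure) auto
  moreover have "distr haar haar (\<lambda>x i. x i \<noteq> a i) = haar" for a :: "'k \<Rightarrow> bool"
  proof (rule haar_eqI)
    fix J :: "'k set" and F :: "'k \<Rightarrow> bool set"
    assume J: "finite J"
    define G where "G j = (\<lambda>b. b \<noteq> a j) ` F j" for j
    have G: "card (G j) = card (F j)" for j
      unfolding G_def by (rule card_image) (auto simp: inj_on_def)
    have "emeasure (distr haar haar (\<lambda>x i. x i \<noteq> a i)) {x. \<forall>j\<in>J. x j \<in> F j} =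
        emeasure haar {x. \<forall>j\<in>J. (x j \<noteq> a j) \<in> F j}"
      by (subst emeasure_distr[OF measurable_translation cylinder_in_sets_haar[OF J]])
         (simp add: vimage_def)
    also have "{x. \<forall>j\<in>J. (x j \<noteq> a j) \<in> F j} = {x. \<forall>j\<in>J. x j \<in> G j}"
    proof -
      have "(b \<noteq> a j) \<in> F j \<longleftrightarrow> b \<in> G j" for b j
        unfolding G_def image_iff by (cases "a j"; cases b) (auto intro: bexI[rotated])
      then show ?thesis by simp
    qed
    finally show "emeasure (distr haar haar (\<lambda>x i. x i \<noteq> a i)) {x. \<forall>j\<in>J. x j \<in> F j} =
        (\<Prod>j\<in>J. ennreal (real (card (F j)) / 2))"
      using emeasure_haar_cylinder[OF J, of G] by (simp add: G)
  qed simp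
  ultimately show "sets N = sets (PiM UNIV (\<lambda>_. count_space UNIV)) \<and> prob_space N \<and>
      (\<forall>a. distr N N (\<lambda>x i. x i \<noteq> a i) = N)"
    by (simp add: N sets_haar)
next
  assume N: "sets N = sets (PiM UNIV (\<lambda>_. count_space UNIV)) \<and> prob_space N \<and>
    (\<forall>a. distr N N (\<lambda>x i. x i \<noteq> a i) = N)"
  then interpret prob_space N by simp
  have sets_N: "sets N = sets haar" using N by (simp add: sets_haar)
  then have space_N: "space N = UNIV" using sets_eq_imp_space_eq by fastforce
  have meas: "(\<lambda>x i. x i \<noteq> a i) \<in> measurable N N" for a :: "'k \<Rightarrow> bool"
    using measurable_translation by (simp add: measurable_cong_sets[OF sets_N sets_N])
  have cyl: "{x. \<forall>j\<in>J. x j \<in> F j} \<in> sets N" if "finite J" for J :: "'k set" and F :: "'k \<Rightarrow> bool set"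
    using cylinder_in_sets_haar[OF that] by (simp add: sets_N)
  have "measure N {x. \<forall>j\<in>J. x j \<in> F j} = (\<Prod>j\<in>J. real (card (F j)) / 2)"
    if "finite J" for J :: "'k set" and F :: "'k \<Rightarrow> bool set"
    using that
  proof (induction J rule: finite_induct)
    case empty
    then show ?case using prob_space by (simp add: space_N)
  next
    case (insert j J)
    define C where "C = {x. \<forall>j\<in>J. x j \<in> F j}"
    define D where "D b = {x \<in> C. x j = b}" for b
    have "{x. \<forall>i\<in>insert j J. x i \<in> (if i = j then {b} else F i)} = D b" for b
      using insert.hyps by (auto simp: C_def D_def)
    then have D_sets: "D b \<in> sets N" for b
      using cyl[of "insert j J" "\<lambda>i. if i = j then {b} else F i"] insert.hyps by simp
    have swap: "measure N (D True) = measure N (D False)"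
    proof -
      have "measure N (D True) = measure (distr N N (\<lambda>x i. x i \<noteq> (i = j))) (D True)"
        using N by simp
      also have "\<dots> = measure N ((\<lambda>x i. x i \<noteq> (i = j)) -` D True \<inter> space N)"
        by (rule measure_distr[OF meas D_sets])
      also have "(\<lambda>x i. x i \<noteq> (i = j)) -` D True \<inter> space N = D False"
      proof -
        have "(\<forall>i\<in>J. (x i \<noteq> (i = j)) \<in> F i) \<longleftrightarrow> (\<forall>i\<in>J. x i \<in> F i)" for x
        proof (rule ball_cong[OF refl])
          fix i assume "i \<in> J"
          then have "i \<noteq> j" using insert.hyps by blast
          then show "(x i \<noteq> (i = j)) \<in> F i \<longleftrightarrow> x i \<in> F i" by simp
        qed
        then show ?thesis by (auto simp: C_def D_def space_N)
      qed
      finally show ?thesis .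
    qed
    have "measure N C = measure N (D True \<union> D False)"
      by (rule arg_cong[where f = "measure N"]) (auto simp: D_def)
    also have "\<dots> = measure N (D True) + measure N (D False)"
      by (rule finite_measure_Union[OF D_sets D_sets]) (auto simp: D_def)
    finally have half: "measure N (D b) = measure N C / 2" for b
      using swap by (cases b) auto
    have "measure N {x. \<forall>i\<in>insert j J. x i \<in> F i} = measure N (\<Union>b\<in>F j. D b)"
      by (rule arg_cong[where f = "measure N"]) (auto simp: D_def C_def)
    also have "\<dots> = (\<Sum>b\<in>F j. measure N (D b))"
    proof (rule finite_measure_finite_Union)
      show "D ` F j \<subseteq> sets N" using D_sets by blast
      show "disjoint_family_on D (F j)" by (auto simp: disjoint_family_on_def D_def)
    qed simp
    also have "\<dots> = real (card (F j)) / 2 * measure N C"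
      by (simp add: half)
    finally show ?case
      using insert by (simp add: C_def)
  qed
  then show "N = haar"
    by (intro haar_eqI[OF sets_N]) (simp add: emeasure_eq_measure prod_ennreal)
qed


section \<open>The spaces L_p of Haar measure\<close>

text \<open>Measurable functions modulo equality almost everywhere; this does not depend on p.\<close>

quotient_type 'k L0 = "('k \<Rightarrow> bool) \<Rightarrow> real" / partial:
  "\<lambda>f g. f \<in> borel_measurable haar \<and> g \<in> borel_measurable haar \<and> (AE x in haar. f x = g x)"
proof (rule part_equivpI)
  show "\<exists>f :: ('k \<Rightarrow> bool) \<Rightarrow> real. f \<in> borel_measurable haar \<and> f \<in> borel_measurable haar \<and>
      (AE x in haar. f x = f x)"
    by (rule exI[of _ "\<lambda>_. 0"]) simp
  show "symp (\<lambda>f g. f \<in> borel_measurable haar \<and> g \<in> borel_measurable haar \<and>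
      (AE x in haar. f x = (g x :: real)))"
    by (auto intro!: sympI)
  show "transp (\<lambda>f g. f \<in> borel_measurable haar \<and> g \<in> borel_measurable haar \<and>
      (AE x in haar. f x = (g x :: real)))"
    by (auto intro!: transpI)
qed

instantiation L0 :: (type) real_vector
begin

lift_definition zero_L0 :: "'a L0" is "\<lambda>_. 0" by simp

lift_definition plus_L0 :: "'a L0 \<Rightarrow> 'a L0 \<Rightarrow> 'a L0" is "\<lambda>f g x. f x + g x" by auto

lift_definition minus_L0 :: "'a L0 \<Rightarrow> 'a L0 \<Rightarrow> 'a L0" is "\<lambda>f g x. f x - g x" by auto

lift_definition uminus_L0 :: "'a L0 \<Rightarrow> 'a L0" is "\<lambda>f x. - f x" by auto

lift_definition scaleR_L0 :: "real \<Rightarrow> 'a L0 \<Rightarrow> 'a L0" is "\<lambda>c f x. c * f x" by auto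

instance
  by standard (transfer; auto simp: algebra_simps)+

end

lift_definition Lp_integrable :: "real \<Rightarrow> 'k L0 \<Rightarrow> bool" is
  "\<lambda>p f. integrable haar (\<lambda>x. \<bar>f x\<bar> powr p)"
  by (intro integrable_cong_AE) auto

lift_definition Lp_qnorm :: "real \<Rightarrow> 'k L0 \<Rightarrow> real" is
  "\<lambda>p f. (\<integral>x. \<bar>f x\<bar> powr p \<partial>haar) powr (1 / p)"
  by (intro arg_cong[where f = "\<lambda>t. t powr _"] integral_cong_AE) auto

definition Lp_haar :: "real \<Rightarrow> 'k L0 qspace" where
  "Lp_haar p = \<lparr>points = {f. Lp_integrable p f}, qnorm = Lp_qnorm p\<rparr>"

end

(*
  Suppose the kernel of q is a sum of separable pieces X_i. Send a kernel element to its family of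
  pieces, seen as a point D x of l_p(I x k). As L_p is, up to closure, a directed union of isometric
  copies of finite-dimensional l_p, and the ball of l_p(I x k) is compact for pointwise convergence,
  D extends to a bounded operator D' on the preimage of the simple functions. Modulo the kernel, the
  pieces of D' induce operators Q_i into separable subspaces of L_p; and U = (sum of the pieces) - id
  vanishes on the kernel, so it induces an operator from the simple functions to l_p.

  Sums of n Rademacher functions have norm of order n^(1/2), so each Q_i and each coordinate of U
  vanishes at all but countably many of the uncountably many Rademacher functions. Conversely, the
  image of each of them has only countably many nonzero pieces and coordinates. Hence one can choose
  n of them using pairwise disjoint sets of pieces and coordinates. Any lift w of their sum then has
  n disjoint parts of D' w and U w, each bounded below because it gives back one of the Rademacher
  functions, so that n <= const * n^(p/2).
*)
theory Submission
  imports Defs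
begin

section \<open>The p-th power of a p-norm\<close>

text \<open>Nothing is known about weak compactness in the X_i, so the pieces are kept as elements
  of l_p rather than of X_i; coordinatewise limits are then available for the extension. The price
  is that an extended piece may leave the kernel, and that the extended pieces may fail to add up to
  their argument. Q_i and U record these two defects, and they cannot all vanish at a lift of a
  Rademacher function r: a lift x is the sum of its extended pieces minus U x, so r = q x would be 0
  if every piece were killed by q and U x were 0.

  Vanishing on the kernel makes a defect depend only on the function lifted. It may therefore be
  computed on a lift of r_1 + ... + r_n chosen for the sum as a whole, where the p-th power of the
  quasinorm is of order n^(p/2), while adding up lifts of the r_k would only give order n.
  Countability comes from clustering: if uncountably many values in a separable space stayed away
  from 0, n of them would be nearly equal, and the p-th power of their sum would be of order n^p,
  too large against n^(p/2).\<close>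

definition npow :: "real \<Rightarrow> 'a::real_vector qspace \<Rightarrow> 'a \<Rightarrow> real" where
  "npow p X x = qnorm X x powr p"

text \<open>After division by s = a + b both terms lie in [0,1], where t \<le>
  \<open>t powr p\<close>; the two fractions add up to 1.\<close>

lemma powr_add_le:
  fixes a b p :: real
  assumes "0 < p" "p \<le> 1" "0 \<le> a" "0 \<le> b"
  shows "(a + b) powr p \<le> a powr p + b powr p"
proof (cases "a + b = 0")
  case False
  define s where "s = a + b"
  have s: "s > 0" using False assms by (simp add: s_def)
  have le: "t / s \<le> (t / s) powr p" if "0 \<le> t" "t \<le> s" for t
  proof (cases "t = 0")
    case False
    then have "(t / s) powr 1 \<le> (t / s) powr p"
      using that s assms by (intro powr_mono') auto
    then show ?thesis using that s by simp
  qed simp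
  have "1 = a / s + b / s" using s by (simp add: s_def flip: add_divide_distrib)
  also have "\<dots> \<le> (a / s) powr p + (b / s) powr p"
    using assms by (intro add_mono le) (auto simp: s_def)
  also have "\<dots> = (a powr p + b powr p) / s powr p"
    using s assms by (simp add: powr_divide add_divide_distrib)
  finally show ?thesis using s by (simp add: s_def field_simps)
qed (use assms in auto)

lemma abs_add_powr_le:
  fixes a b p :: real
  assumes "0 < p" "p \<le> 1"
  shows "\<bar>a + b\<bar> powr p \<le> \<bar>a\<bar> powr p + \<bar>b\<bar> powr p"
proof -
  have "\<bar>a + b\<bar> powr p \<le> (\<bar>a\<bar> + \<bar>b\<bar>) powr p"
    using assms by (intro powr_mono2) auto
  also have "\<dots> \<le> \<bar>a\<bar> powr p + \<bar>b\<bar> powr p" using assms by (intro powr_add_le) auto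
  finally show ?thesis .
qed

lemma abs_sum_powr_le:
  fixes f :: "'a \<Rightarrow> real"
  assumes "0 < p" "p \<le> 1"
  shows "\<bar>sum f A\<bar> powr p \<le> (\<Sum>a\<in>A. \<bar>f a\<bar> powr p)"
proof (induction A rule: infinite_finite_induct)
  case (insert x A)
  then show ?case using abs_add_powr_le[OF assms, of "f x" "sum f A"] by simp
qed (use assms in auto)

text \<open>Estimates are made for \<open>npow\<close>, which is subadditive, homogeneous of degree
  p, and gives the metric \<open>pdist\<close> on differences; for p < 1 the quasinorm itself may
  violate the triangle inequality.\<close>

locale p_space =
  fixes p :: real and X :: "'a::real_vector qspace"
  assumes p_pos: "0 < p" and p_le_1: "p \<le> 1" and p_normed: "p_normed p X"
begin

lemma subspace: "subspace (points X)"
  using p_normed by (simp add: p_normed_def quasinormed_def)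

lemmas zero_mem = subspace_0[OF subspace]
  and add_mem = subspace_add[OF subspace]
  and diff_mem = subspace_diff[OF subspace]
  and scale_mem = subspace_scale[OF subspace]
  and sum_mem = subspace_sum[OF subspace]

lemma npow_nonneg [simp]: "0 \<le> npow p X x"
  by (simp add: npow_def)

lemma npow_eq_0: "x \<in> points X \<Longrightarrow> npow p X x = 0 \<longleftrightarrow> x = 0"
  using p_normed by (simp add: npow_def p_normed_def quasinormed_def)

lemma npow_0 [simp]: "npow p X 0 = 0"
  by (simp add: npow_eq_0 zero_mem)

lemma npow_pos: "x \<in> points X \<Longrightarrow> x \<noteq> 0 \<Longrightarrow> 0 < npow p X x"
  using npow_eq_0[of x] npow_nonneg[of x] by linarith

lemma npow_scale: "x \<in> points X \<Longrightarrow> npow p X (c *\<^sub>R x) = \<bar>c\<bar> powr p * npow p X x"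
  using p_normed by (simp add: npow_def p_normed_def quasinormed_def powr_mult)

lemma npow_add: "x \<in> points X \<Longrightarrow> y \<in> points X \<Longrightarrow> npow p X (x + y) \<le> npow p X x + npow p X y"
  using p_normed by (simp add: npow_def p_normed_def)

lemma npow_minus: "x \<in> points X \<Longrightarrow> npow p X (- x) = npow p X x"
  using npow_scale[of x "-1"] by simp

lemma npow_diff: "x \<in> points X \<Longrightarrow> y \<in> points X \<Longrightarrow> npow p X (x - y) \<le> npow p X x + npow p X y"
  using npow_add[of x "- y"] subspace_neg[OF subspace, of y] npow_minus[of y] by simp

lemma npow_diff_commute: "x \<in> points X \<Longrightarrow> y \<in> points X \<Longrightarrow> npow p X (x - y) = npow p X (y - x)"
  using npow_minus[of "x - y"] diff_mem by simp

lemma npow_le_add_diff: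
  "x \<in> points X \<Longrightarrow> y \<in> points X \<Longrightarrow> npow p X x \<le> npow p X y + npow p X (x - y)"
  using npow_add[of y "x - y"] diff_mem by simp

lemma npow_sum:
  "(\<And>a. a \<in> A \<Longrightarrow> f a \<in> points X) \<Longrightarrow> npow p X (sum f A) \<le> (\<Sum>a\<in>A. npow p X (f a))"
proof (induction A rule: infinite_finite_induct)
  case (insert x A)
  then have "npow p X (sum f (insert x A)) \<le> npow p X (f x) + npow p X (sum f A)"
    by (simp add: npow_add sum_mem)
  then show ?case using insert by force
qed simp_all

lemma qnorm_eq: "x \<in> points X \<Longrightarrow> qnorm X x = npow p X x powr (1 / p)"
  using p_normed p_pos by (simp add: npow_def powr_powr p_normed_def quasinormed_def)

sublocale M: Metric_space "points X" "pdist p X"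
  by (rule Metric_space_pdist[OF p_normed])

lemma pdist_eq: "x \<in> points X \<Longrightarrow> y \<in> points X \<Longrightarrow> pdist p X x y = npow p X (x - y)"
  by (simp add: pdist_def npow_def)

lemma p_topology_eq: "p_topology p X = M.mtopology"
  by (simp add: p_topology_def)

end

text \<open>The quasi-triangle inequality follows from subadditivity of the p-th power: both powers
  are at most \<open>m powr p\<close> with m the sum of the two quasinorms, and taking the p-th root
  of \<open>2 * m powr p\<close> yields the constant \<open>2 powr (1 / p)\<close>.\<close>

lemma p_normedI:
  assumes p: "0 < p" "p \<le> 1" and "subspace (points X)"
    and "\<And>x. x \<in> points X \<Longrightarrow> 0 \<le> qnorm X x"
    and "\<And>x. x \<in> points X \<Longrightarrow> qnorm X x = 0 \<Longrightarrow> x = 0"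
    and scale: "\<And>x c. x \<in> points X \<Longrightarrow> qnorm X (c *\<^sub>R x) = \<bar>c\<bar> * qnorm X x"
    and add: "\<And>x y. x \<in> points X \<Longrightarrow> y \<in> points X \<Longrightarrow>
           qnorm X (x + y) powr p \<le> qnorm X x powr p + qnorm X y powr p"
  shows "p_normed p X"
proof -
  have 0: "0 \<in> points X" using assms(3) by (rule subspace_0)
  have z: "qnorm X 0 = 0" using scale[OF 0, of 0] by simp
  have "qnorm X (x + y) \<le> 2 powr (1 / p) * (qnorm X x + qnorm X y)"
    if x: "x \<in> points X" and y: "y \<in> points X" for x y
  proof -
    define m where "m = qnorm X x + qnorm X y"
    have nn: "0 \<le> qnorm X x" "0 \<le> qnorm X y" "0 \<le> qnorm X (x + y)"
      using assms(4) x y subspace_add[OF assms(3)] by auto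
    have "qnorm X (x + y) powr p \<le> m powr p + m powr p"
      using add[OF x y] nn p powr_mono2[of p "qnorm X x" m] powr_mono2[of p "qnorm X y" m]
      by (simp add: m_def)
    also have "\<dots> = 2 * m powr p" by simp
    finally have "(qnorm X (x + y) powr p) powr (1 / p) \<le> (2 * m powr p) powr (1 / p)"
      using p by (intro powr_mono2) auto
    then show ?thesis using nn p by (simp add: powr_powr powr_mult m_def)
  qed
  then show ?thesis
    unfolding p_normed_def quasinormed_def using assms z by blast
qed

section \<open>Linear and bounded operators, isomorphisms\<close>

lemma bounded_operatorD:
  assumes "bounded_operator X Y T"
  shows "\<And>x. x \<in> points X \<Longrightarrow> T x \<in> points Y"
    and "\<And>x y. x \<in> points X \<Longrightarrow> y \<in> points X \<Longrightarrow> T (x + y) = T x + T y"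
    and "\<And>c x. x \<in> points X \<Longrightarrow> T (c *\<^sub>R x) = c *\<^sub>R T x"
  using assms by (auto simp: bounded_operator_def linear_operator_def)

lemma (in p_space) linear_operator_sum:
  assumes T: "linear_operator X Y T" and "\<And>a. a \<in> A \<Longrightarrow> f a \<in> points X"
  shows "T (sum f A) = (\<Sum>a\<in>A. T (f a))"
proof -
  have "T (0 *\<^sub>R 0) = 0 *\<^sub>R T 0" using T zero_mem unfolding linear_operator_def by blast
  then have T0: "T 0 = 0" by simp
  show ?thesis using assms(2)
  proof (induction A rule: infinite_finite_induct)
    case (insert x A)
    then have "T (f x + sum f A) = T (f x) + T (sum f A)"
      using T sum_mem[of A f] by (simp add: linear_operator_def)
    then show ?case using insert by simp
  qed (simp_all add: T0)
qed

lemma (in p_space) linear_operator_diff: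
  assumes T: "linear_operator X Y T" and "x \<in> points X" "y \<in> points X"
  shows "T (x - y) = T x - T y"
proof -
  have "T (x - y + y) = T (x - y) + T y"
    using assms diff_mem unfolding linear_operator_def by blast
  then show ?thesis by simp
qed

lemma (in p_space) linear_operator_0:
  "linear_operator X Y T \<Longrightarrow> T 0 = 0"
  using linear_operator_diff[of Y T 0 0] zero_mem by simp

lemma bounded_operator_iff:
  assumes "p_space p X" "p_space p Y"
  shows "bounded_operator X Y T \<longleftrightarrow>
    linear_operator X Y T \<and> (\<exists>C>0. \<forall>x\<in>points X. npow p Y (T x) \<le> C * npow p X x)"
proof (cases "linear_operator X Y T")
  case True
  interpret X: p_space p X by fact
  interpret Y: p_space p Y by fact
  have mem: "T x \<in> points Y" if "x \<in> points X" for x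
    using True that by (auto simp: linear_operator_def)
  have nn: "0 \<le> qnorm X x" "0 \<le> qnorm Y (T x)" if "x \<in> points X" for x
    using X.qnorm_eq[OF that] Y.qnorm_eq[OF mem[OF that]] by simp_all
  show ?thesis
  proof
    assume "bounded_operator X Y T"
    then obtain C where C: "\<And>x. x \<in> points X \<Longrightarrow> qnorm Y (T x) \<le> C * qnorm X x"
      by (auto simp: bounded_operator_def)
    \<comment> \<open>The constant in \<open>bounded_operator\<close> may have any sign, so it is
      made positive before powers are taken.\<close>
    define D where "D = max C 1"
    have D: "D > 0" by (simp add: D_def)
    have "npow p Y (T x) \<le> D powr p * npow p X x" if x: "x \<in> points X" for x
    proof -
      have "qnorm Y (T x) \<le> D * qnorm X x"
        using C[OF x] nn[OF x] mult_right_mono[of C D "qnorm X x"] by (simp add: D_def)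
      then have "qnorm Y (T x) powr p \<le> (D * qnorm X x) powr p"
        using nn[OF x] X.p_pos by (intro powr_mono2) auto
      then show ?thesis using nn[OF x] D by (simp add: npow_def powr_mult)
    qed
    then show "linear_operator X Y T \<and> (\<exists>C>0. \<forall>x\<in>points X. npow p Y (T x) \<le> C * npow p X x)"
      using True D by (intro conjI exI[of _ "D powr p"]) auto
  next
    assume "linear_operator X Y T \<and> (\<exists>C>0. \<forall>x\<in>points X. npow p Y (T x) \<le> C * npow p X x)"
    then obtain C where C: "C > 0" "\<And>x. x \<in> points X \<Longrightarrow> npow p Y (T x) \<le> C * npow p X x" by auto
    have "qnorm Y (T x) \<le> C powr (1 / p) * qnorm X x" if x: "x \<in> points X" for x
    proof -
      have "npow p Y (T x) powr (1 / p) \<le> (C * npow p X x) powr (1 / p)"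
        using C(2)[OF x] X.p_pos by (intro powr_mono2) auto
      then show ?thesis
        using C(1) X.qnorm_eq[OF x] Y.qnorm_eq[OF mem[OF x]] by (simp add: powr_mult)
    qed
    then show "bounded_operator X Y T" using True by (auto simp: bounded_operator_def)
  qed
qed (simp add: bounded_operator_def)

lemma continuous_imp_bounded_operator:
  assumes "p_space p X" "p_space p Y" and T: "linear_operator X Y T"
    and cont: "continuous_map (p_topology p X) (p_topology p Y) T"
  shows "bounded_operator X Y T"
proof -
  interpret X: p_space p X by fact
  interpret Y: p_space p Y by fact
  have mem: "T x \<in> points Y" if "x \<in> points X" for x
    using T that by (auto simp: linear_operator_def)
  have T0: "T 0 = 0" using X.linear_operator_0[OF T] .
  have "\<exists>d>0. \<forall>x. x \<in> points X \<and> pdist p X 0 x < d \<longrightarrow> pdist p Y (T 0) (T x) < 1"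
    using cont X.zero_mem zero_less_one
    unfolding X.p_topology_eq Y.p_topology_eq
      X.M.metric_continuous_map[OF Y.M.Metric_space_axioms] by blast
  then obtain d where d: "d > 0"
    "\<And>x. x \<in> points X \<Longrightarrow> pdist p X 0 x < d \<Longrightarrow> pdist p Y (T 0) (T x) < 1"
    by blast
  have small: "npow p Y (T x) \<le> 1" if "x \<in> points X" "npow p X x < d" for x
    using d(2)[OF that(1)] that mem[OF that(1)] T0 X.zero_mem Y.zero_mem
    by (simp add: X.pdist_eq Y.pdist_eq X.npow_minus Y.npow_minus)
  have "npow p Y (T x) \<le> 2 / d * npow p X x" if x: "x \<in> points X" for x
  proof (cases "x = 0")
    case False
    \<comment> \<open>The scalar is chosen so that \<open>npow p X (c *\<^sub>R x)\<close> equals d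
      / 2, inside the ball on which T is known to be small.\<close>
    define c where "c = (d / (2 * npow p X x)) powr (1 / p)"
    have N: "npow p X x > 0" using X.npow_pos[OF x False] .
    have cp: "\<bar>c\<bar> powr p = d / (2 * npow p X x)"
      using d(1) N X.p_pos by (simp add: c_def powr_powr)
    have "npow p X (c *\<^sub>R x) < d" using cp N d(1) by (simp add: X.npow_scale[OF x])
    then have "npow p Y (T (c *\<^sub>R x)) \<le> 1" using small X.scale_mem[OF x] by blast
    moreover have "T (c *\<^sub>R x) = c *\<^sub>R T x" using T x by (simp add: linear_operator_def)
    ultimately show ?thesis using N d(1) cp by (simp add: Y.npow_scale[OF mem[OF x]] field_simps)
  qed (simp add: T0)
  then show ?thesis
    unfolding bounded_operator_iff[OF assms(1,2)] using T d(1) by (auto intro!: exI[of _ "2 / d"])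
qed

lemma isomorphicD:
  assumes "p_space p X" "p_space p Y" and "isomorphic p X Y"
  shows "\<exists>T R. bounded_operator X Y T \<and> bounded_operator Y X R \<and> (\<forall>x\<in>points X. R (T x) = x)"
proof -
  interpret X: p_space p X by fact
  interpret Y: p_space p Y by fact
  have top [simp]: "topspace (p_topology p X) = points X" "topspace (p_topology p Y) = points Y"
    by (simp_all add: X.p_topology_eq Y.p_topology_eq)
  from assms(3) obtain T where T: "linear_operator X Y T"
    and "homeomorphic_map (p_topology p X) (p_topology p Y) T"
    unfolding isomorphic_def by blast
  then obtain R where R: "homeomorphic_maps (p_topology p X) (p_topology p Y) T R"
    using homeomorphic_map_maps by blast
  then have cont: "continuous_map (p_topology p X) (p_topology p Y) T"
      "continuous_map (p_topology p Y) (p_topology p X) R"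
    and RT: "\<And>x. x \<in> points X \<Longrightarrow> R (T x) = x" and TR: "\<And>y. y \<in> points Y \<Longrightarrow> T (R y) = y"
    by (auto simp: homeomorphic_maps_def)
  have Rmem: "R y \<in> points X" if "y \<in> points Y" for y
    using cont(2) that by (auto simp: continuous_map_def Pi_iff)
  have "linear_operator Y X R"
    unfolding linear_operator_def
  proof (intro conjI ballI allI)
    show "R ` points Y \<subseteq> points X" using Rmem by blast
    fix x y c assume x: "x \<in> points Y" and y: "y \<in> points Y"
    have "T (R x + R y) = x + y"
      using T Rmem[OF x] Rmem[OF y] TR x y by (simp add: linear_operator_def)
    then show "R (x + y) = R x + R y" using RT[OF X.add_mem[OF Rmem[OF x] Rmem[OF y]]] by simp
  next
    fix c x assume x: "x \<in> points Y"
    have "T (c *\<^sub>R R x) = c *\<^sub>R x" using T Rmem[OF x] TR x by (simp add: linear_operator_def)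
    then show "R (c *\<^sub>R x) = c *\<^sub>R R x" using RT[OF X.scale_mem[OF Rmem[OF x], of c]] by simp
  qed
  then show ?thesis
    using RT continuous_imp_bounded_operator[OF assms(1,2) T cont(1)]
      continuous_imp_bounded_operator[OF assms(2,1) _ cont(2)] by blast
qed

section \<open>Completeness and the open mapping theorem\<close>

lemma real_tendsto_0_le:
  fixes a b :: "nat \<Rightarrow> real"
  assumes "\<And>n. 0 \<le> a n" "\<And>n. a n \<le> b n" "b \<longlonglongrightarrow> 0"
  shows "a \<longlonglongrightarrow> 0"
  by (rule tendsto_sandwich[OF _ _ tendsto_const assms(3)]) (use assms in auto)

context p_space
begin

lemma mcomplete_imp_series:
  assumes "M.mcomplete" and mem: "\<And>k. x k \<in> points X" and sm: "summable (\<lambda>k. npow p X (x k))"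
  obtains z where "z \<in> points X" "(\<lambda>n. npow p X (z - (\<Sum>k<n. x k))) \<longlonglongrightarrow> 0"
proof -
  define s where "s n = (\<Sum>k<n. x k)" for n
  have s: "s n \<in> points X" for n by (simp add: s_def sum_mem mem)
  have "M.MCauchy s"
    unfolding M.MCauchy_def
  proof (intro conjI allI impI)
    show "range s \<subseteq> points X" using s by blast
    fix e :: real assume "e > 0"
    from sm[unfolded summable_Cauchy, rule_format, OF this] obtain N where
      N: "\<And>m n. m \<ge> N \<Longrightarrow> norm (sum (\<lambda>k. npow p X (x k)) {m..<n}) < e" by blast
    have *: "pdist p X (s m) (s n) < e" if "N \<le> m" "m \<le> n" for m n
    proof -
      have "s n - s m = sum x {m..<n}"
        using that by (simp add: s_def lessThan_atLeast0 sum_diff_nat_ivl)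
      then have "npow p X (s n - s m) \<le> (\<Sum>k=m..<n. npow p X (x k))"
        using npow_sum[of "{m..<n}" x] mem by simp
      also have "\<dots> < e" using N[OF that(1), of n] by simp
      finally show ?thesis using s by (simp add: pdist_eq npow_diff_commute)
    qed
    then show "\<exists>N. \<forall>n n'. N \<le> n \<longrightarrow> N \<le> n' \<longrightarrow> pdist p X (s n) (s n') < e"
      using M.commute by (metis linorder_le_cases)
  qed
  then obtain z where z: "limitin M.mtopology s z sequentially"
    using assms(1) by (auto simp: M.mcomplete_def)
  then have "z \<in> points X" "(\<lambda>n. pdist p X (s n) z) \<longlonglongrightarrow> 0"
    by (auto simp: M.limitin_metric_dist_null)
  then show thesis
    using s by (intro that[of z]) (auto simp: pdist_eq s_def[symmetric] npow_diff_commute)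
qed

text \<open>A Cauchy sequence is thinned until consecutive distances are below
  \<open>(1/2) ^ k\<close>. The increments then form a summable series, and its sum yields a limit
  of the subsequence, hence of the whole sequence.\<close>

lemma series_imp_mcomplete:
  assumes "\<And>x. \<lbrakk>\<And>k. x k \<in> points X; summable (\<lambda>k. npow p X (x k))\<rbrakk> \<Longrightarrow>
     \<exists>z\<in>points X. (\<lambda>n. npow p X (z - (\<Sum>k<n. x k))) \<longlonglongrightarrow> 0"
  shows "M.mcomplete"
  unfolding M.mcomplete_def
proof (intro allI impI)
  fix \<sigma> assume C: "M.MCauchy \<sigma>"
  then have mem: "\<sigma> n \<in> points X" for n by (auto simp: M.MCauchy_def)
  have "\<forall>k. \<exists>N. \<forall>m n. N \<le> m \<longrightarrow> N \<le> n \<longrightarrow> pdist p X (\<sigma> m) (\<sigma> n) < (1/2) ^ k"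
    using C by (auto simp: M.MCauchy_def)
  then obtain N where N: "\<And>k m n. N k \<le> m \<Longrightarrow> N k \<le> n \<Longrightarrow> pdist p X (\<sigma> m) (\<sigma> n) < (1/2) ^ k"
    by metis
  \<comment> \<open>The sum makes \<open>r k\<close> at least \<open>N k\<close>; the added k makes
    r strictly increasing even where N takes the value 0.\<close>
  define r where "r k = (\<Sum>i\<le>k. N i) + k" for k
  have r: "strict_mono r" by (rule strict_mono_Suc_iff[THEN iffD2]) (auto simp: r_def)
  have rN: "N k \<le> r k" for k
    using member_le_sum[of k "{..k}" N] by (simp add: r_def)
  define x where "x k = \<sigma> (r (Suc k)) - \<sigma> (r k)" for k
  have x: "x k \<in> points X" for k by (simp add: x_def diff_mem mem)
  have "npow p X (x k) < (1/2) ^ k" for k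
  proof -
    have "N k \<le> r (Suc k)" using rN[of k] strict_monoD[OF r, of k "Suc k"] by simp
    then show ?thesis using N[of k "r (Suc k)" "r k"] rN[of k] mem by (simp add: x_def pdist_eq)
  qed
  then have "summable (\<lambda>k. npow p X (x k))"
    by (intro summable_comparison_test'[OF summable_geometric[of "1/2::real"]])
      (auto intro: less_imp_le)
  from assms[OF x this] obtain z where z: "z \<in> points X"
    "(\<lambda>n. npow p X (z - (\<Sum>k<n. x k))) \<longlonglongrightarrow> 0" by blast
  have "(\<Sum>k<n. x k) = \<sigma> (r n) - \<sigma> (r 0)" for n
    by (induction n) (simp_all add: x_def)
  then have "z - (\<Sum>k<n. x k) = z + \<sigma> (r 0) - \<sigma> (r n)" for n
    by (simp only: diff_diff_eq2)
  then have "(\<lambda>n. npow p X (z + \<sigma> (r 0) - \<sigma> (r n))) \<longlonglongrightarrow> 0"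
    using z(2) by (simp only:)
  then have "(\<lambda>n. pdist p X ((\<sigma> \<circ> r) n) (z + \<sigma> (r 0))) \<longlonglongrightarrow> 0"
    using z mem by (simp add: pdist_eq add_mem npow_diff_commute[of "\<sigma> _"])
  then have "limitin M.mtopology (\<sigma> \<circ> r) (z + \<sigma> (r 0)) sequentially"
    using z mem by (simp add: M.limitin_metric_dist_null add_mem)
  then show "\<exists>x. limitin M.mtopology \<sigma> x sequentially"
    using M.MCauchy_convergent_subsequence[OF C r] by blast
qed

lemma npow_le_of_limit:
  assumes "z \<in> points X" "\<And>n. s n \<in> points X" "(\<lambda>n. npow p X (z - s n)) \<longlonglongrightarrow> 0"
    and "\<And>n. npow p X (s n) \<le> B"
  shows "npow p X z \<le> B"
proof -
  have "npow p X z \<le> B + npow p X (z - s n)" for n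
    using npow_le_add_diff[OF assms(1,2), of n] assms(4)[of n] by linarith
  moreover have "(\<lambda>n. B + npow p X (z - s n)) \<longlonglongrightarrow> B + 0"
    by (intro tendsto_intros assms)
  ultimately show ?thesis by (intro LIMSEQ_le_const[where x = B]) auto
qed

lemma limit_unique:
  assumes "z \<in> points X" "y \<in> points X" "\<And>n. s n \<in> points X"
    and "(\<lambda>n. npow p X (z - s n)) \<longlonglongrightarrow> 0" "(\<lambda>n. npow p X (y - s n)) \<longlonglongrightarrow> 0"
  shows "z = y"
proof -
  have "npow p X (z - y) \<le> npow p X (z - s n) + npow p X (y - s n)" for n
    using npow_diff[of "z - s n" "y - s n"] assms(1-3) diff_mem by simp
  moreover have "(\<lambda>n. npow p X (z - s n) + npow p X (y - s n)) \<longlonglongrightarrow> 0 + 0"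
    by (intro tendsto_intros assms)
  ultimately have "npow p X (z - y) \<le> 0" by (intro LIMSEQ_le_const[where x = 0]) auto
  then have "npow p X (z - y) = 0" using npow_nonneg[of "z - y"] by linarith
  then show ?thesis using npow_eq_0[of "z - y"] assms(1,2) diff_mem by simp
qed

end

lemma p_space_of_p_Banach: "0 < p \<Longrightarrow> p \<le> 1 \<Longrightarrow> p_Banach p X \<Longrightarrow> p_space p X"
  by (simp add: p_space_def p_Banach_def)

text \<open>By Baire's theorem the closure of the image of some ball contains a ball of Y.
  Translating it to 0 and rescaling gives every y an approximate preimage with half the error, and
  completeness of X sums the successive corrections.\<close>

theorem open_mapping:
  assumes p: "0 < p" "p \<le> 1" and BX: "p_Banach p X" and BY: "p_Banach p Y"
    and T: "bounded_operator X Y T" and onto: "T ` points X = points Y"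
  obtains C where "C > 0"
    "\<And>y. y \<in> points Y \<Longrightarrow> \<exists>x\<in>points X. T x = y \<and> npow p X x \<le> C * npow p Y y"
proof -
  interpret X: p_space p X using p_space_of_p_Banach[OF p BX] .
  interpret Y: p_space p Y using p_space_of_p_Banach[OF p BY] .
  have lin: "linear_operator X Y T" using T by (simp add: bounded_operator_def)
  note TD = bounded_operatorD[OF T]
  obtain K where K: "K > 0" "\<And>x. x \<in> points X \<Longrightarrow> npow p Y (T x) \<le> K * npow p X x"
    using T unfolding bounded_operator_iff[OF X.p_space_axioms Y.p_space_axioms] by blast
  define S where "S n = Y.M.mtopology closure_of (T ` {x \<in> points X. npow p X x \<le> real n})" for n
  have "\<exists>n. Y.M.mtopology interior_of (S n) \<noteq> {}"
  proof (rule ccontr)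
    assume "\<not> ?thesis"
    then have "Y.M.mtopology interior_of \<Union> (range S) = {}"
      using BY by (intro Y.M.metric_Baire_category_alt) (auto simp: p_Banach_def S_def)
    moreover have "\<Union> (range S) = points Y"
    proof
      show "\<Union> (range S) \<subseteq> points Y"
        using closure_of_subset_topspace[of Y.M.mtopology] by (auto simp: S_def)
      show "points Y \<subseteq> \<Union> (range S)"
      proof
        fix y assume "y \<in> points Y"
        then obtain x where x: "x \<in> points X" "y = T x" using onto by blast
        obtain n where "npow p X x \<le> real n" using real_arch_simple by blast
        then have "y \<in> T ` {x \<in> points X. npow p X x \<le> real n}" using x by blast
        also have "\<dots> \<subseteq> S n" unfolding S_def using TD(1) by (intro closure_of_subset) auto
        finally show "y \<in> \<Union> (range S)" by blast
      qed
    qed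
    ultimately have "points Y = {}"
      using interior_of_topspace[of Y.M.mtopology] by simp
    then show False using Y.zero_mem by blast
  qed
  then obtain n y0 r where r: "r > 0" and y0: "y0 \<in> points Y" and ball: "Y.M.mball y0 r \<subseteq> S n"
    unfolding Y.M.metric_interior_of by blast
  have near: "\<exists>x\<in>points X. npow p X x \<le> real n \<and> npow p Y (y - T x) < e"
    if "y \<in> points Y" "npow p Y (y - y0) < r" "e > 0" for y e
  proof -
    have "y \<in> Y.M.mball y0 r"
      using that y0 by (simp add: Y.M.in_mball Y.pdist_eq Y.npow_diff_commute)
    then have "y \<in> S n" using ball by blast
    then show ?thesis
      using that(3) TD(1) unfolding S_def Y.M.metric_closure_of
      by (auto simp: Y.M.in_mball Y.pdist_eq dest!: spec[of _ e])
  qed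
  have approx0: "\<exists>x\<in>points X. npow p X x \<le> 2 * real n \<and> npow p Y (y - T x) < e"
    if y: "y \<in> points Y" and yr: "npow p Y y < r" and e: "e > 0" for y e
  proof -
    \<comment> \<open>Here y is the difference of \<open>y0 + y\<close> and \<open>y0\<close>, two
      points of the ball filled by the closure; subtracting their approximate preimages moves the
      centre to 0 at the cost of doubling the bound n.\<close>
    obtain a where a: "a \<in> points X" "npow p X a \<le> real n" "npow p Y (y0 + y - T a) < e / 2"
      using near[of "y0 + y" "e / 2"] y y0 yr e Y.add_mem by auto
    obtain b where b: "b \<in> points X" "npow p X b \<le> real n" "npow p Y (y0 - T b) < e / 2"
      using near[of "y0" "e / 2"] y0 e r by auto
    have "y - T (a - b) = (y0 + y - T a) - (y0 - T b)"
      using X.linear_operator_diff[OF lin a(1) b(1)] by simp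
    then have "npow p Y (y - T (a - b)) \<le> npow p Y (y0 + y - T a) + npow p Y (y0 - T b)"
      using y y0 a(1) b(1) by (simp only: Y.npow_diff TD(1) Y.add_mem Y.diff_mem)
    then show ?thesis
      using a b X.npow_diff[OF a(1) b(1)] X.diff_mem by (intro bexI[of _ "a - b"]) auto
  qed
  \<comment> \<open>Rescaling brings \<open>npow p Y y\<close> to r / 2, so undoing it multiplies by
    \<open>2 * npow p Y y / r\<close>. The bound 2n is enlarged by 1 so that C is positive even for
    n = 0. An error below r / 4 becomes at most half of \<open>npow p Y y\<close>.\<close>
  define C where "C = 2 * (2 * real n + 1) / r"
  have C: "C > 0" using r by (simp add: C_def)
  have approx: "\<exists>x\<in>points X. npow p X x \<le> C * npow p Y y \<and> npow p Y (y - T x) \<le> npow p Y y / 2"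
    if y: "y \<in> points Y" for y
  proof (cases "y = 0")
    case True
    then show ?thesis using X.zero_mem X.linear_operator_0[OF lin] by (intro bexI[of _ 0]) auto
  next
    case False
    define c where "c = (r / (2 * npow p Y y)) powr (1 / p)"
    have N: "npow p Y y > 0" using Y.npow_pos[OF y False] .
    have cp: "\<bar>c\<bar> powr p = r / (2 * npow p Y y)" and c: "c > 0"
      using r N p by (simp_all add: c_def powr_powr)
    have "npow p Y (c *\<^sub>R y) < r" using cp N r by (simp add: Y.npow_scale[OF y])
    then obtain x where x: "x \<in> points X" "npow p X x \<le> 2 * real n" "npow p Y (c *\<^sub>R y - T x) < r / 4"
      using approx0[of "c *\<^sub>R y" "r / 4"] y r Y.scale_mem by auto
    have cx: "inverse c *\<^sub>R x \<in> points X" using x(1) X.scale_mem by blast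
    have ic: "\<bar>inverse c\<bar> powr p = 2 * npow p Y y / r"
      using cp c N r by (simp add: powr_divide inverse_eq_divide)
    have "npow p X (inverse c *\<^sub>R x) \<le> 2 * npow p Y y / r * (2 * real n + 1)"
      unfolding X.npow_scale[OF x(1)] ic using x(2) N r by (intro mult_left_mono) auto
    then have big: "npow p X (inverse c *\<^sub>R x) \<le> C * npow p Y y" by (simp add: C_def field_simps)
    have "y - T (inverse c *\<^sub>R x) = inverse c *\<^sub>R (c *\<^sub>R y - T x)"
      using c TD(3)[OF x(1)] by (simp add: scaleR_diff_right)
    then have "npow p Y (y - T (inverse c *\<^sub>R x)) = 2 * npow p Y y / r * npow p Y (c *\<^sub>R y - T x)"
      using ic Y.npow_scale[of "c *\<^sub>R y - T x" "inverse c"] Y.scale_mem[OF y] TD(1)[OF x(1)] Y.diff_mem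
      by simp
    moreover have "\<dots> \<le> 2 * npow p Y y / r * (r / 4)"
      using x(3) N r by (intro mult_left_mono) auto
    ultimately have "npow p Y (y - T (inverse c *\<^sub>R x)) \<le> 2 * npow p Y y / r * (r / 4)"
      by linarith
    then have small: "npow p Y (y - T (inverse c *\<^sub>R x)) \<le> npow p Y y / 2" using r by simp
    show ?thesis using cx big small by blast
  qed
  then obtain g where g: "\<And>y. y \<in> points Y \<Longrightarrow> g y \<in> points X \<and>
      npow p X (g y) \<le> C * npow p Y y \<and> npow p Y (y - T (g y)) \<le> npow p Y y / 2"
    by metis
  show thesis
  proof (rule that[of "2 * C"])
    show "0 < 2 * C" using C by simp
    fix y assume y: "y \<in> points Y"
    \<comment> \<open>The residual after k corrections. It halves each time, and the geometric
      series of the corrections explains the factor 2 in \<open>2 * C\<close>.\<close>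
    define v where "v k = ((\<lambda>u. u - T (g u)) ^^ k) y" for k
    have v0: "v 0 = y" and vS: "v (Suc k) = v k - T (g (v k))" for k by (simp_all add: v_def)
    have v: "v k \<in> points Y \<and> npow p Y (v k) \<le> (1/2) ^ k * npow p Y y" for k
    proof (induction k)
      case (Suc k)
      then show ?case using g[of "v k"] TD(1) by (auto simp: vS Y.diff_mem)
    qed (simp add: v0 y)
    define x where "x k = g (v k)" for k
    have x: "x k \<in> points X" for k using v g by (simp add: x_def)
    have xle: "npow p X (x k) \<le> C * npow p Y y * (1/2) ^ k" for k
    proof -
      have "npow p X (x k) \<le> C * npow p Y (v k)" using v g by (simp add: x_def)
      also have "\<dots> \<le> C * ((1/2) ^ k * npow p Y y)" using v C by (intro mult_left_mono) auto
      finally show ?thesis by (simp add: mult_ac)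
    qed
    have geo: "(\<lambda>k. C * npow p Y y * (1/2) ^ k) sums (C * npow p Y y * 2)"
      using sums_mult[OF geometric_sums[of "1/2::real"], of "C * npow p Y y"] by simp
    have "summable (\<lambda>k. npow p X (x k))"
      using xle by (intro summable_comparison_test'[OF sums_summable[OF geo]]) auto
    then obtain z where z: "z \<in> points X" and zl: "(\<lambda>n. npow p X (z - (\<Sum>k<n. x k))) \<longlonglongrightarrow> 0"
      using X.mcomplete_imp_series[of x] BX x by (auto simp: p_Banach_def)
    have sx: "(\<Sum>k<n. x k) \<in> points X" for n by (simp add: X.sum_mem x)
    have "npow p X z \<le> 2 * C * npow p Y y"
    proof (rule X.npow_le_of_limit[OF z sx zl])
      fix n
      have "npow p X (\<Sum>k<n. x k) \<le> (\<Sum>k<n. npow p X (x k))" by (rule X.npow_sum) (rule x)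
      also have "\<dots> \<le> (\<Sum>k<n. C * npow p Y y * (1/2) ^ k)" by (rule sum_mono) (rule xle)
      also have "\<dots> \<le> C * npow p Y y * 2"
        unfolding sums_unique[OF geo] using C
        by (intro sum_le_suminf sums_summable[OF geo]) auto
      finally show "npow p X (\<Sum>k<n. x k) \<le> 2 * C * npow p Y y" by simp
    qed
    moreover have "T z = y"
    proof (rule Y.limit_unique[OF TD(1)[OF z] y])
      show "T (\<Sum>k<n. x k) \<in> points Y" for n using TD(1) sx by blast
      have "npow p Y (T z - T (\<Sum>k<n. x k)) \<le> K * npow p X (z - (\<Sum>k<n. x k))" for n
        using K(2)[of "z - (\<Sum>k<n. x k)"] z sx X.linear_operator_diff[OF lin z sx] X.diff_mem by simp
      moreover have "(\<lambda>n. K * npow p X (z - (\<Sum>k<n. x k))) \<longlonglongrightarrow> 0"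
        by (rule tendsto_mult_right_zero[OF zl])
      ultimately show "(\<lambda>n. npow p Y (T z - T (\<Sum>k<n. x k))) \<longlonglongrightarrow> 0"
        by (rule real_tendsto_0_le[OF Y.npow_nonneg])
      have "y - T (\<Sum>k<n. x k) = v n" for n
      proof (induction n)
        case (Suc n)
        have "T ((\<Sum>k<n. x k) + x n) = T (\<Sum>k<n. x k) + T (x n)" using TD(2) sx x by blast
        then show ?case using Suc by (simp add: vS x_def algebra_simps)
      qed (simp add: v0 X.linear_operator_0[OF lin])
      then have "npow p Y (y - T (\<Sum>k<n. x k)) \<le> (1/2) ^ n * npow p Y y" for n
        using v by (simp only:)
      moreover have "(\<lambda>n. (1/2::real) ^ n * npow p Y y) \<longlonglongrightarrow> 0"
        by (intro tendsto_mult_left_zero LIMSEQ_realpow_zero) auto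
      ultimately show "(\<lambda>n. npow p Y (y - T (\<Sum>k<n. x k))) \<longlonglongrightarrow> 0"
        by (rule real_tendsto_0_le[OF Y.npow_nonneg])
    qed
    ultimately show "\<exists>x\<in>points X. T x = y \<and> npow p X x \<le> 2 * C * npow p Y y" using z by blast
  qed
qed

section \<open>Completeness of l_p and L_p\<close>

text \<open>An arbitrary measure is allowed so that counting measure yields l_p and
  \<open>haar\<close> yields L_p. Almost everywhere the p-th powers of the terms are summable; the
  terms are then eventually at most 1 in modulus, where |t| \<le> |t|^p, so the series itself
  converges and the tail of the p-th powers bounds the remainder.\<close>

lemma Riesz_Fischer:
  fixes f :: "nat \<Rightarrow> 'a \<Rightarrow> real"
  assumes p: "0 < p" "p \<le> 1"
    and [measurable]: "\<And>k. f k \<in> borel_measurable M"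
    and int: "\<And>k. integrable M (\<lambda>x. \<bar>f k x\<bar> powr p)"
    and sm: "summable (\<lambda>k. \<integral>x. \<bar>f k x\<bar> powr p \<partial>M)"
  defines "g \<equiv> \<lambda>x. \<Sum>k. f k x"
  shows "integrable M (\<lambda>x. \<bar>g x - (\<Sum>k<n. f k x)\<bar> powr p)"
    and "(\<integral>x. \<bar>g x - (\<Sum>k<n. f k x)\<bar> powr p \<partial>M) \<le> (\<Sum>k. \<integral>x. \<bar>f (k + n) x\<bar> powr p \<partial>M)"
proof -
  have nn: "0 \<le> (\<integral>x. \<bar>f k x\<bar> powr p \<partial>M)" for k by simp
  have sums: "(\<integral>\<^sup>+x. (\<Sum>k. ennreal (\<bar>f (k + n) x\<bar> powr p)) \<partial>M) =
      ennreal (\<Sum>k. \<integral>x. \<bar>f (k + n) x\<bar> powr p \<partial>M)" for n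
  proof -
    have "(\<integral>\<^sup>+x. (\<Sum>k. ennreal (\<bar>f (k + n) x\<bar> powr p)) \<partial>M) =
        (\<Sum>k. \<integral>\<^sup>+x. ennreal (\<bar>f (k + n) x\<bar> powr p) \<partial>M)"
      by (intro nn_integral_suminf) measurable
    also have "\<dots> = (\<Sum>k. ennreal (\<integral>x. \<bar>f (k + n) x\<bar> powr p \<partial>M))"
      by (intro suminf_cong nn_integral_eq_integral int) auto
    also have "\<dots> = ennreal (\<Sum>k. \<integral>x. \<bar>f (k + n) x\<bar> powr p \<partial>M)"
      by (intro suminf_ennreal2 summable_ignore_initial_segment[OF sm]) auto
    finally show ?thesis .
  qed
  have "AE x in M. (\<Sum>k. ennreal (\<bar>f k x\<bar> powr p)) \<noteq> \<infinity>"
    using sums[of 0] by (intro nn_integral_PInf_AE) auto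
  then have AE: "AE x in M. ennreal (\<bar>g x - (\<Sum>k<n. f k x)\<bar> powr p) \<le> (\<Sum>k. ennreal (\<bar>f (k + n) x\<bar> powr p))"
  proof (eventually_elim)
    case (elim x)
    have s: "summable (\<lambda>k. \<bar>f k x\<bar> powr p)"
      using elim by (intro summable_suminf_not_top) auto
    then have "(\<lambda>k. \<bar>f k x\<bar> powr p) \<longlonglongrightarrow> 0" by (rule summable_LIMSEQ_zero)
    then have "\<forall>\<^sub>F k in sequentially. \<bar>f k x\<bar> powr p < 1" by (rule order_tendstoD) simp
    then have "\<forall>\<^sub>F k in sequentially. norm (f k x) \<le> \<bar>f k x\<bar> powr p"
    proof eventually_elim
      case (elim k)
      have "\<bar>f k x\<bar> \<le> 1"
        using elim p powr_mono2[of p 1 "\<bar>f k x\<bar>"] by (cases "\<bar>f k x\<bar> \<le> 1") auto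
      then show ?case using powr_mono'[of p 1 "\<bar>f k x\<bar>"] p by (cases "f k x = 0") auto
    qed
    then have sf: "summable (\<lambda>k. f k x)" by (rule summable_comparison_test_ev[OF _ s])
    have s': "summable (\<lambda>k. \<bar>f (k + n) x\<bar> powr p)" using summable_ignore_initial_segment[OF s] .
    have "g x - (\<Sum>k<n. f k x) = (\<Sum>k. f (k + n) x)"
      using suminf_minus_initial_segment[OF sf, of n] by (simp add: g_def)
    moreover have "(\<lambda>m. \<Sum>k<m. f (k + n) x) \<longlonglongrightarrow> (\<Sum>k. f (k + n) x)"
      by (intro summable_LIMSEQ summable_ignore_initial_segment[OF sf])
    ultimately have "(\<lambda>m. \<bar>\<Sum>k<m. f (k + n) x\<bar> powr p) \<longlonglongrightarrow> \<bar>g x - (\<Sum>k<n. f k x)\<bar> powr p"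
      using p by (intro tendsto_powr' tendsto_rabs tendsto_const) auto
    then have "\<bar>g x - (\<Sum>k<n. f k x)\<bar> powr p \<le> (\<Sum>k. \<bar>f (k + n) x\<bar> powr p)"
    proof (rule LIMSEQ_le_const2, intro exI allI impI)
      fix m
      have "\<bar>\<Sum>k<m. f (k + n) x\<bar> powr p \<le> (\<Sum>k<m. \<bar>f (k + n) x\<bar> powr p)"
        by (rule abs_sum_powr_le[OF p])
      also have "\<dots> \<le> (\<Sum>k. \<bar>f (k + n) x\<bar> powr p)" by (intro sum_le_suminf s') auto
      finally show "\<bar>\<Sum>k<m. f (k + n) x\<bar> powr p \<le> (\<Sum>k. \<bar>f (k + n) x\<bar> powr p)" .
    qed
    then show ?case using s' by (subst suminf_ennreal2) (auto intro: ennreal_leI)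
  qed
  have [measurable]: "g \<in> borel_measurable M" unfolding g_def by measurable
  have le: "(\<integral>\<^sup>+x. ennreal (\<bar>g x - (\<Sum>k<n. f k x)\<bar> powr p) \<partial>M) \<le>
      ennreal (\<Sum>k. \<integral>x. \<bar>f (k + n) x\<bar> powr p \<partial>M)"
    using nn_integral_mono_AE[OF AE] by (simp add: sums)
  show int_g: "integrable M (\<lambda>x. \<bar>g x - (\<Sum>k<n. f k x)\<bar> powr p)"
    using le by (intro integrableI_bounded) (auto simp: le_less_trans top.not_eq_extremum)
  have "0 \<le> (\<Sum>k. \<integral>x. \<bar>f (k + n) x\<bar> powr p \<partial>M)"
    by (intro suminf_nonneg nn summable_ignore_initial_segment[OF sm])
  then show "(\<integral>x. \<bar>g x - (\<Sum>k<n. f k x)\<bar> powr p \<partial>M) \<le> (\<Sum>k. \<integral>x. \<bar>f (k + n) x\<bar> powr p \<partial>M)"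
    using le by (subst (asm) nn_integral_eq_integral[OF int_g]) auto
qed

lemma integrable_powr_add:
  fixes f g :: "'a \<Rightarrow> real"
  assumes p: "0 < p" "p \<le> 1" and [measurable]: "f \<in> borel_measurable M" "g \<in> borel_measurable M"
    and "integrable M (\<lambda>x. \<bar>f x\<bar> powr p)" "integrable M (\<lambda>x. \<bar>g x\<bar> powr p)"
  shows "integrable M (\<lambda>x. \<bar>f x + g x\<bar> powr p)"
    and "(\<integral>x. \<bar>f x + g x\<bar> powr p \<partial>M) \<le> (\<integral>x. \<bar>f x\<bar> powr p \<partial>M) + (\<integral>x. \<bar>g x\<bar> powr p \<partial>M)"
proof -
  have i: "integrable M (\<lambda>x. \<bar>f x\<bar> powr p + \<bar>g x\<bar> powr p)" using assms by simp
  show j: "integrable M (\<lambda>x. \<bar>f x + g x\<bar> powr p)"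
    by (rule Bochner_Integration.integrable_bound[OF i]) (auto simp: abs_add_powr_le[OF p])
  show "(\<integral>x. \<bar>f x + g x\<bar> powr p \<partial>M) \<le> (\<integral>x. \<bar>f x\<bar> powr p \<partial>M) + (\<integral>x. \<bar>g x\<bar> powr p \<partial>M)"
    unfolding Bochner_Integration.integral_add[OF assms(5,6), symmetric]
    by (rule integral_mono[OF j i]) (rule abs_add_powr_le[OF p])
qed

lemma summable_on_iff_integrable:
  fixes f :: "'a \<Rightarrow> real"
  shows "f summable_on UNIV \<longleftrightarrow> integrable (count_space UNIV) f"
  by (subst summable_on_iff_abs_summable_on_real)
    (simp only: abs_summable_equivalent Infinite_Set_Sum.abs_summable_on_def)

lemma infsum_eq_integral:
  fixes f :: "'a \<Rightarrow> real"
  assumes "integrable (count_space UNIV) f"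
  shows "infsum f UNIV = (\<integral>x. f x \<partial>count_space UNIV)"
  using infsetsum_infsum[of f UNIV] assms
  by (simp add: Infinite_Set_Sum.abs_summable_on_def infsetsum_def)

lemma infsum_powr_nonneg: "0 \<le> (\<Sum>\<^sub>\<infinity>i\<in>A. \<bar>f i :: real\<bar> powr p)"
  by (intro infsum_nonneg) simp

lemma mem_ell_p: "x \<in> points (ell_p p) \<longleftrightarrow> (\<lambda>i. \<bar>x i\<bar> powr p) summable_on UNIV"
  by (simp add: ell_p_def)

lemma npow_ell_p: "0 < p \<Longrightarrow> npow p (ell_p p) x = (\<Sum>\<^sub>\<infinity>i. \<bar>x i\<bar> powr p)"
  by (simp add: npow_def ell_p_def powr_powr infsum_powr_nonneg)

lemma mem_ell_p': "x \<in> points (ell_p p) \<longleftrightarrow> integrable (count_space UNIV) (\<lambda>i. \<bar>x i\<bar> powr p)"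
  by (simp add: mem_ell_p summable_on_iff_integrable)

lemma npow_ell_p':
  "0 < p \<Longrightarrow> x \<in> points (ell_p p) \<Longrightarrow> npow p (ell_p p) x = (\<integral>i. \<bar>x i\<bar> powr p \<partial>count_space UNIV)"
  unfolding mem_ell_p' by (simp add: npow_ell_p infsum_eq_integral)

lemma p_space_ell_p:
  assumes p: "0 < p" "p \<le> 1"
  shows "p_space p (ell_p p :: ('k \<Rightarrow> real) qspace)"
proof
  show "p_normed p (ell_p p :: ('k \<Rightarrow> real) qspace)"
  proof (rule p_normedI[OF p])
    have zero: "\<bar>0 x\<bar> powr p = 0" for x :: 'k using p by simp
    have scale: "\<bar>(c *\<^sub>R x) i\<bar> powr p = \<bar>c\<bar> powr p * \<bar>x i\<bar> powr p" for c and x :: "'k \<Rightarrow> real" and i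
      by (simp add: scaleR_fun_def abs_mult powr_mult)
    show "subspace (points (ell_p p :: ('k \<Rightarrow> real) qspace))"
    proof (rule subspaceI)
      show "0 \<in> points (ell_p p :: ('k \<Rightarrow> real) qspace)" by (simp add: mem_ell_p)
      show "x + y \<in> points (ell_p p)" if "x \<in> points (ell_p p)" "y \<in> points (ell_p p)"
        for x y :: "'k \<Rightarrow> real"
        using that integrable_powr_add(1)[OF p, of x "count_space UNIV" y] by (simp add: mem_ell_p')
      show "c *\<^sub>R x \<in> points (ell_p p)" if "x \<in> points (ell_p p)" for c and x :: "'k \<Rightarrow> real"
        using that by (simp add: mem_ell_p scale summable_on_cmult_right)
    qed
    fix x y :: "'k \<Rightarrow> real" and c :: real
    assume x: "x \<in> points (ell_p p)"
    show "0 \<le> qnorm (ell_p p) x" by (simp add: ell_p_def)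
    show "x = 0" if "qnorm (ell_p p) x = 0"
    proof
      fix i
      have "(\<Sum>\<^sub>\<infinity>i. \<bar>x i\<bar> powr p) = 0" using that by (simp add: ell_p_def)
      then have "\<bar>x i\<bar> powr p = 0"
        using x by (intro nonneg_infsum_le_0D[where f = "\<lambda>i. \<bar>x i\<bar> powr p" and A = UNIV])
          (auto simp: mem_ell_p)
      then show "x i = 0 i" by simp
    qed
    show "qnorm (ell_p p) (c *\<^sub>R x) = \<bar>c\<bar> * qnorm (ell_p p) x"
      using p by (simp add: ell_p_def scale infsum_cmult_right' powr_mult powr_powr)
    assume y: "y \<in> points (ell_p p)"
    have "x + y \<in> points (ell_p p)"
      using x y integrable_powr_add(1)[OF p, of x "count_space UNIV" y] by (simp add: mem_ell_p')
    then show "qnorm (ell_p p) (x + y) powr p \<le> qnorm (ell_p p) x powr p + qnorm (ell_p p) y powr p"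
      unfolding npow_def[symmetric]
      using integrable_powr_add(2)[OF p, of x "count_space UNIV" y] x y
      by (simp add: npow_ell_p'[OF p(1)] mem_ell_p'[symmetric])
  qed
qed (use p in auto)

lemma tail_tendsto_0:
  fixes a :: "nat \<Rightarrow> real"
  assumes "summable a"
  shows "(\<lambda>n. \<Sum>k. a (k + n)) \<longlonglongrightarrow> 0"
  using suminf_minus_initial_segment[OF assms] tendsto_diff[OF tendsto_const summable_LIMSEQ[OF assms], of "suminf a"]
  by simp

lemma sum_fun_apply: "(\<Sum>a\<in>A. f a) x = (\<Sum>a\<in>A. f a x)"
  for f :: "'a \<Rightarrow> 'b \<Rightarrow> 'c::comm_monoid_add"
  by (induction A rule: infinite_finite_induct) auto

lemma p_Banach_ell_p:
  assumes p: "0 < p" "p \<le> 1"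
  shows "p_Banach p (ell_p p :: ('k \<Rightarrow> real) qspace)"
proof -
  interpret p_space p "ell_p p :: ('k \<Rightarrow> real) qspace" by (rule p_space_ell_p[OF p])
  have M.mcomplete
  proof (rule series_imp_mcomplete)
    fix x :: "nat \<Rightarrow> 'k \<Rightarrow> real"
    assume mem: "\<And>k. x k \<in> points (ell_p p)" and "summable (\<lambda>k. npow p (ell_p p) (x k))"
    then have sm: "summable (\<lambda>k. \<integral>i. \<bar>x k i\<bar> powr p \<partial>count_space UNIV)"
      by (simp add: npow_ell_p' p)
    define z where "z i = (\<Sum>k. x k i)" for i
    have RF: "integrable (count_space UNIV) (\<lambda>i. \<bar>z i - (\<Sum>k<n. x k i)\<bar> powr p)"
      "(\<integral>i. \<bar>z i - (\<Sum>k<n. x k i)\<bar> powr p \<partial>count_space UNIV) \<le>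
         (\<Sum>k. \<integral>i. \<bar>x (k + n) i\<bar> powr p \<partial>count_space UNIV)" for n
      unfolding z_def using Riesz_Fischer[OF p, of x "count_space UNIV" n] mem sm by (auto simp: mem_ell_p')
    have d: "z - (\<Sum>k<n. x k) = (\<lambda>i. z i - (\<Sum>k<n. x k i))" for n
      by (auto simp: sum_fun_apply)
    have z: "z \<in> points (ell_p p)" using RF(1)[of 0] by (simp add: mem_ell_p')
    have "z - (\<Sum>k<n. x k) \<in> points (ell_p p)" for n
      using RF(1)[of n] by (simp add: mem_ell_p' d)
    then have "npow p (ell_p p) (z - (\<Sum>k<n. x k)) \<le>
        (\<Sum>k. \<integral>i. \<bar>x (k + n) i\<bar> powr p \<partial>count_space UNIV)" for n
      using RF(2)[of n] by (simp add: npow_ell_p' p d)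
    then have "(\<lambda>n. npow p (ell_p p) (z - (\<Sum>k<n. x k))) \<longlonglongrightarrow> 0"
      by (intro real_tendsto_0_le[OF _ _ tail_tendsto_0[OF sm]]) auto
    then show "\<exists>z\<in>points (ell_p p). (\<lambda>n. npow p (ell_p p) (z - (\<Sum>k<n. x k))) \<longlonglongrightarrow> 0"
      using z by blast
  qed
  then show ?thesis using p_normed by (simp add: p_Banach_def)
qed

section \<open>Classes of measurable functions as a p-Banach space\<close>

lemma L0_cases:
  obtains f where "f \<in> borel_measurable haar" "F = abs_L0 f"
  by (induction F rule: L0.abs_induct) auto

lemma abs_L0_eqI:
  assumes "f \<in> borel_measurable haar" "g \<in> borel_measurable haar" "AE x in haar. f x = g x"
  shows "abs_L0 f = abs_L0 g"
  by (rule Quotient3_rel_abs[OF Quotient3_L0]) (use assms in auto)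

lemma mem_Lp: "f \<in> borel_measurable haar \<Longrightarrow>
    abs_L0 f \<in> points (Lp_haar p) \<longleftrightarrow> integrable haar (\<lambda>x. \<bar>f x\<bar> powr p)"
  by (simp add: Lp_haar_def Lp_integrable.abs_eq)

lemma npow_Lp: "0 < p \<Longrightarrow> f \<in> borel_measurable haar \<Longrightarrow>
    npow p (Lp_haar p) (abs_L0 f) = (\<integral>x. \<bar>f x\<bar> powr p \<partial>haar)"
  by (simp add: npow_def Lp_haar_def Lp_qnorm.abs_eq powr_powr)

lemma abs_L0_add: "f \<in> borel_measurable haar \<Longrightarrow> g \<in> borel_measurable haar \<Longrightarrow>
    abs_L0 f + abs_L0 g = abs_L0 (\<lambda>x. f x + g x)"
  and abs_L0_diff: "f \<in> borel_measurable haar \<Longrightarrow> g \<in> borel_measurable haar \<Longrightarrow>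
    abs_L0 f - abs_L0 g = abs_L0 (\<lambda>x. f x - g x)"
  and abs_L0_scale: "f \<in> borel_measurable haar \<Longrightarrow> c *\<^sub>R abs_L0 f = abs_L0 (\<lambda>x. c * f x)"
  by (simp_all add: plus_L0.abs_eq minus_L0.abs_eq scaleR_L0.abs_eq)

lemma abs_L0_0: "abs_L0 (\<lambda>_. 0) = 0"
  by (simp add: zero_L0_def)

lemma abs_L0_sum: "(\<And>a. a \<in> A \<Longrightarrow> f a \<in> borel_measurable haar) \<Longrightarrow>
    (\<Sum>a\<in>A. abs_L0 (f a)) = abs_L0 (\<lambda>x. \<Sum>a\<in>A. f a x)"
proof (induction A rule: infinite_finite_induct)
  case (insert a A)
  then show ?case by (simp add: abs_L0_add borel_measurable_sum)
qed (simp_all add: abs_L0_0)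

lemma p_space_Lp:
  assumes p: "0 < p" "p \<le> 1"
  shows "p_space p (Lp_haar p :: 'k L0 qspace)"
proof
  show "p_normed p (Lp_haar p :: 'k L0 qspace)"
  proof (rule p_normedI[OF p])
    have add: "F + G \<in> points (Lp_haar p) \<and>
        npow p (Lp_haar p) (F + G) \<le> npow p (Lp_haar p) F + npow p (Lp_haar p) G"
      if "F \<in> points (Lp_haar p)" "G \<in> points (Lp_haar p)" for F G :: "'k L0"
    proof -
      obtain f where f: "f \<in> borel_measurable haar" and [simp]: "F = abs_L0 f" by (rule L0_cases)
      obtain g where g: "g \<in> borel_measurable haar" and [simp]: "G = abs_L0 g" by (rule L0_cases)
      note fg = f g
      show ?thesis
        using that integrable_powr_add[OF p fg] fg by (simp add: abs_L0_add mem_Lp npow_Lp p)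
    qed
    have scale: "c *\<^sub>R F \<in> points (Lp_haar p) \<and> qnorm (Lp_haar p) (c *\<^sub>R F) = \<bar>c\<bar> * qnorm (Lp_haar p) F"
      if "F \<in> points (Lp_haar p)" for c and F :: "'k L0"
    proof -
      obtain f where f: "f \<in> borel_measurable haar" and [simp]: "F = abs_L0 f" by (rule L0_cases)
      show ?thesis using that f p
        by (simp add: abs_L0_scale mem_Lp abs_mult powr_mult)
          (simp add: Lp_haar_def Lp_qnorm.abs_eq abs_mult powr_mult powr_powr)
    qed
    show "subspace (points (Lp_haar p :: 'k L0 qspace))"
      using add scale p by (intro subspaceI) (auto simp: mem_Lp simp flip: abs_L0_0)
    fix F G :: "'k L0" and c :: real
    assume F: "F \<in> points (Lp_haar p)"
    show "0 \<le> qnorm (Lp_haar p) F" by (simp add: Lp_haar_def Lp_qnorm.rep_eq)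
    show "F = 0" if "qnorm (Lp_haar p) F = 0"
    proof -
      obtain f where f: "f \<in> borel_measurable haar" and [simp]: "F = abs_L0 f" by (rule L0_cases)
      have "(\<integral>x. \<bar>f x\<bar> powr p \<partial>haar) = 0" using that f by (simp add: Lp_haar_def Lp_qnorm.abs_eq)
      then have "AE x in haar. \<bar>f x\<bar> powr p = 0"
        using F f by (subst (asm) integral_nonneg_eq_0_iff_AE) (auto simp: mem_Lp)
      then show ?thesis using f by (auto simp flip: abs_L0_0 intro!: abs_L0_eqI)
    qed
    show "qnorm (Lp_haar p) (c *\<^sub>R F) = \<bar>c\<bar> * qnorm (Lp_haar p) F" using scale F by blast
    assume "G \<in> points (Lp_haar p)"
    then show "qnorm (Lp_haar p) (F + G) powr p \<le> qnorm (Lp_haar p) F powr p + qnorm (Lp_haar p) G powr p"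
      using add F by (simp add: npow_def)
  qed
qed (use p in auto)

lemma p_Banach_Lp:
  assumes p: "0 < p" "p \<le> 1"
  shows "p_Banach p (Lp_haar p :: 'k L0 qspace)"
proof -
  interpret p_space p "Lp_haar p :: 'k L0 qspace" by (rule p_space_Lp[OF p])
  have M.mcomplete
  proof (rule series_imp_mcomplete)
    fix F :: "nat \<Rightarrow> 'k L0"
    assume mem: "\<And>k. F k \<in> points (Lp_haar p)" and sm: "summable (\<lambda>k. npow p (Lp_haar p) (F k))"
    have "\<exists>f. f \<in> borel_measurable haar \<and> F k = abs_L0 f" for k using L0_cases[of "F k"] by blast
    then obtain f where f [measurable]: "\<And>k. f k \<in> borel_measurable haar" and F: "\<And>k. F k = abs_L0 (f k)"
      by metis
    have int: "\<And>k. integrable haar (\<lambda>x. \<bar>f k x\<bar> powr p)" and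
      sm: "summable (\<lambda>k. \<integral>x. \<bar>f k x\<bar> powr p \<partial>haar)"
      using mem sm by (simp_all add: F mem_Lp npow_Lp p)
    define z where "z x = (\<Sum>k. f k x)" for x
    have z [measurable]: "z \<in> borel_measurable haar" unfolding z_def by measurable
    have RF: "integrable haar (\<lambda>x. \<bar>z x - (\<Sum>k<n. f k x)\<bar> powr p)"
      "(\<integral>x. \<bar>z x - (\<Sum>k<n. f k x)\<bar> powr p \<partial>haar) \<le> (\<Sum>k. \<integral>x. \<bar>f (k + n) x\<bar> powr p \<partial>haar)" for n
      unfolding z_def using Riesz_Fischer[OF p f int sm, of n] by auto
    have d: "abs_L0 z - (\<Sum>k<n. F k) = abs_L0 (\<lambda>x. z x - (\<Sum>k<n. f k x))" for n
      unfolding F by (subst abs_L0_sum) (auto intro!: abs_L0_diff)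
    have "npow p (Lp_haar p) (abs_L0 z - (\<Sum>k<n. F k)) \<le> (\<Sum>k. \<integral>x. \<bar>f (k + n) x\<bar> powr p \<partial>haar)" for n
      using RF(2)[of n] by (simp add: npow_Lp p d)
    then have "(\<lambda>n. npow p (Lp_haar p) (abs_L0 z - (\<Sum>k<n. F k))) \<longlonglongrightarrow> 0"
      by (intro real_tendsto_0_le[OF _ _ tail_tendsto_0[OF sm]]) auto
    moreover have "abs_L0 z \<in> points (Lp_haar p)" using RF(1)[of 0] by (simp add: mem_Lp)
    ultimately show "\<exists>z\<in>points (Lp_haar p). (\<lambda>n. npow p (Lp_haar p) (z - (\<Sum>k<n. F k))) \<longlonglongrightarrow> 0"
      by blast
  qed
  then show ?thesis using p_normed by (simp add: p_Banach_def)
qed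

section \<open>Cylinder functions and Rademacher functions\<close>

text \<open>A function of the coordinates in F is encoded by a function on subsets of F, a point
  being replaced by the set of its true coordinates. Integrals thus become sums over
  \<open>Pow F\<close> divided by \<open>2 ^ card F\<close>.\<close>

definition cyl :: "'k set \<Rightarrow> ('k set \<Rightarrow> real) \<Rightarrow> 'k L0" where
  "cyl F g = abs_L0 (\<lambda>x. g {k \<in> F. x k})"

definition rademacher :: "'k \<Rightarrow> 'k L0" where
  "rademacher a = abs_L0 (\<lambda>x. if x a then 1 else -1)"

lemma cylinder_function_eq:
  fixes g :: "'k set \<Rightarrow> real"
  assumes "finite F"
  shows "g {k \<in> F. x k} = (\<Sum>s\<in>Pow F. g s * indicator {x. \<forall>k\<in>F. x k \<in> {k \<in> s}} x)"
proof -
  have "(\<Sum>s\<in>Pow F. g s * indicator {x. \<forall>k\<in>F. x k \<in> {k \<in> s}} x) =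
      (\<Sum>s\<in>Pow F. if s = {k \<in> F. x k} then g s else 0)"
    by (intro sum.cong refl) (auto simp: indicator_def)
  also have "\<dots> = g {k \<in> F. x k}" using assms by (subst sum.delta) auto
  finally show ?thesis by simp
qed

lemma
  fixes g :: "'k set \<Rightarrow> real"
  assumes F: "finite F"
  shows borel_measurable_cylinder_function: "(\<lambda>x. g {k \<in> F. x k}) \<in> borel_measurable haar"
    and integrable_cylinder_function: "integrable haar (\<lambda>x. g {k \<in> F. x k})"
    and integral_cylinder_function: "(\<integral>x. g {k \<in> F. x k} \<partial>haar) = (\<Sum>s\<in>Pow F. g s) / 2 ^ card F"
proof -
  have [measurable]: "{x. \<forall>k\<in>F. x k \<in> {k \<in> s}} \<in> sets haar" for s
    by (rule cylinder_in_sets_haar[OF F])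
  have em: "emeasure haar {x. \<forall>k\<in>F. x k \<in> {k \<in> s}} = ennreal ((1/2) ^ card F)" for s
    unfolding emeasure_haar_cylinder[OF F] by (subst prod_ennreal) simp_all
  have m: "measure haar {x. \<forall>k\<in>F. x k \<in> {k \<in> s}} = (1/2) ^ card F" for s
    using em[of s] by (simp add: measure_def)
  have int: "integrable haar (indicator {x. \<forall>k\<in>F. x k \<in> {k \<in> s}} :: _ \<Rightarrow> real)" for s
    by (rule integrable_real_indicator) (rule cylinder_in_sets_haar[OF F], subst em, simp)
  show "(\<lambda>x. g {k \<in> F. x k}) \<in> borel_measurable haar"
    unfolding cylinder_function_eq[OF F, of g] by measurable
  show "integrable haar (\<lambda>x. g {k \<in> F. x k})"
    unfolding cylinder_function_eq[OF F, of g]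
    by (intro Bochner_Integration.integrable_sum integrable_mult_right int)
  have "(\<integral>x. g {k \<in> F. x k} \<partial>haar) =
      (\<Sum>s\<in>Pow F. g s * (\<integral>x. indicator {x. \<forall>k\<in>F. x k \<in> {k \<in> s}} x \<partial>haar))"
    unfolding cylinder_function_eq[OF F, of g]
    by (subst Bochner_Integration.integral_sum, intro integrable_mult_right int) simp
  also have "\<dots> = (\<Sum>s\<in>Pow F. g s * (1/2) ^ card F)"
    using m by simp
  finally show "(\<integral>x. g {k \<in> F. x k} \<partial>haar) = (\<Sum>s\<in>Pow F. g s) / 2 ^ card F"
    by (simp add: sum_divide_distrib power_divide)
qed

lemma cyl_mem: "finite F \<Longrightarrow> cyl F g \<in> points (Lp_haar p)"
  unfolding cyl_def
  using integrable_cylinder_function[of F "\<lambda>s. \<bar>g s\<bar> powr p"]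
  by (simp add: mem_Lp borel_measurable_cylinder_function)

lemma npow_cyl:
  "0 < p \<Longrightarrow> finite F \<Longrightarrow> npow p (Lp_haar p) (cyl F g) = (\<Sum>s\<in>Pow F. \<bar>g s\<bar> powr p) / 2 ^ card F"
  unfolding cyl_def
  using integral_cylinder_function[of F "\<lambda>s. \<bar>g s\<bar> powr p"]
  by (simp add: npow_Lp borel_measurable_cylinder_function)

lemma cyl_sum_scale:
  assumes "finite F"
  shows "(\<Sum>a\<in>A. c a *\<^sub>R cyl F (g a)) = cyl F (\<lambda>s. \<Sum>a\<in>A. c a * g a s)"
proof -
  have m: "(\<lambda>x. c a * g a {k \<in> F. x k}) \<in> borel_measurable haar" for a
    using borel_measurable_cylinder_function[OF assms, of "\<lambda>s. c a * g a s"] .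
  show ?thesis
    unfolding cyl_def abs_L0_sum[OF m, symmetric]
    by (simp add: abs_L0_scale borel_measurable_cylinder_function[OF assms])
qed

lemma cyl_mono:
  assumes "F \<subseteq> G"
  shows "cyl F g = cyl G (\<lambda>s. g (s \<inter> F))"
proof -
  have "{k \<in> G. x k} \<inter> F = {k \<in> F. x k}" for x using assms by auto
  then show ?thesis by (simp add: cyl_def)
qed

text \<open>The indicators of the cells on which all coordinates in F are fixed.\<close>

definition atoms :: "'k set \<Rightarrow> 'k L0 set" where
  "atoms F = (\<lambda>s. cyl F (\<lambda>t. of_bool (t = s))) ` Pow F"

lemma sum_of_bool_Pow:
  "finite F \<Longrightarrow> s \<subseteq> F \<Longrightarrow> (\<Sum>t\<in>Pow F. c t * of_bool (s = t)) = (c s :: real)"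
  using sum.delta[of "Pow F" s c] by (simp add: of_bool_def if_distrib cong: if_cong)

lemma cyl_eq_sum:
  assumes "finite F"
  shows "cyl F g = (\<Sum>s\<in>Pow F. g s *\<^sub>R cyl F (\<lambda>t. of_bool (t = s)))"
proof -
  have "g {k \<in> F. x k} = (\<Sum>s\<in>Pow F. g s * of_bool ({k \<in> F. x k} = s))" for x
    using sum_of_bool_Pow[OF assms, of "{k \<in> F. x k}" g] by simp
  then show ?thesis unfolding cyl_sum_scale[OF assms] by (simp add: cyl_def)
qed

lemma cyl_in_span_atoms: "finite F \<Longrightarrow> cyl F g \<in> span (atoms F)"
  by (subst cyl_eq_sum, assumption, intro span_sum span_scale, rule span_base) (auto simp: atoms_def)

lemma finite_atoms: "finite F \<Longrightarrow> finite (atoms F)"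
  by (simp add: atoms_def)

lemma atoms_mem: "finite F \<Longrightarrow> atoms F \<subseteq> points (Lp_haar p)"
  by (auto simp: atoms_def cyl_mem)

lemma npow_atom: "0 < p \<Longrightarrow> finite F \<Longrightarrow> b \<in> atoms F \<Longrightarrow> npow p (Lp_haar p) b = 1 / 2 ^ card F"
proof -
  assume "0 < p" and F: "finite F" and "b \<in> atoms F"
  then obtain s where s: "s \<subseteq> F" and b: "b = cyl F (\<lambda>t. of_bool (t = s))" by (auto simp: atoms_def)
  have "(\<Sum>t\<in>Pow F. \<bar>of_bool (t = s)\<bar> powr p) = (\<Sum>t\<in>Pow F. if t = s then 1 else (0::real))"
    using \<open>0 < p\<close> by (intro sum.cong) auto
  then show ?thesis using s F \<open>0 < p\<close> by (simp add: b npow_cyl)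
qed

lemma npow_Lp_0: "0 < p \<Longrightarrow> p \<le> 1 \<Longrightarrow> npow p (Lp_haar p) 0 = 0"
  by (rule p_space.npow_0[OF p_space_Lp])

text \<open>Every cell has positive measure, so distinct cells stay distinct modulo null sets, and
  sums over the set \<open>atoms F\<close> can be reindexed over \<open>Pow F\<close>. As the claim
  does not involve p, the norm for exponent 1 serves as the test.\<close>

lemma inj_on_atom:
  assumes F: "finite F"
  shows "inj_on (\<lambda>s. cyl F (\<lambda>t. of_bool (t = s))) (Pow F)"
proof (rule inj_onI, rule ccontr)
  fix s u assume s: "s \<in> Pow F" and u: "u \<in> Pow F" and "s \<noteq> u"
    and eq: "cyl F (\<lambda>t. of_bool (t = s)) = cyl F (\<lambda>t. of_bool (t = u))"
  define g where "g t = (of_bool (t = s) - of_bool (t = u) :: real)" for t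
  have "cyl F g = cyl F (\<lambda>t. of_bool (t = s)) - cyl F (\<lambda>t. of_bool (t = u))"
    unfolding cyl_def g_def using F
    by (subst abs_L0_diff)
      (auto intro!: borel_measurable_cylinder_function[of F "\<lambda>t. of_bool (t = _)", simplified])
  then have "npow 1 (Lp_haar 1) (cyl F g) = 0"
    using eq by (simp add: npow_Lp_0)
  then have "(\<Sum>t\<in>Pow F. \<bar>g t\<bar>) = 0" using F by (simp add: npow_cyl)
  then have "\<bar>g s\<bar> = 0" using F s by (simp add: sum_nonneg_eq_0_iff)
  then show False using \<open>s \<noteq> u\<close> by (simp add: g_def)
qed

text \<open>The cells are disjoint, so the p-th powers add without cross terms. Equality matters: it
  lets bounds for individual atoms pass to their span with the same constant.\<close>

lemma npow_sum_atoms: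
  assumes p: "0 < p" and F: "finite F"
  shows "npow p (Lp_haar p) (\<Sum>b\<in>atoms F. c b *\<^sub>R b) = (\<Sum>b\<in>atoms F. \<bar>c b\<bar> powr p * npow p (Lp_haar p) b)"
proof -
  let ?b = "\<lambda>s. cyl F (\<lambda>t. of_bool (t = s))"
  have "(\<Sum>b\<in>atoms F. c b *\<^sub>R b) = (\<Sum>s\<in>Pow F. c (?b s) *\<^sub>R ?b s)"
    unfolding atoms_def by (subst sum.reindex[OF inj_on_atom[OF F]]) simp
  also have "\<dots> = cyl F (\<lambda>s. c (?b s))"
    by (rule cyl_eq_sum[OF F, symmetric])
  finally have "npow p (Lp_haar p) (\<Sum>b\<in>atoms F. c b *\<^sub>R b) = (\<Sum>s\<in>Pow F. \<bar>c (?b s)\<bar> powr p) / 2 ^ card F"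
    using p F by (simp add: npow_cyl)
  also have "\<dots> = (\<Sum>b\<in>atoms F. \<bar>c b\<bar> powr p * (1 / 2 ^ card F))"
    unfolding atoms_def by (subst sum.reindex[OF inj_on_atom[OF F]]) (simp add: sum_divide_distrib)
  also have "\<dots> = (\<Sum>b\<in>atoms F. \<bar>c b\<bar> powr p * npow p (Lp_haar p) b)"
    by (intro sum.cong refl) (simp add: npow_atom[OF p F])
  finally show ?thesis .
qed

lemma independent_atoms:
  assumes F: "finite F"
  shows "independent (atoms F)"
proof (rule independent_if_scalars_zero[OF finite_atoms[OF F]])
  fix c b assume "(\<Sum>b\<in>atoms F. c b *\<^sub>R b) = 0" and b: "b \<in> atoms F"
  then have "(\<Sum>b\<in>atoms F. \<bar>c b\<bar> powr 1 * npow 1 (Lp_haar 1) b) = 0"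
    using npow_sum_atoms[OF zero_less_one F, of c] by (simp add: npow_Lp_0)
  then have "\<bar>c b\<bar> powr 1 * npow 1 (Lp_haar 1) b = 0"
    using b finite_atoms[OF F] by (subst (asm) sum_nonneg_eq_0_iff) (auto simp: npow_def)
  then show "c b = 0" using npow_atom[OF zero_less_one F b] by simp
qed

text \<open>A function of the coordinates in F is also one of those in G. This makes the spans a
  directed system.\<close>

lemma span_atoms_mono:
  assumes "F \<subseteq> G" "finite G"
  shows "span (atoms F) \<subseteq> span (atoms G)"
proof (rule span_minimal)
  show "atoms F \<subseteq> span (atoms G)"
    using assms cyl_mono[OF assms(1)] by (auto simp: atoms_def[of F] intro: cyl_in_span_atoms)
qed simp

lemma rademacher_eq_cyl: "a \<in> F \<Longrightarrow> rademacher a = cyl F (\<lambda>s. if a \<in> s then 1 else -1)"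
  by (simp add: rademacher_def cyl_def)

lemma sum_rademacher: "finite A \<Longrightarrow> sum rademacher A = cyl A (\<lambda>s. \<Sum>a\<in>A. if a \<in> s then 1 else -1)"
  using cyl_sum_scale[of A "\<lambda>_. 1" "\<lambda>a s. if a \<in> s then 1 else -1" A]
  by (simp add: rademacher_eq_cyl[of _ A])

lemma rademacher_in_span: "rademacher a \<in> span (atoms {a})"
  by (simp add: rademacher_eq_cyl[of a "{a}"] cyl_in_span_atoms)

lemma rademacher_mem: "rademacher a \<in> points (Lp_haar p)"
  by (simp add: rademacher_eq_cyl[of a "{a}"] cyl_mem)

lemma npow_rademacher: 
  assumes "0 < p"
  shows "npow p (Lp_haar p) (rademacher a) = 1"
proof -
  have "\<bar>if a \<in> s then 1 else - 1 :: real\<bar> powr p = 1" for s by simp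
  then show ?thesis using assms
    unfolding rademacher_eq_cyl[of a "{a}", OF singletonI] by (subst npow_cyl) (simp_all add: card_Pow)
qed

text \<open>This is the second moment of a Rademacher sum before normalisation. Splitting the
  subsets by whether they contain the new element b reduces it to (f - 1)^2 + (1 + f)^2 = 2 f^2 +
  2.\<close>

lemma sum_sign_squares:
  assumes "finite A"
  shows "(\<Sum>s\<in>Pow A. (\<Sum>a\<in>A. if a \<in> s then 1 else -1 :: real)\<^sup>2) = card A * 2 ^ card A"
  using assms
proof (induction A rule: finite_induct)
  case (insert b A)
  define f where "f s = (\<Sum>a\<in>A. if a \<in> s then 1 else -1 :: real)" for s
  have f: "f (insert b s) = f s" for s
    unfolding f_def using insert.hyps by (intro sum.cong) auto
  have inj: "inj_on (insert b) (Pow A)" using insert.hyps by (auto simp: inj_on_def)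
  have disj: "Pow A \<inter> insert b ` Pow A = {}" using insert.hyps by auto
  have "(\<Sum>s\<in>Pow (insert b A). (\<Sum>a\<in>insert b A. if a \<in> s then 1 else -1 :: real)\<^sup>2) =
      (\<Sum>s\<in>Pow (insert b A). ((if b \<in> s then 1 else -1) + f s)\<^sup>2)"
    using insert.hyps by (simp add: f_def)
  also have "\<dots> = (\<Sum>s\<in>Pow A. ((if b \<in> s then 1 else -1) + f s)\<^sup>2) + (\<Sum>s\<in>Pow A. (1 + f s)\<^sup>2)"
    unfolding Pow_insert using insert.hyps disj
    by (subst sum.union_disjoint) (simp_all add: sum.reindex[OF inj] f)
  also have "(\<Sum>s\<in>Pow A. ((if b \<in> s then 1 else -1) + f s)\<^sup>2) = (\<Sum>s\<in>Pow A. (f s - 1)\<^sup>2)"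
    using insert.hyps by (intro sum.cong) auto
  also have "\<dots> + (\<Sum>s\<in>Pow A. (1 + f s)\<^sup>2) = (\<Sum>s\<in>Pow A. 2 * (f s)\<^sup>2 + 2)"
    unfolding sum.distrib[symmetric] by (intro sum.cong) (simp_all add: power2_eq_square algebra_simps)
  also have "\<dots> = 2 * (card A * 2 ^ card A) + 2 * 2 ^ card A"
    using insert.IH insert.hyps
    by (simp add: sum.distrib sum_distrib_left[symmetric] f_def card_Pow)
  finally show ?case using insert.hyps by (simp add: algebra_simps)
qed simp

text \<open>The constant 2 is not optimal, but the pointwise bound below avoids Jensen's inequality.\<close>

lemma npow_sum_rademacher_le:
  assumes p: "0 < p" "p \<le> 1" and A: "finite A" "A \<noteq> {}"
  shows "npow p (Lp_haar p) (sum rademacher A) \<le> 2 * real (card A) powr (p / 2)"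
proof -
  define n where "n = real (card A)"
  have n: "n > 0" using A by (simp add: n_def card_gt_0_iff)
  \<comment> \<open>The threshold n is the mean of t^2 for a sum t of n signs. Below it the first
    term suffices; above it the second does, because p/2 - 1 is negative and t^2 exceeds n.\<close>
  have bound: "\<bar>t\<bar> powr p \<le> n powr (p / 2) + n powr (p / 2 - 1) * t\<^sup>2" for t :: real
  proof -
    have eq: "\<bar>t\<bar> powr p = (t\<^sup>2) powr (p / 2)"
    proof -
      have "t\<^sup>2 = \<bar>t\<bar> powr 2" by (cases "t = 0") (simp_all add: powr_numeral)
      then show ?thesis by (simp only: powr_powr) simp
    qed
    show ?thesis
    proof (cases "t\<^sup>2 \<le> n")
      case True
      then have "(t\<^sup>2) powr (p / 2) \<le> n powr (p / 2)" using p by (intro powr_mono2) auto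
      then show ?thesis by (simp add: eq add_increasing2)
    next
      case False
      have "(t\<^sup>2) powr (p / 2) = (t\<^sup>2) powr (p / 2 - 1) * t\<^sup>2"
        using False n powr_add[of "t\<^sup>2" "p / 2 - 1" 1] by simp
      also have "\<dots> \<le> n powr (p / 2 - 1) * t\<^sup>2"
        using False n p by (intro mult_right_mono powr_mono2') auto
      finally show ?thesis by (simp add: eq add_increasing)
    qed
  qed
  let ?S = "\<lambda>s. \<Sum>a\<in>A. if a \<in> s then 1 else -1 :: real"
  have "npow p (Lp_haar p) (sum rademacher A) = (\<Sum>s\<in>Pow A. \<bar>?S s\<bar> powr p) / 2 ^ card A"
    using A p by (simp add: sum_rademacher npow_cyl)
  also have "\<dots> \<le> (\<Sum>s\<in>Pow A. n powr (p / 2) + n powr (p / 2 - 1) * (?S s)\<^sup>2) / 2 ^ card A"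
    by (intro divide_right_mono sum_mono bound) simp
  also have "\<dots> = n powr (p / 2) + n powr (p / 2 - 1) * n"
    using A sum_sign_squares[OF A(1)]
    by (simp add: sum.distrib sum_distrib_left[symmetric] card_Pow add_divide_distrib n_def)
  also have "\<dots> = 2 * n powr (p / 2)" using n powr_add[of n "p / 2 - 1" 1] by simp
  finally show ?thesis by (simp add: n_def)
qed

section \<open>Restrictions and slices in l_p\<close>

lemma ell_p_sum_le:
  assumes "0 < p" "x \<in> points (ell_p p)" "finite F"
  shows "(\<Sum>i\<in>F. \<bar>x i\<bar> powr p) \<le> npow p (ell_p p) x"
  using assms unfolding npow_ell_p[OF assms(1)] mem_ell_p by (intro finite_sum_le_infsum) auto

lemma ell_p_coord_le:
  "0 < p \<Longrightarrow> x \<in> points (ell_p p) \<Longrightarrow> \<bar>x i\<bar> powr p \<le> npow p (ell_p p) x"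
  using ell_p_sum_le[of p x "{i}"] by simp

text \<open>Only finite partial sums are tested, which makes bounds stable under coordinatewise
  limits and under regrouping into slices.\<close>

lemma ell_p_boundedI:
  assumes "0 < p" and bd: "\<And>F. finite F \<Longrightarrow> (\<Sum>i\<in>F. \<bar>x i\<bar> powr p) \<le> B"
  shows "x \<in> points (ell_p p)" "npow p (ell_p p) x \<le> B"
proof -
  show x: "x \<in> points (ell_p p)"
    unfolding mem_ell_p using bd by (intro nonneg_bdd_above_summable_on bdd_aboveI2[where M = B]) auto
  show "npow p (ell_p p) x \<le> B"
    using x bd unfolding npow_ell_p[OF assms(1)] mem_ell_p by (intro infsum_le_finite_sums) auto
qed

lemma has_sum_sum:
  fixes f :: "'b \<Rightarrow> 'a \<Rightarrow> 'c::topological_comm_monoid_add"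
  assumes "\<And>k. k \<in> B \<Longrightarrow> (f k has_sum s k) A"
  shows "((\<lambda>i. \<Sum>k\<in>B. f k i) has_sum (\<Sum>k\<in>B. s k)) A"
  using assms
  by (induction B rule: infinite_finite_induct) (auto intro: has_sum_add has_sum_0)

lemma infsum_sum:
  fixes f :: "'b \<Rightarrow> 'a \<Rightarrow> 'c::{topological_comm_monoid_add, t2_space}"
  assumes "\<And>k. k \<in> B \<Longrightarrow> f k summable_on A"
  shows "infsum (\<lambda>i. \<Sum>k\<in>B. f k i) A = (\<Sum>k\<in>B. infsum (f k) A)"
    and "(\<lambda>i. \<Sum>k\<in>B. f k i) summable_on A"
proof -
  have "((\<lambda>i. \<Sum>k\<in>B. f k i) has_sum (\<Sum>k\<in>B. infsum (f k) A)) A"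
    using assms by (intro has_sum_sum has_sum_infsum)
  then show "infsum (\<lambda>i. \<Sum>k\<in>B. f k i) A = (\<Sum>k\<in>B. infsum (f k) A)"
    and "(\<lambda>i. \<Sum>k\<in>B. f k i) summable_on A"
    by (auto simp: infsumI summable_on_def)
qed

lemma countable_support: "x \<in> points (ell_p p) \<Longrightarrow> countable {i. x i \<noteq> 0}"
  using summable_countable_real[of "\<lambda>i. \<bar>x i\<bar> powr p" UNIV] by (simp add: mem_ell_p)

text \<open>For p \<le> 1 the space l_p lies in l_1: the p-th power of a finite sum of moduli is at
  most the sum of their p-th powers.\<close>

lemma abs_summable_ell_p:
  assumes p: "0 < p" "p \<le> 1" and x: "x \<in> points (ell_p p)"
  shows "x summable_on UNIV" and "\<bar>infsum x UNIV\<bar> powr p \<le> npow p (ell_p p) x"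
proof -
  let ?N = "npow p (ell_p p) x"
  have fin: "(\<Sum>i\<in>F. \<bar>x i\<bar>) \<le> ?N powr (1 / p)" if "finite F" for F
  proof -
    have "(\<Sum>i\<in>F. \<bar>x i\<bar>) powr p \<le> ?N"
      using abs_sum_powr_le[OF p, of "\<lambda>i. \<bar>x i\<bar>" F] ell_p_sum_le[OF p(1) x that]
      by (simp add: sum_nonneg)
    then have "((\<Sum>i\<in>F. \<bar>x i\<bar>) powr p) powr (1 / p) \<le> ?N powr (1 / p)"
      using p by (intro powr_mono2) auto
    then show ?thesis using p by (simp add: powr_powr sum_nonneg)
  qed
  have s: "(\<lambda>i. \<bar>x i\<bar>) summable_on UNIV"
    using fin by (intro nonneg_bdd_above_summable_on bdd_aboveI2[where M = "?N powr (1 / p)"]) auto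
  then show "x summable_on UNIV" by (subst summable_on_iff_abs_summable_on_real) simp
  have "\<bar>infsum x UNIV\<bar> \<le> (\<Sum>\<^sub>\<infinity>i. \<bar>x i\<bar>)"
    using norm_infsum_bound[of x UNIV] s by simp
  also have "\<dots> \<le> ?N powr (1 / p)" using fin s by (intro infsum_le_finite_sums) auto
  finally have "\<bar>infsum x UNIV\<bar> powr p \<le> (?N powr (1 / p)) powr p"
    using p by (intro powr_mono2) auto
  then show "\<bar>infsum x UNIV\<bar> powr p \<le> ?N" using p by (simp add: powr_powr infsum_powr_nonneg npow_ell_p)
qed

definition coord_restrict :: "'g set \<Rightarrow> ('g \<Rightarrow> real) \<Rightarrow> 'g \<Rightarrow> real" where
  "coord_restrict A x = (\<lambda>i. if i \<in> A then x i else 0)"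

lemma coord_restrict_mem:
  assumes "0 < p" "x \<in> points (ell_p p)"
  shows "coord_restrict A x \<in> points (ell_p p)"
proof (rule ell_p_boundedI(1)[OF assms(1)])
  fix F :: "'a set" assume "finite F"
  then show "(\<Sum>i\<in>F. \<bar>coord_restrict A x i\<bar> powr p) \<le> npow p (ell_p p) x"
    using ell_p_sum_le[OF assms \<open>finite F\<close>] sum_mono[of F "\<lambda>i. \<bar>coord_restrict A x i\<bar> powr p" "\<lambda>i. \<bar>x i\<bar> powr p"]
    by (force simp: coord_restrict_def)
qed

text \<open>At each coordinate at most one restriction is nonzero. This is the lower p-estimate that
  makes n disjoint parts cost a multiple of n in the final count.\<close>

lemma sum_npow_coord_restrict_le:
  assumes p: "0 < p" and x: "x \<in> points (ell_p p)" and B: "finite B" "disjoint_family_on A B"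
  shows "(\<Sum>k\<in>B. npow p (ell_p p) (coord_restrict (A k) x)) \<le> npow p (ell_p p) x"
proof -
  have "(\<Sum>k\<in>B. npow p (ell_p p) (coord_restrict (A k) x)) = (\<Sum>\<^sub>\<infinity>i. \<Sum>k\<in>B. \<bar>coord_restrict (A k) x i\<bar> powr p)"
    unfolding npow_ell_p[OF p] using coord_restrict_mem[OF p x] by (subst infsum_sum(1)) (auto simp: mem_ell_p)
  also have "\<dots> \<le> (\<Sum>\<^sub>\<infinity>i. \<bar>x i\<bar> powr p)"
  proof (rule infsum_mono)
    show "(\<lambda>i. \<Sum>k\<in>B. \<bar>coord_restrict (A k) x i\<bar> powr p) summable_on UNIV"
      using coord_restrict_mem[OF p x] by (intro infsum_sum(2)) (auto simp: mem_ell_p)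
    show "(\<lambda>i. \<bar>x i\<bar> powr p) summable_on UNIV" using x by (simp add: mem_ell_p)
    fix i
    show "(\<Sum>k\<in>B. \<bar>coord_restrict (A k) x i\<bar> powr p) \<le> \<bar>x i\<bar> powr p"
    proof (cases "\<exists>k\<in>B. i \<in> A k")
      case True
      then obtain k where k: "k \<in> B" "i \<in> A k" by blast
      then have "i \<notin> A l" if "l \<in> B" "l \<noteq> k" for l
        using B(2) that unfolding disjoint_family_on_def by blast
      then have "(\<Sum>l\<in>B. \<bar>coord_restrict (A l) x i\<bar> powr p) = (\<Sum>l\<in>{k}. \<bar>coord_restrict (A l) x i\<bar> powr p)"
        using k B(1) by (intro sum.mono_neutral_right) (auto simp: coord_restrict_def)
      then show ?thesis using k by (simp add: coord_restrict_def)
    qed (simp add: coord_restrict_def)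
  qed
  finally show ?thesis by (simp add: npow_ell_p p)
qed

lemma npow_coord_restrict_small:
  assumes p: "0 < p" and x: "x \<in> points (ell_p p)" and e: "0 < e"
  obtains F where "finite F" "\<And>A. A \<inter> F = {} \<Longrightarrow> npow p (ell_p p) (coord_restrict A x) < e"
proof -
  have "((\<lambda>F. \<Sum>i\<in>F. \<bar>x i\<bar> powr p) \<longlongrightarrow> npow p (ell_p p) x) (finite_subsets_at_top UNIV)"
    unfolding npow_ell_p[OF p] using x by (intro infsum_tendsto) (simp add: mem_ell_p)
  then have "\<forall>\<^sub>F F in finite_subsets_at_top UNIV. npow p (ell_p p) x - e < (\<Sum>i\<in>F. \<bar>x i\<bar> powr p)"
    using e by (intro order_tendstoD) auto
  then obtain F where F: "finite F" "npow p (ell_p p) x - e < (\<Sum>i\<in>F. \<bar>x i\<bar> powr p)"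
    by (auto simp: eventually_finite_subsets_at_top)
  show thesis
  proof (rule that[OF F(1)])
    fix A :: "'a set" assume A: "A \<inter> F = {}"
    have "(\<Sum>i\<in>F. \<bar>x i\<bar> powr p) = (\<Sum>i\<in>F. \<bar>coord_restrict F x i\<bar> powr p)"
      by (intro sum.cong) (auto simp: coord_restrict_def)
    also have "\<dots> \<le> npow p (ell_p p) (coord_restrict F x)"
      using F coord_restrict_mem[OF p x] by (intro ell_p_sum_le[OF p])
    finally have "(\<Sum>i\<in>F. \<bar>x i\<bar> powr p) \<le> npow p (ell_p p) (coord_restrict F x)" .
    moreover have "(\<Sum>b\<in>UNIV. npow p (ell_p p) (coord_restrict (if b then A else F) x)) \<le> npow p (ell_p p) x"
      using A by (intro sum_npow_coord_restrict_le[OF p x]) (auto simp: disjoint_family_on_def)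
    ultimately show "npow p (ell_p p) (coord_restrict A x) < e" using F(2) by (simp add: UNIV_bool)
  qed
qed

text \<open>An element of l_p over pairs is read as a family of elements of l_p; this is the form in
  which decompositions of kernel elements are stored.\<close>

definition slice :: "'i \<Rightarrow> ('i \<times> 'k \<Rightarrow> real) \<Rightarrow> 'k \<Rightarrow> real" where
  "slice i y = (\<lambda>a. y (i, a))"

definition sum_slices :: "('i \<times> 'k \<Rightarrow> real) \<Rightarrow> 'k \<Rightarrow> real" where
  "sum_slices y = (\<lambda>a. \<Sum>\<^sub>\<infinity>i. y (i, a))"

lemma slice_mem:
  assumes p: "0 < p" and y: "y \<in> points (ell_p p)"
  shows "slice i y \<in> points (ell_p p)" "npow p (ell_p p) (slice i y) \<le> npow p (ell_p p) y"
proof -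
  have *: "(\<Sum>a\<in>F. \<bar>slice i y a\<bar> powr p) \<le> npow p (ell_p p) y" if "finite F" for F
    using ell_p_sum_le[OF p y, of "Pair i ` F"] that
    by (simp add: sum.reindex inj_on_def slice_def)
  show "slice i y \<in> points (ell_p p)" "npow p (ell_p p) (slice i y) \<le> npow p (ell_p p) y"
    using ell_p_boundedI[OF p *] by auto
qed

lemma column_mem:
  assumes p: "0 < p" and y: "y \<in> points (ell_p p)"
  shows "(\<lambda>i. y (i, a)) \<in> points (ell_p p)"
proof (rule ell_p_boundedI(1)[OF p])
  fix F :: "'a set" assume "finite F"
  then show "(\<Sum>i\<in>F. \<bar>y (i, a)\<bar> powr p) \<le> npow p (ell_p p) y"
    using ell_p_sum_le[OF p y, of "(\<lambda>i. (i, a)) ` F"] by (simp add: sum.reindex inj_on_def)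
qed

text \<open>Column by column, the p-th power of the modulus of the sum is at most the sum of the
  p-th powers, so adding up the slices is a contraction.\<close>

lemma sum_slices_mem:
  assumes p: "0 < p" "p \<le> 1" and y: "y \<in> points (ell_p p)"
  shows "sum_slices y \<in> points (ell_p p)" "npow p (ell_p p) (sum_slices y) \<le> npow p (ell_p p) y"
proof -
  have *: "(\<Sum>a\<in>F. \<bar>sum_slices y a\<bar> powr p) \<le> npow p (ell_p p) y" if F: "finite F" for F
  proof -
    have col: "(\<lambda>i. \<bar>y (i, a)\<bar> powr p) summable_on UNIV" for a
      using column_mem[OF p(1) y] by (simp add: mem_ell_p)
    have "(\<Sum>a\<in>F. \<bar>sum_slices y a\<bar> powr p) \<le> (\<Sum>a\<in>F. \<Sum>\<^sub>\<infinity>i. \<bar>y (i, a)\<bar> powr p)"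
      using abs_summable_ell_p(2)[OF p column_mem[OF p(1) y]]
      by (intro sum_mono) (simp add: sum_slices_def npow_ell_p p)
    also have "\<dots> = (\<Sum>\<^sub>\<infinity>i. \<Sum>a\<in>F. \<bar>y (i, a)\<bar> powr p)"
      using col by (subst infsum_sum(1)) auto
    also have "\<dots> \<le> npow p (ell_p p) y"
    proof (rule infsum_le_finite_sums)
      show "(\<lambda>i. \<Sum>a\<in>F. \<bar>y (i, a)\<bar> powr p) summable_on UNIV"
        using col by (intro infsum_sum(2)) auto
      fix G :: "'a set" assume "finite G"
      then show "(\<Sum>i\<in>G. \<Sum>a\<in>F. \<bar>y (i, a)\<bar> powr p) \<le> npow p (ell_p p) y"
        using ell_p_sum_le[OF p(1) y, of "G \<times> F"] F by (simp add: sum.cartesian_product)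
    qed
    finally show ?thesis .
  qed
  show "sum_slices y \<in> points (ell_p p)" "npow p (ell_p p) (sum_slices y) \<le> npow p (ell_p p) y"
    using ell_p_boundedI[OF p(1) *] by auto
qed

lemma sum_slices_diff:
  assumes p: "0 < p" "p \<le> 1" and "y \<in> points (ell_p p)" "z \<in> points (ell_p p)"
  shows "sum_slices (y - z) = sum_slices y - sum_slices z"
proof
  fix a
  have "((\<lambda>i. y (i, a) + - z (i, a)) has_sum (sum_slices y a + - sum_slices z a)) UNIV"
    unfolding sum_slices_def
    using assms(3,4) abs_summable_ell_p(1)[OF p column_mem[OF p(1)]]
    by (intro has_sum_add has_sum_uminusI has_sum_infsum)
  then show "sum_slices (y - z) a = (sum_slices y - sum_slices z) a"
    by (simp add: sum_slices_def[of "y - z"] infsumI)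
qed

text \<open>Finite sums of slices are killed by linearity, and what remains outside finitely many
  slices is arbitrarily small, so continuity of q concludes.\<close>

lemma operator_sum_slices_eq_0:
  fixes q :: "('k \<Rightarrow> real) \<Rightarrow> 'y::real_vector" and y :: "'i \<times> 'k \<Rightarrow> real"
  assumes p: "0 < p" "p \<le> 1" and "p_space p Y" and q: "bounded_operator (ell_p p) Y q"
    and y: "y \<in> points (ell_p p)" and zero: "\<And>i. q (slice i y) = 0"
  shows "q (sum_slices y) = 0"
proof -
  interpret Y: p_space p Y by fact
  interpret E: p_space p "ell_p p :: ('k \<Rightarrow> real) qspace" by (rule p_space_ell_p[OF p])
  interpret G: p_space p "ell_p p :: ('i \<times> 'k \<Rightarrow> real) qspace" by (rule p_space_ell_p[OF p])
  have lin: "linear_operator (ell_p p) Y q" using q by (simp add: bounded_operator_def)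
  obtain K where K: "K > 0" "\<And>x. x \<in> points (ell_p p) \<Longrightarrow> npow p Y (q x) \<le> K * npow p (ell_p p) x"
    using q unfolding bounded_operator_iff[OF E.p_space_axioms Y.p_space_axioms] by blast
  have "npow p Y (q (sum_slices y)) \<le> K * e" if e: "e > 0" for e
  proof -
    obtain F where F: "finite F" "\<And>A. A \<inter> F = {} \<Longrightarrow> npow p (ell_p p) (coord_restrict A y) < e"
      using npow_coord_restrict_small[OF p(1) y e] by blast
    \<comment> \<open>Whole slices have to be split off, so the finite set F of pairs is enlarged to
      all pairs with the same first components.\<close>
    define P where "P = fst ` F"
    define z where "z = coord_restrict (- (P \<times> UNIV)) y"
    have P: "finite P" using F by (simp add: P_def)
    have "F \<subseteq> P \<times> UNIV" by (force simp: P_def)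
    then have ze: "npow p (ell_p p) z < e" unfolding z_def by (intro F(2)) blast
    have z: "z \<in> points (ell_p p)" unfolding z_def by (rule coord_restrict_mem[OF p(1) y])
    have "sum_slices (y - z) = (\<Sum>i\<in>P. slice i y)"
    proof
      fix a
      have "(\<Sum>\<^sub>\<infinity>i. (y - z) (i, a)) = (\<Sum>\<^sub>\<infinity>i\<in>P. y (i, a))"
        by (intro infsum_cong_neutral) (auto simp: z_def coord_restrict_def)
      then show "sum_slices (y - z) a = (\<Sum>i\<in>P. slice i y) a"
        using P by (simp add: sum_slices_def slice_def sum_fun_apply)
    qed
    then have eq: "sum_slices y = sum_slices z + (\<Sum>i\<in>P. slice i y)"
      using sum_slices_diff[OF p y z] by (simp add: algebra_simps)
    have "(\<Sum>i\<in>P. slice i y) \<in> points (ell_p p)"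
      by (intro E.sum_mem slice_mem(1)[OF p(1) y])
    then have "q (sum_slices y) = q (sum_slices z) + q (\<Sum>i\<in>P. slice i y)"
      by (subst eq) (rule bounded_operatorD(2)[OF q sum_slices_mem(1)[OF p z]])
    also have "q (\<Sum>i\<in>P. slice i y) = 0"
      using E.linear_operator_sum[OF lin, of P "\<lambda>i. slice i y"] slice_mem(1)[OF p(1) y] zero by simp
    finally have "npow p Y (q (sum_slices y)) \<le> K * npow p (ell_p p) (sum_slices z)"
      using K(2) sum_slices_mem[OF p z] by simp
    also have "\<dots> \<le> K * e" using K(1) sum_slices_mem(2)[OF p z] ze by (intro mult_left_mono) auto
    finally show ?thesis .
  qed
  from this[of "_ / K"] have "npow p Y (q (sum_slices y)) \<le> 0 + e" if "e > 0" for e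
    using K(1) that by simp
  then have "npow p Y (q (sum_slices y)) \<le> 0" by (rule field_le_epsilon)
  then have "npow p Y (q (sum_slices y)) = 0" using Y.npow_nonneg[of "q (sum_slices y)"] by linarith
  then show ?thesis
    using Y.npow_eq_0 bounded_operatorD(1)[OF q sum_slices_mem(1)[OF p y]] by blast
qed

lemma ell_p_countable_dense:
  fixes A :: "'k set"
  assumes p: "0 < p" "p \<le> 1" and A: "countable A"
  obtains Z where "countable Z" "Z \<subseteq> points (ell_p p)"
    "\<And>x e. x \<in> points (ell_p p) \<Longrightarrow> {k. x k \<noteq> 0} \<subseteq> A \<Longrightarrow> 0 < e \<Longrightarrow> \<exists>z\<in>Z. npow p (ell_p p) (x - z) < e"
proof -
  interpret E: p_space p "ell_p p :: ('k \<Rightarrow> real) qspace" by (rule p_space_ell_p[OF p])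
  define Z where "Z = (\<Union>F\<in>{F. finite F \<and> F \<subseteq> A}. coord_restrict F ` (PiE F (\<lambda>_. \<rat>)))"
  have fin: "coord_restrict F g \<in> points (ell_p p)" "npow p (ell_p p) (coord_restrict F g) \<le> (\<Sum>k\<in>F. \<bar>g k\<bar> powr p)"
    if "finite F" for F :: "'k set" and g
  proof -
    have *: "(\<Sum>k\<in>G. \<bar>coord_restrict F g k\<bar> powr p) \<le> (\<Sum>k\<in>F. \<bar>g k\<bar> powr p)" if G: "finite G" for G
    proof -
      have "(\<Sum>k\<in>G. \<bar>coord_restrict F g k\<bar> powr p) = (\<Sum>k\<in>G \<inter> F. \<bar>g k\<bar> powr p)"
        using G by (intro sum.mono_neutral_cong_right) (auto simp: coord_restrict_def)
      also have "\<dots> \<le> (\<Sum>k\<in>F. \<bar>g k\<bar> powr p)" using \<open>finite F\<close> by (intro sum_mono2) auto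
      finally show ?thesis .
    qed
    then show "coord_restrict F g \<in> points (ell_p p)" "npow p (ell_p p) (coord_restrict F g) \<le> (\<Sum>k\<in>F. \<bar>g k\<bar> powr p)"
      using ell_p_boundedI[OF p(1) *] by auto
  qed
  show thesis
  proof (rule that)
    show "countable Z" unfolding Z_def
      by (intro countable_UN countable_image countable_PiE countable_Collect_finite_subset A)
        (auto simp: countable_rat)
    show "Z \<subseteq> points (ell_p p)" using fin by (auto simp: Z_def)
    fix x :: "'k \<Rightarrow> real" and e :: real
    assume x: "x \<in> points (ell_p p)" and supp: "{k. x k \<noteq> 0} \<subseteq> A" and e: "0 < e"
    obtain F0 where F0: "finite F0" "\<And>B. B \<inter> F0 = {} \<Longrightarrow> npow p (ell_p p) (coord_restrict B x) < e / 2"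
      using npow_coord_restrict_small[OF p(1) x, of "e / 2"] e by auto
    define F where "F = F0 \<inter> A"
    have F: "finite F" "F \<subseteq> A" using F0 by (auto simp: F_def)
    \<comment> \<open>An error below r in each coordinate of F costs at most e / 2 in total; the
      added 1 keeps the quotient meaningful when F is empty.\<close>
    define r where "r = (e / (2 * (real (card F) + 1))) powr (1 / p)"
    have r: "r > 0" using e by (auto simp: r_def)
    have rp: "r powr p = e / (2 * (real (card F) + 1))" using e p by (simp add: r_def powr_powr)
    have "\<forall>k. \<exists>g\<in>\<rat>. \<bar>x k - g\<bar> < r"
    proof
      fix k
      obtain g where "g \<in> \<rat>" "x k < g" "g < x k + r" using Rats_dense_in_real[of "x k" "x k + r"] r by auto
      then show "\<exists>g\<in>\<rat>. \<bar>x k - g\<bar> < r" by (intro bexI[of _ g]) auto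
    qed
    then obtain g where g: "\<And>k. g k \<in> \<rat>" "\<And>k. \<bar>x k - g k\<bar> < r" by metis
    have "coord_restrict F (restrict g F) \<in> Z"
      unfolding Z_def using F g(1) by (intro UN_I[of F] imageI) auto
    also have "coord_restrict F (restrict g F) = coord_restrict F g" by (auto simp: coord_restrict_def)
    finally have gZ: "coord_restrict F g \<in> Z" .
    have "x - coord_restrict F g = coord_restrict (- F0) x + coord_restrict F (\<lambda>k. x k - g k)"
      using supp by (intro ext) (auto simp: coord_restrict_def F_def)
    then have "npow p (ell_p p) (x - coord_restrict F g) \<le>
        npow p (ell_p p) (coord_restrict (- F0) x) + npow p (ell_p p) (coord_restrict F (\<lambda>k. x k - g k))"
      using E.npow_add[OF coord_restrict_mem[OF p(1) x] fin(1)[OF F(1)]] by metis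
    moreover have "npow p (ell_p p) (coord_restrict (- F0) x) < e / 2" by (rule F0(2)) blast
    moreover have "npow p (ell_p p) (coord_restrict F (\<lambda>k. x k - g k)) \<le> e / 2"
    proof -
      have "npow p (ell_p p) (coord_restrict F (\<lambda>k. x k - g k)) \<le> (\<Sum>k\<in>F. \<bar>x k - g k\<bar> powr p)"
        by (rule fin(2)[OF F(1)])
      also have "\<dots> \<le> (\<Sum>k\<in>F. r powr p)"
        using g(2) p r by (intro sum_mono powr_mono2) (auto intro: less_imp_le)
      also have "\<dots> = real (card F) / (real (card F) + 1) * (e / 2)" by (simp add: rp)
      also have "\<dots> \<le> 1 * (e / 2)" using e by (intro mult_right_mono) auto
      finally show ?thesis by simp
    qed
    ultimately show "\<exists>z\<in>Z. npow p (ell_p p) (x - z) < e" using gZ by (intro bexI[of _ "coord_restrict F g"]) auto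
  qed
qed

section \<open>Countability\<close>

text \<open>With t = \<open>real n powr (p / 2)\<close> the claim reads K t + 2 < e t^2, which
  follows from t > 1 and e t > |K| + 2. The summand 2 leaves room for the approximation error in the
  clustering argument.\<close>

lemma exists_powr_dominates:
  fixes K e p :: real
  assumes "0 < p" "0 < e"
  obtains n :: nat where "n > 0" "K * real n powr (p / 2) + 2 < real n powr p * e"
proof -
  define c where "c = (\<bar>K\<bar> + 2) / e + 1"
  have c: "c \<ge> 1" using assms by (simp add: c_def)
  obtain n :: nat where n: "c powr (2 / p) < real n" using reals_Archimedean2 by blast
  have n0: "0 < n" using n powr_ge_zero[of c "2 / p"] by (cases n) auto
  have "(c powr (2 / p)) powr (p / 2) < real n powr (p / 2)"
    using n assms by (intro powr_less_mono2) auto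
  then have n: "n > 0" "(\<bar>K\<bar> + 2) / e + 1 < real n powr (p / 2)"
    using n0 assms c by (simp_all add: powr_powr c_def)
  define t where "t = real n powr (p / 2)"
  have t2: "real n powr p = t * t" by (simp add: t_def flip: powr_add)
  have "0 \<le> (\<bar>K\<bar> + 2) / e" using assms by simp
  then have t1: "1 < t" using n(2) by (simp add: t_def)
  have "\<bar>K\<bar> + 2 < t * e" using n(2) assms by (simp add: t_def field_simps)
  then have "(\<bar>K\<bar> + 2) * t < t * e * t" using t1 by (intro mult_strict_right_mono) auto
  moreover have "K * t \<le> \<bar>K\<bar> * t" using t1 by (intro mult_right_mono) auto
  then have "K * t + 2 \<le> (\<bar>K\<bar> + 2) * t" using t1 unfolding distrib_right by linarith
  ultimately show thesis using that[of n] n(1) by (simp add: t2 flip: t_def) (simp add: mult_ac)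
qed

text \<open>If uncountably many values had \<open>npow\<close> above e, some z in the countable set
  would have n of them within 1/n. Replacing each of these by a single one, \<open>g b\<close>,
  changes their sum by at most n * (2/n) = 2, so n^p e \<le> K n^(p/2) + 2, which fails for a
  suitable n. Letting e run through the numbers 1/(m+1) covers all nonzero values.\<close>

lemma (in p_space) countable_nonzero:
  fixes g :: "'k \<Rightarrow> 'a"
  assumes g: "\<And>a. g a \<in> points X"
    and bd: "\<And>B. finite B \<Longrightarrow> B \<noteq> {} \<Longrightarrow> npow p X (sum g B) \<le> K * real (card B) powr (p / 2)"
    and Z: "countable Z" "Z \<subseteq> points X" "\<And>a e. 0 < e \<Longrightarrow> \<exists>z\<in>Z. npow p X (g a - z) < e"
  shows "countable {a. g a \<noteq> 0}"
proof -
  have cnt: "countable {a. e < npow p X (g a)}" (is "countable ?A") if e: "0 < e" for e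
  proof (rule ccontr)
    assume unc: "uncountable ?A"
    obtain n :: nat where n: "n > 0" "K * real n powr (p / 2) + 2 < real n powr p * e"
      using exists_powr_dominates[OF p_pos e] by blast
    have "?A \<subseteq> (\<Union>z\<in>Z. {a \<in> ?A. npow p X (g a - z) < 1 / real n})"
      using Z(3)[of "1 / real n"] n(1) by auto
    then obtain z where z: "z \<in> Z" "uncountable {a \<in> ?A. npow p X (g a - z) < 1 / real n}"
      using unc Z(1) by (meson countable_UN countable_subset)
    then have "infinite {a \<in> ?A. npow p X (g a - z) < 1 / real n}"
      using countable_finite by blast
    then obtain B where B: "B \<subseteq> {a \<in> ?A. npow p X (g a - z) < 1 / real n}" "finite B" "card B = n"
      using infinite_arbitrarily_large by blast
    then obtain b where b: "b \<in> B" using n(1) by fastforce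
    have zX: "z \<in> points X" using z Z(2) by blast
    have close: "npow p X (g b - g a) \<le> 2 / real n" if "a \<in> B" for a
    proof -
      have "npow p X (g b - g a) = npow p X ((g b - z) - (g a - z))" by simp
      also have "\<dots> \<le> npow p X (g b - z) + npow p X (g a - z)"
        by (intro npow_diff diff_mem g zX)
      also have "\<dots> \<le> 1 / real n + 1 / real n"
        using B(1) b that by (intro add_mono less_imp_le) auto
      finally show ?thesis by simp
    qed
    have "real n *\<^sub>R g b = (\<Sum>a\<in>B. g b)" using B by (simp add: scaleR_conv_of_real sum_constant_scaleR)
    also have "\<dots> = sum g B + (\<Sum>a\<in>B. g b - g a)" by (simp add: sum_subtractf)
    finally have "npow p X (real n *\<^sub>R g b) \<le> npow p X (sum g B) + npow p X (\<Sum>a\<in>B. g b - g a)"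
      using npow_add sum_mem diff_mem g by metis
    also have "npow p X (\<Sum>a\<in>B. g b - g a) \<le> (\<Sum>a\<in>B. npow p X (g b - g a))"
      by (intro npow_sum diff_mem g)
    also have "\<dots> \<le> (\<Sum>a\<in>B. 2 / real n)" by (intro sum_mono close)
    also have "\<dots> = 2" using B n by simp
    also have "npow p X (sum g B) \<le> K * real n powr (p / 2)" using bd[of B] B b by auto
    finally have "real n powr p * npow p X (g b) \<le> K * real n powr (p / 2) + 2"
      using g by (simp add: npow_scale)
    moreover have "real n powr p * e \<le> real n powr p * npow p X (g b)"
      using B b by (intro mult_left_mono) auto
    ultimately show False using n(2) by linarith
  qed
  have "{a. g a \<noteq> 0} = (\<Union>m. {a. inverse (real (Suc m)) < npow p X (g a)})"
  proof (intro set_eqI iffI)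
    fix a assume "a \<in> {a. g a \<noteq> 0}"
    then have "0 < npow p X (g a)" using npow_pos g by blast
    then show "a \<in> (\<Union>m. {a. inverse (real (Suc m)) < npow p X (g a)})"
      using reals_Archimedean by blast
  next
    fix a assume "a \<in> (\<Union>m. {a. inverse (real (Suc m)) < npow p X (g a)})"
    then obtain m where "inverse (real (Suc m)) < npow p X (g a)" by blast
    then have "0 < npow p X (g a)" using inverse_positive_iff_positive[of "real (Suc m)"] by linarith
    then show "a \<in> {a. g a \<noteq> 0}" by auto
  qed
  also have "countable \<dots>" by (intro countable_UN cnt) auto
  finally show ?thesis .
qed

text \<open>The choice is greedy: the sets chosen so far contain countably many s, each s rules out
  countably many a, and an uncountable type leaves an admissible one.\<close>

lemma exists_disjoint_family:
  fixes M :: "'k \<Rightarrow> 's set"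
  assumes unc: "uncountable (UNIV :: 'k set)" and M: "\<And>a. countable (M a)"
    and pt: "\<And>s. countable {a. s \<in> M a}"
  obtains B where "finite B" "card B = n" "disjoint_family_on M B"
proof -
  have "\<exists>B. finite B \<and> card B = n \<and> disjoint_family_on M B"
  proof (induction n)
    case 0
    show ?case by (intro exI[of _ "{}"]) (simp add: disjoint_family_on_def)
  next
    case (Suc n)
    then obtain B where B: "finite B" "card B = n" "disjoint_family_on M B" by blast
    have "countable (B \<union> (\<Union>b\<in>B. \<Union>s\<in>M b. {a. s \<in> M a}))"
      using B M pt by (intro countable_Un countable_UN) (auto intro: countable_finite)
    then obtain a where a: "a \<notin> B \<union> (\<Union>b\<in>B. \<Union>s\<in>M b. {a. s \<in> M a})"
      using unc by (metis UNIV_eq_I)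
    then show ?case
      using B by (intro exI[of _ "insert a B"]) (auto simp: disjoint_family_on_def)
  qed
  then show thesis using that by blast
qed

section \<open>Extending operators from the kernel\<close>

lemma compact_box: "compact {f :: 'a \<Rightarrow> real. \<forall>x. f x \<in> {- R x..R x}}"
proof -
  have "compactin (product_topology (\<lambda>_. euclidean) UNIV) (PiE UNIV (\<lambda>x. {- R x..R x}))"
    by (auto simp: compactin_PiE)
  moreover have "PiE UNIV (\<lambda>x. {- R x..R x}) = {f :: 'a \<Rightarrow> real. \<forall>x. f x \<in> {- R x..R x}}"
    by (auto simp: PiE_UNIV_domain)
  ultimately show ?thesis by (simp add: euclidean_product_topology)
qed

text \<open>A filter that does the work of an ultrafilter on the index set, by Tychonoff's theorem.\<close>

lemma convergent_subfilter:
  fixes \<Phi> :: "'c \<Rightarrow> 'a \<Rightarrow> real"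
  assumes "F \<noteq> bot" and bd: "\<And>c x. \<bar>\<Phi> c x\<bar> \<le> R x"
  shows "\<exists>G \<theta>. G \<le> F \<and> G \<noteq> bot \<and> (\<forall>x. ((\<lambda>c. \<Phi> c x) \<longlongrightarrow> \<theta> x) G)"
proof -
  have "filtermap \<Phi> F \<noteq> bot" using assms(1) by (simp add: filtermap_bot_iff)
  moreover have "eventually (\<lambda>f. f \<in> {f. \<forall>x. f x \<in> {- R x..R x}}) (filtermap \<Phi> F)"
    using bd by (auto simp: eventually_filtermap abs_le_iff minus_le_iff intro!: always_eventually)
  ultimately obtain \<theta> where \<theta>: "inf (nhds \<theta>) (filtermap \<Phi> F) \<noteq> bot"
    using compact_box[of R] unfolding compact_filter by blast
  \<comment> \<open>Since \<theta> is a cluster point, the sets of c with \<open>\<Phi> c\<close>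
    near \<theta> meet every set of F. The filter is therefore proper, and \<Phi> converges to
    \<theta> along it.\<close>
  define G where "G = inf (filtercomap \<Phi> (nhds \<theta>)) F"
  have "inf (nhds \<theta>) (filtermap \<Phi> F) \<le> bot" if "G = bot"
  proof -
    from that have "eventually (\<lambda>_. False) G" by simp
    then obtain P Q where "eventually P (nhds \<theta>)" "eventually Q F" and PQ: "\<And>c. P (\<Phi> c) \<Longrightarrow> Q c \<Longrightarrow> False"
      unfolding G_def eventually_inf eventually_filtercomap by metis
    then have "eventually (\<lambda>f. \<not> P f) (filtermap \<Phi> F)"
      unfolding eventually_filtermap by (elim eventually_mono) blast
    with \<open>eventually P (nhds \<theta>)\<close> have "eventually (\<lambda>_. False) (inf (nhds \<theta>) (filtermap \<Phi> F))"
      unfolding eventually_inf by blast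
    then show ?thesis by (simp add: eventually_False)
  qed
  then have "G \<noteq> bot" using \<theta> by (auto simp: bot_unique)
  have lim: "(\<Phi> \<longlongrightarrow> \<theta>) G"
    by (simp add: filterlim_iff_le_filtercomap G_def)
  have "((\<lambda>c. \<Phi> c x) \<longlongrightarrow> \<theta> x) G" for x
  proof (rule topological_tendstoI)
    fix S :: "real set" assume "open S" "\<theta> x \<in> S"
    then have "open ((\<lambda>f :: 'a \<Rightarrow> real. f x) -` S)"
      by (intro open_vimage continuous_on_product_coordinates)
    then show "\<forall>\<^sub>F c in G. \<Phi> c x \<in> S"
      using topological_tendstoD[OF lim] \<open>\<theta> x \<in> S\<close> by fastforce
  qed
  moreover have "G \<le> F" by (simp add: G_def)
  ultimately show ?thesis using \<open>G \<noteq> bot\<close> by blast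
qed

section \<open>Subspaces, and functions of finitely many coordinates\<close>

definition subqspace :: "'a set \<Rightarrow> 'a::real_vector qspace \<Rightarrow> 'a qspace" where
  "subqspace S X = \<lparr>points = S, qnorm = qnorm X\<rparr>"

lemma points_subqspace [simp]: "points (subqspace S X) = S"
  and npow_subqspace [simp]: "npow p (subqspace S X) = npow p X"
  by (auto simp: subqspace_def npow_def)

lemma (in p_space) p_space_subqspace:
  assumes "Real_Vector_Spaces.subspace S" "S \<subseteq> points X"
  shows "p_space p (subqspace S X)"
proof
  show "p_normed p (subqspace S X)"
    using p_normed assms
    by (intro p_normedI[OF p_pos p_le_1]) (auto simp: p_normed_def quasinormed_def subqspace_def subset_iff)
qed (use p_pos p_le_1 in auto)

lemma (in p_space) subspace_vimage:
  assumes q: "linear_operator X Y q" and W: "Real_Vector_Spaces.subspace W"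
  shows "Real_Vector_Spaces.subspace {x \<in> points X. q x \<in> W}"
  using q W linear_operator_0[OF q] zero_mem add_mem scale_mem
  by (auto simp: linear_operator_def Real_Vector_Spaces.subspace_def)

text \<open>These are the classes of functions depending on finitely many coordinates, not all
  simple functions of measure theory. The union is directed, and it contains the Rademacher
  functions.\<close>

definition simple :: "'k L0 set" where
  "simple = (\<Union>F\<in>{F. finite F}. span (atoms F))"

lemma simpleI: "finite F \<Longrightarrow> x \<in> span (atoms F) \<Longrightarrow> x \<in> simple"
  unfolding simple_def by blast

lemma simpleE:
  assumes "x \<in> simple"
  obtains F where "finite F" "x \<in> span (atoms F)"
  using assms unfolding simple_def by blast

lemma subspace_simple: "subspace simple"
proof (rule subspaceI)
  show "0 \<in> simple" by (rule simpleI[of "{}"]) (simp_all add: span_zero)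
  fix x y :: "'a L0" and c :: real
  assume "x \<in> simple"
  then obtain F where F: "finite F" "x \<in> span (atoms F)" by (rule simpleE)
  then show "c *\<^sub>R x \<in> simple" by (intro simpleI span_scale)
  assume "y \<in> simple"
  then obtain G where G: "finite G" "y \<in> span (atoms G)" by (rule simpleE)
  have "x \<in> span (atoms (F \<union> G))" "y \<in> span (atoms (F \<union> G))"
    using F G span_atoms_mono[of F "F \<union> G"] span_atoms_mono[of G "F \<union> G"] by auto
  then show "x + y \<in> simple" using F G by (intro simpleI[of "F \<union> G"] span_add) auto
qed

lemma rademacher_simple: "rademacher a \<in> simple"
  by (rule simpleI[OF _ rademacher_in_span]) simp

text \<open>The span of the atoms of a finite set is an isometric copy of a finite-dimensional l_p,
  whence linear liftings with a common bound.\<close>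

lemma linear_lifting:
  fixes q :: "'e::real_vector \<Rightarrow> 'm L0"
  assumes p: "0 < p" "p \<le> 1" and "p_space p E" and q: "linear_operator E (Lp_haar p) q"
    and lift: "\<And>y. y \<in> points (Lp_haar p) \<Longrightarrow> \<exists>x\<in>points E. q x = y \<and> npow p E x \<le> C * npow p (Lp_haar p) y"
    and F: "finite F"
  obtains s where "linear s" "range s \<subseteq> points E"
    "\<And>y. y \<in> span (atoms F) \<Longrightarrow> q (s y) = y \<and> npow p E (s y) \<le> C * npow p (Lp_haar p) y"
proof -
  interpret E: p_space p E by fact
  have "\<forall>y\<in>points (Lp_haar p). \<exists>x. x\<in>points E \<and> q x = y \<and> npow p E x \<le> C * npow p (Lp_haar p) y"
    using lift by blast
  then obtain l where l: "\<And>y. y \<in> points (Lp_haar p) \<Longrightarrow>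
      l y \<in> points E \<and> q (l y) = y \<and> npow p E (l y) \<le> C * npow p (Lp_haar p) y"
    by metis
  \<comment> \<open>Independence of the atoms permits arbitrary lifts of them as values of a linear
    map. The bound C survives linear combinations because the p-th powers add exactly over the
    atoms.\<close>
  obtain s where s: "linear s" "\<And>b. b \<in> atoms F \<Longrightarrow> s b = l b" "range s = span (l ` atoms F)"
    using linear_independent_extend_subspace[OF independent_atoms[OF F], of l] by blast
  have mem: "l b \<in> points E" if "b \<in> atoms F" for b
    using l atoms_mem[OF F] that by blast
  show thesis
  proof (rule that[OF s(1)])
    show "range s \<subseteq> points E"
      unfolding s(3) using mem by (intro span_minimal E.subspace) auto
    fix y assume "y \<in> span (atoms F)"
    then obtain c where y: "y = (\<Sum>b\<in>atoms F. c b *\<^sub>R b)"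
      unfolding span_finite[OF finite_atoms[OF F]] by blast
    have sy: "s y = (\<Sum>b\<in>atoms F. c b *\<^sub>R l b)"
      using s(2) by (simp add: y linear_sum[OF s(1)] linear_scale[OF s(1)])
    have "q (s y) = (\<Sum>b\<in>atoms F. q (c b *\<^sub>R l b))"
      unfolding sy using mem by (intro E.linear_operator_sum[OF q] E.scale_mem)
    also have "\<dots> = y"
      unfolding y
    proof (rule sum.cong[OF refl])
      fix b assume b: "b \<in> atoms F"
      then have "q (c b *\<^sub>R l b) = c b *\<^sub>R q (l b)" using q mem by (simp add: linear_operator_def)
      then show "q (c b *\<^sub>R l b) = c b *\<^sub>R b" using l atoms_mem[OF F] b by auto
    qed
    finally have "q (s y) = y" .
    moreover have "npow p E (s y) \<le> (\<Sum>b\<in>atoms F. npow p E (c b *\<^sub>R l b))"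
      unfolding sy using mem by (intro E.npow_sum E.scale_mem)
    moreover have "\<dots> \<le> (\<Sum>b\<in>atoms F. C * (\<bar>c b\<bar> powr p * npow p (Lp_haar p) b))"
    proof (rule sum_mono)
      fix b assume b: "b \<in> atoms F"
      then have "\<bar>c b\<bar> powr p * npow p E (l b) \<le> \<bar>c b\<bar> powr p * (C * npow p (Lp_haar p) b)"
        using l[of b] atoms_mem[OF F] by (intro mult_left_mono) auto
      then show "npow p E (c b *\<^sub>R l b) \<le> C * (\<bar>c b\<bar> powr p * npow p (Lp_haar p) b)"
        using mem[OF b] by (simp add: E.npow_scale mult_ac)
    qed
    moreover have "\<dots> = C * npow p (Lp_haar p) y"
      unfolding y npow_sum_atoms[OF p(1) F] by (simp add: sum_distrib_left)
    ultimately show "q (s y) = y \<and> npow p E (s y) \<le> C * npow p (Lp_haar p) y" by linarith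
  qed
qed

text \<open>For finite F, subtracting a linear lift of q x moves x into the kernel, with a bound
  independent of F. Applying D and passing to a coordinatewise limit over F gives D'; linearity and
  the bound on finite sums pass to the limit. The last conclusion, that common zeros of D remain
  zeros of D', preserves countable supports of slices.\<close>

lemma kernel_extension:
  fixes q :: "'e::real_vector \<Rightarrow> 'm L0" and D :: "'e \<Rightarrow> 'g \<Rightarrow> real"
  assumes p: "0 < p" "p \<le> 1" and E: "p_space p E" and q: "bounded_operator E (Lp_haar p) q"
    and C: "0 < C" and lift: "\<And>y. y \<in> points (Lp_haar p) \<Longrightarrow>
      \<exists>x\<in>points E. q x = y \<and> npow p E x \<le> C * npow p (Lp_haar p) y"
    and D: "bounded_operator (subqspace {x \<in> points E. q x = 0} E) (ell_p p) D"
  shows "\<exists>D'. bounded_operator (subqspace {x \<in> points E. q x \<in> simple} E) (ell_p p) D' \<and>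
    (\<forall>x\<in>points E. q x = 0 \<longrightarrow> D' x = D x) \<and>
    (\<forall>x\<in>points E. \<forall>g. q x \<in> simple \<longrightarrow> (\<forall>z\<in>points E. q z = 0 \<longrightarrow> D z g = 0) \<longrightarrow> D' x g = 0)"
proof -
  interpret E: p_space p E by fact
  interpret L: p_space p "Lp_haar p :: 'm L0 qspace" by (rule p_space_Lp[OF p])
  interpret G: p_space p "ell_p p :: ('g \<Rightarrow> real) qspace" by (rule p_space_ell_p[OF p])
  have lin: "linear_operator E (Lp_haar p) q" using q by (simp add: bounded_operator_def)
  note qD = bounded_operatorD[OF q]
  define K where "K = subqspace {x \<in> points E. q x = 0} E"
  define V where "V = subqspace {x \<in> points E. q x \<in> simple} E"
  have K: "p_space p K" unfolding K_def
    using E.subspace_vimage[OF lin subspace_single_0] by (intro E.p_space_subqspace) auto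
  have V: "p_space p V" unfolding V_def
    using E.subspace_vimage[OF lin subspace_simple] by (intro E.p_space_subqspace) auto
  interpret K: p_space p K by (rule K)
  interpret V: p_space p V by (rule V)
  have D: "bounded_operator K (ell_p p) D" using D by (simp add: K_def)
  note DD = bounded_operatorD[OF D]
  have Dlin: "linear_operator K (ell_p p) D" using D by (simp add: bounded_operator_def)
  have pK: "x \<in> points K \<longleftrightarrow> x \<in> points E \<and> q x = 0" and pV: "x \<in> points V \<longleftrightarrow> x \<in> points E \<and> q x \<in> simple"
    and nK: "npow p K x = npow p E x" and nV: "npow p V x = npow p E x" for x
    by (simp_all add: K_def V_def)
  obtain Cq where Cq: "0 < Cq" "\<And>x. x \<in> points E \<Longrightarrow> npow p (Lp_haar p) (q x) \<le> Cq * npow p E x"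
    using q unfolding bounded_operator_iff[OF E L.p_space_axioms] by blast
  obtain CD where CD: "0 < CD" "\<And>x. x \<in> points K \<Longrightarrow> npow p (ell_p p) (D x) \<le> CD * npow p E x"
    using D unfolding bounded_operator_iff[OF K G.p_space_axioms] nK by blast
  have "\<forall>F. \<exists>s. finite F \<longrightarrow> linear s \<and> range s \<subseteq> points E \<and>
      (\<forall>y \<in> span (atoms F). q (s y) = y \<and> npow p E (s y) \<le> C * npow p (Lp_haar p) y)"
    using linear_lifting[OF p E lin lift] by metis
  then obtain s where s: "\<And>F. finite F \<Longrightarrow> linear (s F)" "\<And>F y. finite F \<Longrightarrow> s F y \<in> points E"
    "\<And>F y. finite F \<Longrightarrow> y \<in> span (atoms F) \<Longrightarrow> q (s F y) = y \<and> npow p E (s F y) \<le> C * npow p (Lp_haar p) y"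
    by (metis rangeI subsetD)
  define P where "P F x \<longleftrightarrow> finite F \<and> x \<in> points E \<and> q x \<in> span (atoms F)" for F x
  define r where "r F x = x - s F (q x)" for F x
  \<comment> \<open>The correction adds at most \<open>C * Cq\<close> times
    \<open>npow p E x\<close>, and D contributes \<open>CD\<close>.\<close>
  define A where "A = CD * (1 + C * Cq)"
  have r: "r F x \<in> points K" "npow p (ell_p p) (D (r F x)) \<le> A * npow p E x" if "P F x" for F x
  proof -
    have x: "finite F" "x \<in> points E" "q x \<in> span (atoms F)" using that by (auto simp: P_def)
    show rK: "r F x \<in> points K"
      using x s by (simp add: pK r_def E.diff_mem E.linear_operator_diff[OF lin])
    have "npow p E (s F (q x)) \<le> C * npow p (Lp_haar p) (q x)" using s(3) x by blast
    also have "\<dots> \<le> C * (Cq * npow p E x)" using C Cq x by (intro mult_left_mono) auto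
    finally have "npow p E (r F x) \<le> (1 + C * Cq) * npow p E x"
      using E.npow_diff[OF x(2) s(2)[OF x(1)], of "q x"] by (simp add: r_def algebra_simps)
    then have "CD * npow p E (r F x) \<le> A * npow p E x"
      unfolding A_def mult.assoc using CD(1) by (intro mult_left_mono) auto
    then show "npow p (ell_p p) (D (r F x)) \<le> A * npow p E x"
      using CD(2)[OF rK] by linarith
  qed
  have A: "0 < A" unfolding A_def using CD C Cq by (intro mult_pos_pos add_pos_nonneg) auto
  \<comment> \<open>The value 0 is a placeholder for those F on which q x is not yet in the span. It
    keeps \<Phi> bounded for all F, and for a fixed x in V it is eventually not taken.\<close>
  define \<Phi> where "\<Phi> F = (\<lambda>(x, g). if P F x then D (r F x) g else 0)" for F
  define R where "R = (\<lambda>(x, g :: 'g). (A * npow p E x) powr (1 / p))"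
  have bd: "\<bar>\<Phi> F xg\<bar> \<le> R xg" for F xg
  proof (cases xg)
    case (Pair x g)
    show ?thesis
    proof (cases "P F x")
      case True
      have "\<bar>D (r F x) g\<bar> powr p \<le> A * npow p E x"
        using ell_p_coord_le[OF p(1) DD(1)[OF r(1)[OF True]]] r(2)[OF True] order_trans by blast
      then have "(\<bar>D (r F x) g\<bar> powr p) powr (1 / p) \<le> (A * npow p E x) powr (1 / p)"
        using p by (intro powr_mono2) auto
      then show ?thesis using True p by (simp add: Pair \<Phi>_def R_def powr_powr)
    qed (simp add: Pair \<Phi>_def R_def)
  qed
  have "\<exists>\<U> \<theta>. \<U> \<le> finite_subsets_at_top UNIV \<and> \<U> \<noteq> bot \<and> (\<forall>xg. ((\<lambda>F. \<Phi> F xg) \<longlongrightarrow> \<theta> xg) \<U>)"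
    by (rule convergent_subfilter[OF finite_subsets_at_top_neq_bot bd])
  then obtain \<U> \<theta> where U: "\<U> \<le> finite_subsets_at_top UNIV" "\<U> \<noteq> bot"
    and lim: "\<And>xg. ((\<lambda>F. \<Phi> F xg) \<longlongrightarrow> \<theta> xg) \<U>"
    by blast
  have ev: "\<forall>\<^sub>F F in \<U>. P F x" if "x \<in> points V" for x
  proof -
    from that have "q x \<in> simple" by (simp add: pV)
    then obtain F0 where F0: "finite F0" "q x \<in> span (atoms F0)" by (rule simpleE)
    have "P F x" if "finite F" "F0 \<subseteq> F" for F
      using span_atoms_mono[OF that(2,1)] F0 \<open>x \<in> points V\<close> that by (auto simp: P_def pV)
    then have "\<forall>\<^sub>F F in finite_subsets_at_top UNIV. P F x"
      using F0(1) unfolding eventually_finite_subsets_at_top by blast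
    then show ?thesis using U(1) by (rule filter_leD[rotated])
  qed
  define D' where "D' x = (\<lambda>g. \<theta> (x, g))" for x
  have lim': "((\<lambda>F. D (r F x) g) \<longlongrightarrow> D' x g) \<U>" if "x \<in> points V" for x g
    unfolding D'_def
    by (rule Lim_transform_eventually[OF lim]) (use ev[OF that] in \<open>eventually_elim, auto simp: \<Phi>_def\<close>)
  show ?thesis
  proof (intro exI[of _ D'] conjI ballI allI impI)
    have bd: "D' x \<in> points (ell_p p)" "npow p (ell_p p) (D' x) \<le> A * npow p E x" if x: "x \<in> points V" for x
    proof -
      have "(\<Sum>g\<in>B. \<bar>D' x g\<bar> powr p) \<le> A * npow p E x" if B: "finite B" for B
      proof (rule tendsto_upperbound[OF _ _ U(2)])
        show "((\<lambda>F. \<Sum>g\<in>B. \<bar>D (r F x) g\<bar> powr p) \<longlongrightarrow> (\<Sum>g\<in>B. \<bar>D' x g\<bar> powr p)) \<U>"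
          using p lim'[OF x] by (intro tendsto_sum tendsto_powr' tendsto_rabs tendsto_const) auto
        show "\<forall>\<^sub>F F in \<U>. (\<Sum>g\<in>B. \<bar>D (r F x) g\<bar> powr p) \<le> A * npow p E x"
          using ev[OF x]
        proof eventually_elim
          case (elim F)
          then show ?case
            using ell_p_sum_le[OF p(1) DD(1)[OF r(1)] B] r(2) order_trans by blast
        qed
      qed
      then show "D' x \<in> points (ell_p p)" "npow p (ell_p p) (D' x) \<le> A * npow p E x"
        using ell_p_boundedI[OF p(1)] by blast+
    qed
    have add: "D' (x + y) = D' x + D' y" if x: "x \<in> points V" and y: "y \<in> points V" for x y
    proof
      fix g
      have "((\<lambda>F. D (r F x) g + D (r F y) g) \<longlongrightarrow> D' (x + y) g) \<U>"
      proof (rule Lim_transform_eventually[OF lim'[OF V.add_mem[OF x y]]])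
        show "\<forall>\<^sub>F F in \<U>. D (r F (x + y)) g = D (r F x) g + D (r F y) g"
          using ev[OF x] ev[OF y]
        proof eventually_elim
          case (elim F)
          then have "r F (x + y) = r F x + r F y"
            using s(1) qD(2) by (auto simp: r_def P_def linear_add)
          then show ?case using DD(2)[OF r(1) r(1), OF elim] by simp
        qed
      qed
      moreover have "((\<lambda>F. D (r F x) g + D (r F y) g) \<longlongrightarrow> D' x g + D' y g) \<U>"
        by (intro tendsto_add lim' x y)
      ultimately show "D' (x + y) g = (D' x + D' y) g" using tendsto_unique[OF U(2)] by auto
    qed
    have scale: "D' (c *\<^sub>R x) = c *\<^sub>R D' x" if x: "x \<in> points V" for c x
    proof
      fix g
      have "((\<lambda>F. c * D (r F x) g) \<longlongrightarrow> D' (c *\<^sub>R x) g) \<U>"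
      proof (rule Lim_transform_eventually[OF lim'[OF V.scale_mem[OF x]]])
        show "\<forall>\<^sub>F F in \<U>. D (r F (c *\<^sub>R x)) g = c * D (r F x) g"
          using ev[OF x]
        proof eventually_elim
          case (elim F)
          then have "r F (c *\<^sub>R x) = c *\<^sub>R r F x"
            using s(1) qD(3) by (auto simp: r_def P_def linear_scale scaleR_diff_right)
          then show ?case using DD(3)[OF r(1)[OF elim]] by (simp add: scaleR_fun_def)
        qed
      qed
      moreover have "((\<lambda>F. c * D (r F x) g) \<longlongrightarrow> c * D' x g) \<U>"
        by (intro tendsto_mult tendsto_const lim' x)
      ultimately show "D' (c *\<^sub>R x) g = (c *\<^sub>R D' x) g"
        using tendsto_unique[OF U(2)] by (auto simp: scaleR_fun_def)
    qed
    have "linear_operator V (ell_p p) D'"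
      unfolding linear_operator_def using bd(1) add scale by blast
    then show "bounded_operator (subqspace {x \<in> points E. q x \<in> simple} E) (ell_p p) D'"
      unfolding V_def[symmetric] bounded_operator_iff[OF V G.p_space_axioms] nV using bd(2) A by blast
    fix x
    assume "x \<in> points E"
    show "D' x = D x" if "q x = 0"
    proof
      fix g
      have x: "x \<in> points V" using \<open>x \<in> points E\<close> that by (simp add: pV subspace_0[OF subspace_simple])
      have "((\<lambda>F. D x g) \<longlongrightarrow> D' x g) \<U>"
      proof (rule Lim_transform_eventually[OF lim'[OF x]])
        show "\<forall>\<^sub>F F in \<U>. D (r F x) g = D x g"
          using ev[OF x] by eventually_elim (use that s(1) in \<open>auto simp: r_def P_def linear_0\<close>)
      qed
      then show "D' x g = D x g" using tendsto_unique[OF U(2) _ tendsto_const] by blast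
    qed
    show "D' x g = 0" if "q x \<in> simple" and Dg: "\<forall>z\<in>points E. q z = 0 \<longrightarrow> D z g = 0" for g
    proof -
      have x: "x \<in> points V" using \<open>x \<in> points E\<close> that by (simp add: pV)
      have "((\<lambda>F. 0) \<longlongrightarrow> D' x g) \<U>"
      proof (rule Lim_transform_eventually[OF lim'[OF x]])
        show "\<forall>\<^sub>F F in \<U>. D (r F x) g = 0"
          using ev[OF x] by eventually_elim (use Dg r(1) in \<open>auto simp: pK\<close>)
      qed
      then show ?thesis using tendsto_unique[OF U(2) _ tendsto_const] by blast
    qed
  qed
qed

section \<open>Further bounded operators\<close>

lemma bounded_operatorI:
  assumes X: "p_space p X" and Y: "p_space p Y"
    and mem: "\<And>x. x \<in> points X \<Longrightarrow> T x \<in> points Y"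
    and add: "\<And>x y. x \<in> points X \<Longrightarrow> y \<in> points X \<Longrightarrow> T (x + y) = T x + T y"
    and scale: "\<And>c x. x \<in> points X \<Longrightarrow> T (c *\<^sub>R x) = c *\<^sub>R T x"
    and bd: "\<And>x. x \<in> points X \<Longrightarrow> npow p Y (T x) \<le> C * npow p X x"
  shows "bounded_operator X Y T"
  unfolding bounded_operator_iff[OF X Y]
proof (intro conjI exI ballI)
  show "linear_operator X Y T" using mem add scale by (auto simp: linear_operator_def)
  show "0 < max C 1" by simp
  fix x assume x: "x \<in> points X"
  have "C * npow p X x \<le> max C 1 * npow p X x"
    using p_space.npow_nonneg[OF X] by (intro mult_right_mono) auto
  then show "npow p Y (T x) \<le> max C 1 * npow p X x" using bd[OF x] by linarith
qed

lemma bounded_operatorE: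
  assumes "p_space p X" "p_space p Y" "bounded_operator X Y T"
  obtains C where "0 < C" "\<And>x. x \<in> points X \<Longrightarrow> npow p Y (T x) \<le> C * npow p X x"
  using assms(3) unfolding bounded_operator_iff[OF assms(1,2)] by blast

lemma bounded_operator_comp:
  assumes X: "p_space p X" and Y: "p_space p Y" and Z: "p_space p Z"
    and T: "bounded_operator X Y T" and S: "bounded_operator Y Z S"
  shows "bounded_operator X Z (\<lambda>x. S (T x))"
proof -
  obtain C where C: "0 < C" "\<And>x. x \<in> points X \<Longrightarrow> npow p Y (T x) \<le> C * npow p X x"
    using bounded_operatorE[OF X Y T] by blast
  obtain D where D: "0 < D" "\<And>y. y \<in> points Y \<Longrightarrow> npow p Z (S y) \<le> D * npow p Y y"
    using bounded_operatorE[OF Y Z S] by blast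
  note TD = bounded_operatorD[OF T] and SD = bounded_operatorD[OF S]
  show ?thesis
  proof (rule bounded_operatorI[OF X Z, where C = "D * C"])
    fix x assume x: "x \<in> points X"
    have "npow p Z (S (T x)) \<le> D * npow p Y (T x)" using D(2) TD(1)[OF x] .
    also have "\<dots> \<le> D * (C * npow p X x)" using C(2)[OF x] D(1) by (intro mult_left_mono) auto
    finally show "npow p Z (S (T x)) \<le> D * C * npow p X x" by (simp add: mult.assoc)
  qed (simp_all add: TD SD)
qed

lemma bounded_operator_diff:
  assumes X: "p_space p X" and Y: "p_space p Y"
    and T: "bounded_operator X Y T" and S: "bounded_operator X Y S"
  shows "bounded_operator X Y (\<lambda>x. T x - S x)"
proof -
  interpret Y: p_space p Y by (rule Y)
  obtain C where C: "\<And>x. x \<in> points X \<Longrightarrow> npow p Y (T x) \<le> C * npow p X x"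
    using bounded_operatorE[OF X Y T] by blast
  obtain D where D: "\<And>x. x \<in> points X \<Longrightarrow> npow p Y (S x) \<le> D * npow p X x"
    using bounded_operatorE[OF X Y S] by blast
  note TD = bounded_operatorD[OF T] and SD = bounded_operatorD[OF S]
  show ?thesis
  proof (rule bounded_operatorI[OF X Y, where C = "C + D"])
    fix x assume x: "x \<in> points X"
    show "T x - S x \<in> points Y" using x by (intro Y.diff_mem TD SD)
    show "npow p Y (T x - S x) \<le> (C + D) * npow p X x"
      using Y.npow_diff[OF TD(1)[OF x] SD(1)[OF x]] C[OF x] D[OF x] by (simp add: distrib_right)
  qed (simp_all add: TD SD scaleR_diff_right)
qed

lemma bounded_operator_inclusion:
  assumes "p_space p X" "p_space p (subqspace S X)" "S \<subseteq> points X"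
  shows "bounded_operator (subqspace S X) X (\<lambda>x. x)"
  by (rule bounded_operatorI[OF assms(2,1), where C = 1]) (use assms(3) in auto)

lemma bounded_operator_coord_restrict:
  assumes p: "0 < p" "p \<le> 1"
  shows "bounded_operator (ell_p p) (ell_p p) (coord_restrict A)"
proof (rule bounded_operatorI[OF p_space_ell_p[OF p] p_space_ell_p[OF p], where C = 1])
  fix x :: "'a \<Rightarrow> real" assume x: "x \<in> points (ell_p p)"
  show "coord_restrict A x \<in> points (ell_p p)" by (rule coord_restrict_mem[OF p(1) x])
  show "npow p (ell_p p) (coord_restrict A x) \<le> 1 * npow p (ell_p p) x"
    using sum_npow_coord_restrict_le[OF p(1) x, of "{()}" "\<lambda>_. A"] by (simp add: disjoint_family_on_def)
qed (auto simp: coord_restrict_def scaleR_fun_def)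

lemma bounded_operator_slice:
  assumes p: "0 < p" "p \<le> 1"
  shows "bounded_operator (ell_p p) (ell_p p) (slice i)"
  by (rule bounded_operatorI[OF p_space_ell_p[OF p] p_space_ell_p[OF p], where C = 1])
    (simp_all add: slice_mem[OF p(1)], auto simp: slice_def scaleR_fun_def)

lemma bounded_operator_sum_slices:
  assumes p: "0 < p" "p \<le> 1"
  shows "bounded_operator (ell_p p) (ell_p p) sum_slices"
proof (rule bounded_operatorI[OF p_space_ell_p[OF p] p_space_ell_p[OF p], where C = 1])
  fix x y :: "'a \<times> 'b \<Rightarrow> real" and c :: real
  assume x: "x \<in> points (ell_p p)"
  show "sum_slices (c *\<^sub>R x) = c *\<^sub>R sum_slices x"
    by (auto simp: sum_slices_def scaleR_fun_def infsum_cmult_right')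
  assume y: "y \<in> points (ell_p p)"
  show "sum_slices (x + y) = sum_slices x + sum_slices y"
    using abs_summable_ell_p(1)[OF p column_mem[OF p(1) x]] abs_summable_ell_p(1)[OF p column_mem[OF p(1) y]]
    by (intro ext) (simp add: sum_slices_def infsum_add)
qed (simp_all add: sum_slices_mem[OF p])

text \<open>Open mapping gives preimages with a common bound; injectivity makes the choice unique
  and therefore linear.\<close>

lemma bounded_inverse:
  assumes p: "0 < p" "p \<le> 1" and BX: "p_Banach p X" and BY: "p_Banach p Y"
    and T: "bounded_operator X Y T" and onto: "T ` points X = points Y"
    and inj: "{x \<in> points X. T x = 0} = {0}"
  shows "\<exists>R. bounded_operator Y X R \<and> (\<forall>y\<in>points Y. T (R y) = y)"
proof -
  interpret X: p_space p X using p_space_of_p_Banach[OF p BX] .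
  interpret Y: p_space p Y using p_space_of_p_Banach[OF p BY] .
  have lin: "linear_operator X Y T" using T by (simp add: bounded_operator_def)
  note TD = bounded_operatorD[OF T]
  obtain C where C: "\<And>y. y \<in> points Y \<Longrightarrow> \<exists>x\<in>points X. T x = y \<and> npow p X x \<le> C * npow p Y y"
    using open_mapping[OF p BX BY T onto] by blast
  then obtain R where R: "\<And>y. y \<in> points Y \<Longrightarrow> R y \<in> points X \<and> T (R y) = y \<and> npow p X (R y) \<le> C * npow p Y y"
    by metis
  have eqI: "x = y" if "x \<in> points X" "y \<in> points X" "T x = T y" for x y
  proof -
    have "x - y \<in> {x \<in> points X. T x = 0}"
      using that X.diff_mem X.linear_operator_diff[OF lin] by simp
    then show ?thesis unfolding inj by simp
  qed
  have "bounded_operator Y X R"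
  proof (rule bounded_operatorI[OF Y.p_space_axioms X.p_space_axioms, where C = C])
    show "R (x + y) = R x + R y" if "x \<in> points Y" "y \<in> points Y" for x y
      using that R TD(2) X.add_mem Y.add_mem by (intro eqI) auto
    show "R (c *\<^sub>R x) = c *\<^sub>R R x" if "x \<in> points Y" for c x
      using that R TD(3) X.scale_mem Y.scale_mem by (intro eqI) auto
  qed (use R in auto)
  then show ?thesis using R by blast
qed

text \<open>The kernel is closed, hence complete. This allows the open mapping theorem to be applied
  to j as a map onto its range.\<close>

lemma p_Banach_kernel:
  assumes p: "0 < p" "p \<le> 1" and BX: "p_Banach p X" and Y: "p_space p Y"
    and T: "bounded_operator X Y T"
  shows "p_Banach p (subqspace {x \<in> points X. T x = 0} X)"
proof -
  interpret X: p_space p X using p_space_of_p_Banach[OF p BX] .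
  interpret Y: p_space p Y by (rule Y)
  have lin: "linear_operator X Y T" using T by (simp add: bounded_operator_def)
  obtain C where C: "0 < C" "\<And>x. x \<in> points X \<Longrightarrow> npow p Y (T x) \<le> C * npow p X x"
    using bounded_operatorE[OF X.p_space_axioms Y T] by blast
  define K where "K = {x \<in> points X. T x = 0}"
  have "p_space p (subqspace K X)"
    using X.subspace_vimage[OF lin subspace_single_0] unfolding K_def
    by (intro X.p_space_subqspace) auto
  then interpret K: p_space p "subqspace K X" .
  have K.M.mcomplete
  proof (rule K.series_imp_mcomplete)
    fix x assume "\<And>k :: nat. x k \<in> points (subqspace K X)"
      and sm: "summable (\<lambda>k. npow p (subqspace K X) (x k))"
    then have x: "x k \<in> points X" "T (x k) = 0" for k by (auto simp: K_def)
    obtain z where z: "z \<in> points X" and lim: "(\<lambda>n. npow p X (z - (\<Sum>k<n. x k))) \<longlonglongrightarrow> 0"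
      using X.mcomplete_imp_series[of x] BX x sm by (auto simp: p_Banach_def)
    have "npow p Y (T z) \<le> C * npow p X (z - (\<Sum>k<n. x k))" for n
    proof -
      have s: "(\<Sum>k<n. x k) \<in> points X" by (intro X.sum_mem x)
      have "T (z - (\<Sum>k<n. x k)) = T z"
        using X.linear_operator_diff[OF lin z s] X.linear_operator_sum[OF lin x(1)] x(2) by simp
      then show ?thesis using C(2)[OF X.diff_mem[OF z s]] by simp
    qed
    then have "npow p Y (T z) \<le> 0"
      by (intro LIMSEQ_le_const[OF tendsto_mult_right_zero[OF lim]]) auto
    then have "T z = 0"
      using Y.npow_eq_0[OF bounded_operatorD(1)[OF T z]] Y.npow_nonneg[of "T z"] by linarith
    then show "\<exists>z\<in>points (subqspace K X). (\<lambda>n. npow p (subqspace K X) (z - (\<Sum>k<n. x k))) \<longlonglongrightarrow> 0"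
      using z lim by (auto simp: K_def)
  qed
  then show ?thesis using K.p_normed by (simp add: p_Banach_def K_def)
qed

section \<open>Sums of families of spaces\<close>

lemma mem_ell_p_sum: "x \<in> points (ell_p_sum p I X) \<longleftrightarrow>
    (\<forall>i\<in>I. x i \<in> points (X i)) \<and> (\<forall>i. i \<notin> I \<longrightarrow> x i = 0) \<and> (\<lambda>i. npow p (X i) (x i)) summable_on I"
  by (simp add: ell_p_sum_def npow_def)

lemma npow_ell_p_sum: "0 < p \<Longrightarrow> npow p (ell_p_sum p I X) x = (\<Sum>\<^sub>\<infinity>i\<in>I. npow p (X i) (x i))"
  by (simp add: ell_p_sum_def npow_def powr_powr infsum_nonneg)

locale p_space_family =
  fixes p :: real and I :: "'i set" and X :: "'i \<Rightarrow> 'x::real_vector qspace"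
  assumes p: "0 < p" "p \<le> 1" and X: "\<And>i. i \<in> I \<Longrightarrow> p_space p (X i)"

lemma (in p_space_family) p_space_ell_p_sum:
  shows "p_space p (ell_p_sum p I X)"
proof
  have nn: "0 \<le> npow p (X i) x" for i x by (simp add: npow_def)
  note XD = p_space.zero_mem[OF X] p_space.add_mem[OF X] p_space.scale_mem[OF X]
    p_space.npow_add[OF X] p_space.npow_scale[OF X] p_space.npow_0[OF X]
  show "p_normed p (ell_p_sum p I X)"
  proof (rule p_normedI[OF p])
    have add: "x + y \<in> points (ell_p_sum p I X) \<and>
        npow p (ell_p_sum p I X) (x + y) \<le> npow p (ell_p_sum p I X) x + npow p (ell_p_sum p I X) y"
      if "x \<in> points (ell_p_sum p I X)" "y \<in> points (ell_p_sum p I X)" for x y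
    proof -
      have s: "(\<lambda>i. npow p (X i) (x i)) summable_on I" "(\<lambda>i. npow p (X i) (y i)) summable_on I"
        using that by (auto simp: mem_ell_p_sum)
      have le: "npow p (X i) ((x + y) i) \<le> npow p (X i) (x i) + npow p (X i) (y i)" if "i \<in> I" for i
        using that \<open>x \<in> _\<close> \<open>y \<in> _\<close> by (simp add: mem_ell_p_sum XD)
      have s': "(\<lambda>i. npow p (X i) ((x + y) i)) summable_on I"
        by (rule summable_on_comparison_test[OF summable_on_add[OF s]]) (use le nn in auto)
      have "(\<Sum>\<^sub>\<infinity>i\<in>I. npow p (X i) ((x + y) i)) \<le> (\<Sum>\<^sub>\<infinity>i\<in>I. npow p (X i) (x i) + npow p (X i) (y i))"
        by (rule infsum_mono[OF s' summable_on_add[OF s]]) (rule le)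
      then show ?thesis
        using that s' by (simp add: mem_ell_p_sum npow_ell_p_sum[OF p(1)] infsum_add[OF s] XD)
    qed
    have scale: "c *\<^sub>R x \<in> points (ell_p_sum p I X) \<and>
        qnorm (ell_p_sum p I X) (c *\<^sub>R x) = \<bar>c\<bar> * qnorm (ell_p_sum p I X) x"
      if "x \<in> points (ell_p_sum p I X)" for c x
    proof -
      have eq: "npow p (X i) ((c *\<^sub>R x) i) = \<bar>c\<bar> powr p * npow p (X i) (x i)" if "i \<in> I" for i
        using that \<open>x \<in> _\<close> by (simp add: mem_ell_p_sum XD scaleR_fun_def)
      have "(\<lambda>i. npow p (X i) ((c *\<^sub>R x) i)) summable_on I \<longleftrightarrow>
          (\<lambda>i. \<bar>c\<bar> powr p * npow p (X i) (x i)) summable_on I"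
        by (rule summable_on_cong) (rule eq)
      moreover have "(\<Sum>\<^sub>\<infinity>i\<in>I. npow p (X i) ((c *\<^sub>R x) i)) = (\<Sum>\<^sub>\<infinity>i\<in>I. \<bar>c\<bar> powr p * npow p (X i) (x i))"
        by (rule infsum_cong) (rule eq)
      ultimately show ?thesis
        using that p
        by (simp add: mem_ell_p_sum summable_on_cmult_right XD scaleR_fun_def)
          (simp add: ell_p_sum_def npow_def infsum_cmult_right' powr_mult powr_powr scaleR_fun_def)
    qed
    show "subspace (points (ell_p_sum p I X))"
    proof (rule subspaceI)
      have "(\<lambda>i. npow p (X i) 0) summable_on I \<longleftrightarrow> (\<lambda>_. 0 :: real) summable_on I"
        by (rule summable_on_cong) (rule XD)
      then show "0 \<in> points (ell_p_sum p I X)" by (simp add: mem_ell_p_sum XD)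
    qed (use add scale in auto)
    fix x y c
    assume x: "x \<in> points (ell_p_sum p I X)"
    show "0 \<le> qnorm (ell_p_sum p I X) x" by (simp add: ell_p_sum_def)
    show "x = 0" if "qnorm (ell_p_sum p I X) x = 0"
    proof
      fix i
      have "npow p (ell_p_sum p I X) x = 0" using that p by (simp add: npow_def)
      then have "(\<Sum>\<^sub>\<infinity>i\<in>I. npow p (X i) (x i)) \<le> 0" by (simp add: npow_ell_p_sum p)
      from nonneg_infsum_le_0D[OF this] have "npow p (X i) (x i) = 0" if "i \<in> I"
        using x that nn by (simp add: mem_ell_p_sum)
      then show "x i = 0 i"
        using x p_space.npow_eq_0[OF X, of i "x i"] by (cases "i \<in> I") (auto simp: mem_ell_p_sum)
    qed
    show "qnorm (ell_p_sum p I X) (c *\<^sub>R x) = \<bar>c\<bar> * qnorm (ell_p_sum p I X) x" using scale x by blast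
    assume "y \<in> points (ell_p_sum p I X)"
    then show "qnorm (ell_p_sum p I X) (x + y) powr p \<le>
        qnorm (ell_p_sum p I X) x powr p + qnorm (ell_p_sum p I X) y powr p"
      using add x by (simp add: npow_def)
  qed
qed (use p in auto)

definition emb :: "'i \<Rightarrow> 'x::real_vector \<Rightarrow> 'i \<Rightarrow> 'x" where
  "emb i x = (\<lambda>k. if k = i then x else 0)"

lemma (in p_space_family) emb_mem:
  assumes i: "i \<in> I" and x: "x \<in> points (X i)"
  shows "emb i x \<in> points (ell_p_sum p I X)" "npow p (ell_p_sum p I X) (emb i x) = npow p (X i) x"
proof -
  have 0: "npow p (X k) (emb i x k) = 0" if "k \<in> I - {i}" for k
    using that p_space.npow_0[OF X] by (simp add: emb_def)
  have s: "(\<lambda>k. npow p (X k) (emb i x k)) summable_on I \<longleftrightarrow> (\<lambda>k. npow p (X k) (emb i x k)) summable_on {i}"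
    using 0 i by (intro summable_on_cong_neutral) auto
  have "(\<Sum>\<^sub>\<infinity>k\<in>I. npow p (X k) (emb i x k)) = (\<Sum>\<^sub>\<infinity>k\<in>{i}. npow p (X k) (emb i x k))"
    using 0 i by (intro infsum_cong_neutral) auto
  then show "npow p (ell_p_sum p I X) (emb i x) = npow p (X i) x"
    by (simp add: npow_ell_p_sum p) (simp add: emb_def)
  show "emb i x \<in> points (ell_p_sum p I X)"
    unfolding mem_ell_p_sum s using i x p_space.zero_mem[OF X] by (auto simp: emb_def)
qed

lemma emb_add: "emb i (x + y) = emb i x + emb i y"
  and emb_scale: "emb i (c *\<^sub>R x) = c *\<^sub>R emb i x"
  by (auto simp: emb_def scaleR_fun_def)

lemma (in p_space_family) bounded_operator_emb:
  assumes i: "i \<in> I"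
  shows "bounded_operator (X i) (ell_p_sum p I X) (emb i)"
  by (rule bounded_operatorI[OF X[OF i] p_space_ell_p_sum, where C = 1])
    (simp_all add: emb_mem[OF i] emb_add emb_scale)

text \<open>Slice i is the image under W of coordinate i of y alone. Slices outside I are 0, because
  the index type may be larger than I.\<close>

definition pieces :: "'i set \<Rightarrow> (('i \<Rightarrow> 'x::real_vector) \<Rightarrow> 'k \<Rightarrow> real) \<Rightarrow> ('i \<Rightarrow> 'x) \<Rightarrow> 'i \<times> 'k \<Rightarrow> real" where
  "pieces I W y = (\<lambda>(i, a). if i \<in> I then W (emb i (y i)) a else 0)"

lemma slice_pieces: "slice i (pieces I W y) = (if i \<in> I then W (emb i (y i)) else 0)"
  by (auto simp: slice_def pieces_def)

lemma (in p_space_family) bounded_operator_pieces: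
  assumes W: "bounded_operator (ell_p_sum p I X) (ell_p p) W"
  shows "bounded_operator (ell_p_sum p I X) (ell_p p) (pieces I W)"
proof -
  let ?S = "ell_p_sum p I X"
  have S: "p_space p ?S" by (rule p_space_ell_p_sum)
  have mem: "emb i (y i) \<in> points ?S" if "y \<in> points ?S" "i \<in> I" for i y
    using emb_mem(1)[OF that(2)] that by (simp add: mem_ell_p_sum)
  obtain C where C: "0 < C" "\<And>y. y \<in> points ?S \<Longrightarrow> npow p (ell_p p) (W y) \<le> C * npow p ?S y"
    using bounded_operatorE[OF S p_space_ell_p[OF p] W] by blast
  note WD = bounded_operatorD[OF W]
  have bd: "(\<Sum>ia\<in>F. \<bar>pieces I W y ia\<bar> powr p) \<le> C * npow p ?S y" if y: "y \<in> points ?S" and F: "finite F" for y F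
  proof -
    \<comment> \<open>A finite set of pairs is enlarged to a rectangle, so that the sum splits by
      slices and each slice is bounded through a single summand.\<close>
    have "(\<Sum>ia\<in>F. \<bar>pieces I W y ia\<bar> powr p) \<le> (\<Sum>ia\<in>fst ` F \<times> snd ` F. \<bar>pieces I W y ia\<bar> powr p)"
      using F by (intro sum_mono2 subset_fst_snd) auto
    also have "\<dots> = (\<Sum>i\<in>fst ` F. \<Sum>a\<in>snd ` F. \<bar>pieces I W y (i, a)\<bar> powr p)"
      by (simp add: sum.cartesian_product)
    also have "\<dots> = (\<Sum>i\<in>fst ` F \<inter> I. \<Sum>a\<in>snd ` F. \<bar>W (emb i (y i)) a\<bar> powr p)"
      using F p by (intro sum.mono_neutral_cong_right) (auto simp: pieces_def)
    also have "\<dots> \<le> (\<Sum>i\<in>fst ` F \<inter> I. C * npow p (X i) (y i))"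
    proof (rule sum_mono)
      fix i assume i: "i \<in> fst ` F \<inter> I"
      then have yi: "y i \<in> points (X i)" using y by (auto simp: mem_ell_p_sum)
      have "(\<Sum>a\<in>snd ` F. \<bar>W (emb i (y i)) a\<bar> powr p) \<le> npow p (ell_p p) (W (emb i (y i)))"
        using F i mem[OF y] WD(1) by (intro ell_p_sum_le p) auto
      also have "\<dots> \<le> C * npow p ?S (emb i (y i))" using i mem[OF y] by (intro C) auto
      finally show "(\<Sum>a\<in>snd ` F. \<bar>W (emb i (y i)) a\<bar> powr p) \<le> C * npow p (X i) (y i)"
        using emb_mem(2)[OF _ yi] i by simp
    qed
    also have "\<dots> = C * (\<Sum>i\<in>fst ` F \<inter> I. npow p (X i) (y i))" by (simp add: sum_distrib_left)
    also have "\<dots> \<le> C * npow p ?S y"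
      unfolding npow_ell_p_sum[OF p(1)] using C(1) F y
      by (intro mult_left_mono finite_sum_le_infsum) (auto simp: mem_ell_p_sum npow_def)
    finally show ?thesis .
  qed
  show ?thesis
  proof (rule bounded_operatorI[OF S p_space_ell_p[OF p], where C = C])
    show "pieces I W x \<in> points (ell_p p)" "npow p (ell_p p) (pieces I W x) \<le> C * npow p ?S x"
      if "x \<in> points ?S" for x
      using ell_p_boundedI[OF p(1) bd[OF that]] by auto
    show "pieces I W (x + y) = pieces I W x + pieces I W y" if "x \<in> points ?S" "y \<in> points ?S" for x y
      using WD(2)[OF mem[OF that(1)] mem[OF that(2)]] by (auto simp: pieces_def emb_add)
    show "pieces I W (c *\<^sub>R x) = c *\<^sub>R pieces I W x" if "x \<in> points ?S" for c x
      using WD(3)[OF mem[OF that]] by (auto simp: pieces_def emb_scale scaleR_fun_def)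
  qed
qed

text \<open>The finite sums of the \<open>emb i (y i)\<close> approximate y, and every coordinate of
  W is continuous, so the slices add up to W y coordinate by coordinate.\<close>

lemma (in p_space_family) sum_slices_pieces:
  assumes W: "bounded_operator (ell_p_sum p I X) (ell_p p) W" and y: "y \<in> points (ell_p_sum p I X)"
  shows "sum_slices (pieces I W y) = W y"
proof
  fix a
  let ?S = "ell_p_sum p I X"
  interpret S: p_space p ?S by (rule p_space_ell_p_sum)
  have lin: "linear_operator ?S (ell_p p) W" using W by (simp add: bounded_operator_def)
  have mem: "emb i (y i) \<in> points ?S" if "i \<in> I" for i
    using emb_mem(1)[OF that] that y by (simp add: mem_ell_p_sum)
  obtain C where C: "0 < C" "\<And>y. y \<in> points ?S \<Longrightarrow> npow p (ell_p p) (W y) \<le> C * npow p ?S y"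
    using bounded_operatorE[OF S.p_space_axioms p_space_ell_p[OF p] W] by blast
  have sm: "(\<lambda>i. npow p (X i) (y i)) summable_on I" using y by (simp add: mem_ell_p_sum)
  have "((\<lambda>i. W (emb i (y i)) a) has_sum W y a) I"
    unfolding has_sum_def
  proof (rule tendstoI)
    fix e :: real assume e: "0 < e"
    have "((\<lambda>F. \<Sum>i\<in>F. npow p (X i) (y i)) \<longlongrightarrow> npow p ?S y) (finite_subsets_at_top I)"
      unfolding npow_ell_p_sum[OF p(1)] by (rule infsum_tendsto[OF sm])
    \<comment> \<open>The threshold is chosen so that after W, which costs the factor C, the
      remainder has p-th power below \<open>e powr p\<close> in coordinate a.\<close>
    then have "\<forall>\<^sub>F F in finite_subsets_at_top I. npow p ?S y - e powr p / C < (\<Sum>i\<in>F. npow p (X i) (y i))"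
      by (rule order_tendstoD) (use e C in simp)
    moreover have "\<forall>\<^sub>F F in finite_subsets_at_top I. finite F \<and> F \<subseteq> I"
      by (rule eventually_finite_subsets_at_top_weakI) simp
    ultimately show "\<forall>\<^sub>F F in finite_subsets_at_top I. dist (\<Sum>i\<in>F. W (emb i (y i)) a) (W y a) < e"
    proof eventually_elim
      case (elim F)
      then have F: "finite F" "F \<subseteq> I" by auto
      define z where "z = y - (\<Sum>i\<in>F. emb i (y i))"
      have sF: "(\<Sum>i\<in>F. emb i (y i)) \<in> points ?S" using F mem by (intro S.sum_mem) auto
      then have z: "z \<in> points ?S" unfolding z_def using y by (rule S.diff_mem[rotated])
      have zi: "z i = (if i \<in> F then 0 else y i)" for i
        using F(1) by (simp add: z_def sum_fun_apply emb_def)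
      have "npow p ?S z = (\<Sum>\<^sub>\<infinity>i\<in>I - F. npow p (X i) (y i))"
        unfolding npow_ell_p_sum[OF p(1)] using F p_space.npow_0[OF X]
        by (intro infsum_cong_neutral) (auto simp: zi)
      moreover have "npow p ?S y = (\<Sum>i\<in>F. npow p (X i) (y i)) + (\<Sum>\<^sub>\<infinity>i\<in>I - F. npow p (X i) (y i))"
      proof -
        have "infsum (\<lambda>i. npow p (X i) (y i)) (F \<union> (I - F)) =
            infsum (\<lambda>i. npow p (X i) (y i)) F + infsum (\<lambda>i. npow p (X i) (y i)) (I - F)"
          using F summable_on_subset_banach[OF sm] by (intro infsum_Un_disjoint) auto
        moreover have "F \<union> (I - F) = I" using F by blast
        ultimately show ?thesis using F by (simp add: npow_ell_p_sum[OF p(1)])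
      qed
      ultimately have "npow p ?S z < e powr p / C" using elim(1) by linarith
      then have "C * npow p ?S z < e powr p" using C(1) by (simp add: field_simps)
      moreover have "\<bar>W z a\<bar> powr p \<le> C * npow p ?S z"
        using ell_p_coord_le[OF p(1) bounded_operatorD(1)[OF W z], of a] C(2)[OF z] by linarith
      ultimately have lt: "\<bar>W z a\<bar> powr p < e powr p" by linarith
      have "\<bar>W z a\<bar> < e"
      proof (rule ccontr)
        assume "\<not> \<bar>W z a\<bar> < e"
        then have "e powr p \<le> \<bar>W z a\<bar> powr p" using e p by (intro powr_mono2) auto
        then show False using lt by linarith
      qed
      moreover have "W z = W y - (\<Sum>i\<in>F. W (emb i (y i)))"
      proof -
        have "W (\<Sum>i\<in>F. emb i (y i)) = (\<Sum>i\<in>F. W (emb i (y i)))"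
          using F mem by (intro S.linear_operator_sum[OF lin]) auto
        then show ?thesis unfolding z_def S.linear_operator_diff[OF lin y sF] by simp
      qed
      ultimately show ?case by (simp add: dist_real_def sum_fun_apply abs_minus_commute)
    qed
  qed
  then have "((\<lambda>i. pieces I W y (i, a)) has_sum W y a) UNIV"
    by (subst has_sum_cong_neutral[where T = I and g = "\<lambda>i. W (emb i (y i)) a"]) (auto simp: pieces_def)
  then show "sum_slices (pieces I W y) a = W y a" by (simp add: sum_slices_def infsumI)
qed

text \<open>Each vector of l_p has countable support. A coordinate that vanishes on the images of a
  countable dense set vanishes on all images by continuity, so the supports over the dense set
  already cover everything.\<close>

lemma separable_range_support:
  assumes p: "0 < p" "p \<le> 1" and X: "p_space p X" and sep: "p_separable p X"
    and W: "bounded_operator X (ell_p p) W"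
  obtains A where "countable A" "\<And>x. x \<in> points X \<Longrightarrow> {a. W x a \<noteq> 0} \<subseteq> A"
proof -
  interpret X: p_space p X by (rule X)
  interpret E: p_space p "ell_p p :: ('b \<Rightarrow> real) qspace" by (rule p_space_ell_p[OF p])
  have lin: "linear_operator X (ell_p p) W" using W by (simp add: bounded_operator_def)
  note WD = bounded_operatorD[OF W]
  obtain C where C: "0 < C" "\<And>y. y \<in> points X \<Longrightarrow> npow p (ell_p p) (W y) \<le> C * npow p X y"
    using bounded_operatorE[OF X E.p_space_axioms W] by blast
  obtain S where S: "countable S" "S \<subseteq> points X" "X.M.mtopology closure_of S = points X"
    using sep by (auto simp: p_separable_def separable_space_def X.p_topology_eq)
  define A where "A = (\<Union>d\<in>S. {a. W d a \<noteq> 0})"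
  show thesis
  proof (rule that)
    show "countable A"
      unfolding A_def using S WD(1) by (intro countable_UN countable_support) auto
    fix x assume x: "x \<in> points X"
    have "W x a = 0" if a: "a \<notin> A" for a
    proof (rule ccontr)
      assume nz: "W x a \<noteq> 0"
      define e where "e = \<bar>W x a\<bar> powr p / C"
      have e: "0 < e" using nz C by (simp add: e_def)
      have "x \<in> X.M.mtopology closure_of S" using x S(3) by simp
      then obtain d where d: "d \<in> S" "d \<in> X.M.mball x e"
        unfolding X.M.metric_closure_of using e by blast
      then have dX: "d \<in> points X" and lt: "npow p X (x - d) < e"
        using S(2) by (auto simp: X.M.in_mball X.pdist_eq)
      have "W d a = 0" using d(1) a by (auto simp: A_def)
      then have "W x a = W (x - d) a" using X.linear_operator_diff[OF lin x dX] by simp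
      then have "\<bar>W x a\<bar> powr p \<le> C * npow p X (x - d)"
        using ell_p_coord_le[OF p(1) WD(1)[OF X.diff_mem[OF x dX]], of a] C(2)[OF X.diff_mem[OF x dX]]
        by simp
      also have "\<dots> < C * e" using lt C(1) by simp
      finally show False using C(1) by (simp add: e_def)
    qed
    then show "{a. W x a \<noteq> 0} \<subseteq> A" by blast
  qed
qed

section \<open>The theorem\<close>

theorem proposition3p2:
  fixes p :: real
    and H :: "'h::real_vector qspace"
    and j :: "'h \<Rightarrow> ('k \<Rightarrow> real)"
    and q :: "('k \<Rightarrow> real) \<Rightarrow> 'k L0"
    and I :: "'i set"
    and X :: "'i \<Rightarrow> 'x::real_vector qspace"
  assumes "uncountable (UNIV :: 'k set)"
    and "0 < p" and "p \<le> 1"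
    and "p_Banach p H"
    and "short_exact H (ell_p p) (Lp_haar p) j q"
    and "\<And>i. i \<in> I \<Longrightarrow> p_Banach p (X i) \<and> p_separable p (X i)"
  shows "\<not> isomorphic p H (ell_p_sum p I X)"
proof
  assume iso: "isomorphic p H (ell_p_sum p I X)"
  note p = assms(2,3)
  let ?E = "ell_p p :: ('k \<Rightarrow> real) qspace" and ?L = "Lp_haar p :: 'k L0 qspace"
    and ?G = "ell_p p :: ('i \<times> 'k \<Rightarrow> real) qspace" and ?S = "ell_p_sum p I X"
  let ?K = "subqspace {x \<in> points ?E. q x = 0} ?E" and ?V = "subqspace {x \<in> points ?E. q x \<in> simple} ?E"
  have H: "p_space p H" by (rule p_space_of_p_Banach[OF p assms(4)])
  have E: "p_space p ?E" and G: "p_space p ?G" by (rule p_space_ell_p[OF p])+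
  have L: "p_space p ?L" by (rule p_space_Lp[OF p])
  interpret E: p_space p ?E by (rule E)
  interpret G: p_space p ?G by (rule G)
  interpret L: p_space p ?L by (rule L)
  interpret F: p_space_family p I X
    by (rule p_space_family.intro) (use p assms(6) p_space_of_p_Banach[OF p] in blast)+
  have S: "p_space p ?S" by (rule F.p_space_ell_p_sum)
  have j: "bounded_operator H ?E j" and q: "bounded_operator ?E ?L q"
    and inj: "{x \<in> points H. j x = 0} = {0}" and ran: "{y \<in> points ?E. q y = 0} = j ` points H"
    and onto: "q ` points ?E = points ?L"
    using assms(5) by (auto simp: short_exact_def)
  have qlin: "linear_operator ?E ?L q" using q by (simp add: bounded_operator_def)
  note qD = bounded_operatorD[OF q]
  obtain Cq where Cq: "0 < Cq" "\<And>x. x \<in> points ?E \<Longrightarrow> npow p ?L (q x) \<le> Cq * npow p ?E x"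
    using bounded_operatorE[OF E L q] by blast
  obtain C where C: "0 < C"
    and lift: "\<And>y. y \<in> points ?L \<Longrightarrow> \<exists>x\<in>points ?E. q x = y \<and> npow p ?E x \<le> C * npow p ?L y"
    using open_mapping[OF p p_Banach_ell_p[OF p] p_Banach_Lp[OF p] q onto] by blast
  have BK: "p_Banach p ?K" by (rule p_Banach_kernel[OF p p_Banach_ell_p[OF p] L q])
  have K: "p_space p ?K" by (rule p_space_of_p_Banach[OF p BK])
  have V: "p_space p ?V"
    using E.subspace_vimage[OF qlin subspace_simple] by (intro E.p_space_subqspace) auto
  interpret V: p_space p ?V by (rule V)
  have jK: "bounded_operator H ?K j"
  proof -
    obtain B where "\<And>x. x \<in> points H \<Longrightarrow> npow p ?E (j x) \<le> B * npow p H x"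
      using bounded_operatorE[OF H E j] by blast
    then show ?thesis
      using bounded_operatorD[OF j] ran by (intro bounded_operatorI[OF H K, where C = B]) auto
  qed
  have jK_onto: "j ` points H = points ?K" by (simp add: ran)
  obtain g where g: "bounded_operator ?K H g" "\<And>x. x \<in> points ?K \<Longrightarrow> j (g x) = x"
    using bounded_inverse[OF p assms(4) BK jK jK_onto inj] by blast
  obtain T R where T: "bounded_operator H ?S T" and R: "bounded_operator ?S H R"
    and RT: "\<And>x. x \<in> points H \<Longrightarrow> R (T x) = x"
    using isomorphicD[OF H S iso] by blast

  \<comment> \<open>Decomposition of kernel elements\<close>
  define W where "W y = j (R y)" for y
  have W: "bounded_operator ?S ?E W" unfolding W_def by (rule bounded_operator_comp[OF S H E R j])
  define D where "D x = pieces I W (T (g x))" for x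
  have Tg: "bounded_operator ?K ?S (\<lambda>x. T (g x))" by (rule bounded_operator_comp[OF K H S g(1) T])
  have D: "bounded_operator ?K ?G D"
    unfolding D_def by (rule bounded_operator_comp[OF K S G Tg F.bounded_operator_pieces[OF W]])
  have D_sum: "sum_slices (D x) = x" and D_slice: "q (slice i (D x)) = 0" if x: "x \<in> points ?K" for x i
  proof -
    have TS: "T (g x) \<in> points ?S" by (rule bounded_operatorD(1)[OF Tg x])
    show "sum_slices (D x) = x"
      unfolding D_def F.sum_slices_pieces[OF W TS]
      using RT[OF bounded_operatorD(1)[OF g(1) x]] g(2)[OF x] by (simp add: W_def)
    have "emb i (T (g x) i) \<in> points ?S" if "i \<in> I"
      using F.emb_mem(1)[OF that] TS that by (simp add: mem_ell_p_sum)
    then have "W (emb i (T (g x) i)) \<in> j ` points H" if "i \<in> I"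
      using that bounded_operatorD(1)[OF R] by (auto simp: W_def)
    then show "q (slice i (D x)) = 0"
      unfolding D_def slice_pieces using ran E.linear_operator_0[OF qlin] by auto
  qed
  \<comment> \<open>Separability of the summands enters here: all i-th slices of D are supported in
    one countable set.\<close>
  have "\<forall>i\<in>I. \<exists>A. countable A \<and> (\<forall>x\<in>points (X i). {a. W (emb i x) a \<noteq> 0} \<subseteq> A)"
  proof
    fix i assume i: "i \<in> I"
    have We: "bounded_operator (X i) ?E (\<lambda>x. W (emb i x))"
      by (rule bounded_operator_comp[OF F.X[OF i] S E F.bounded_operator_emb[OF i] W])
    show "\<exists>A. countable A \<and> (\<forall>x\<in>points (X i). {a. W (emb i x) a \<noteq> 0} \<subseteq> A)"
      using separable_range_support[OF p F.X[OF i] _ We] assms(6)[OF i] by metis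
  qed
  then obtain A where A: "\<And>i. i \<in> I \<Longrightarrow> countable (A i)"
    "\<And>i x. i \<in> I \<Longrightarrow> x \<in> points (X i) \<Longrightarrow> {a. W (emb i x) a \<noteq> 0} \<subseteq> A i"
    by metis
  define A' where "A' i = (if i \<in> I then A i else {})" for i
  have A': "countable (A' i)" for i using A(1) by (simp add: A'_def)
  have D_supp: "D x (i, a) = 0" if x: "x \<in> points ?K" and a: "a \<notin> A' i" for x i a
    using bounded_operatorD(1)[OF Tg x] a A(2)[of i "T (g x) i"]
    by (auto simp: D_def pieces_def A'_def mem_ell_p_sum)

  \<comment> \<open>The extended decomposition and its defects\<close>
  obtain D' where D': "bounded_operator ?V ?G D'"
    and D'_eq: "\<And>x. x \<in> points ?E \<Longrightarrow> q x = 0 \<Longrightarrow> D' x = D x"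
    and D'_supp: "\<And>x ia. x \<in> points ?E \<Longrightarrow> q x \<in> simple \<Longrightarrow>
      (\<forall>z\<in>points ?E. q z = 0 \<longrightarrow> D z ia = 0) \<Longrightarrow> D' x ia = 0"
    using kernel_extension[OF p E q C lift D] by blast
  \<comment> \<open>Slices of D lie in the kernel, those of D' need not: \<open>Q i x\<close> is
    what q sees of the i-th one.\<close>
  define Q where "Q i x = q (slice i (D' x))" for i x
  have slice_D': "bounded_operator ?V ?E (\<lambda>x. slice i (D' x))" for i
    by (rule bounded_operator_comp[OF V G E D' bounded_operator_slice[OF p]])
  have Q: "bounded_operator ?V ?L (Q i)" for i
    unfolding Q_def by (rule bounded_operator_comp[OF V E L slice_D' q])
  \<comment> \<open>On the kernel the slices of D add up to the argument, so U is the error in this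
    identity for D'.\<close>
  define U where "U x = sum_slices (D' x) - x" for x
  have incl: "bounded_operator ?V ?E (\<lambda>x. x)" by (rule bounded_operator_inclusion[OF E V]) auto
  have U: "bounded_operator ?V ?E U"
    unfolding U_def
    by (rule bounded_operator_diff[OF V E bounded_operator_comp[OF V G E D' bounded_operator_sum_slices[OF p]] incl])
  have Q0: "Q i x = 0" and U0: "U x = 0" if "x \<in> points ?E" "q x = 0" for i x
    using D_slice[of x i] D_sum[of x] D'_eq that by (auto simp: Q_def U_def)

  \<comment> \<open>Lifts of sums of Rademacher functions\<close>
  have "\<forall>B. \<exists>w. finite B \<longrightarrow> w \<in> points ?E \<and> q w = sum rademacher B \<and>
      npow p ?E w \<le> C * npow p ?L (sum rademacher B)"
    using lift L.sum_mem rademacher_mem by metis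
  \<comment> \<open>A separate lift is taken for every finite set B. Its bound comes from the norm
    of the whole sum, of order n^(p/2) in the p-th power, whereas a sum of lifts of the summands is
    controlled only to order n.\<close>
  then obtain w where w: "\<And>B. finite B \<Longrightarrow> w B \<in> points ?E" "\<And>B. finite B \<Longrightarrow> q (w B) = sum rademacher B"
    "\<And>B. finite B \<Longrightarrow> npow p ?E (w B) \<le> C * npow p ?L (sum rademacher B)"
    by metis
  have w_le: "npow p ?E (w B) \<le> 2 * C * real (card B) powr (p / 2)" if "finite B" "B \<noteq> {}" for B
  proof -
    have "C * npow p ?L (sum rademacher B) \<le> C * (2 * real (card B) powr (p / 2))"
      using npow_sum_rademacher_le[OF p that] C by (intro mult_left_mono) auto
    then show ?thesis using w(3)[OF that(1)] by simp
  qed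
  define u where "u a = w {a}" for a
  have u: "u a \<in> points ?E" "q (u a) = rademacher a" for a
    using w(1,2)[of "{a}"] by (simp_all add: u_def)
  have wV: "w B \<in> points ?V" if "finite B" for B
    using w(1,2)[OF that] subspace_sum[OF subspace_simple rademacher_simple] by simp
  have uV: "u a \<in> points ?V" for a using wV by (simp add: u_def)

  \<comment> \<open>The lift of the sum and the sum of the lifts differ by a kernel element, which f
    does not see.\<close>
  have sum_lift: "f (w B) = (\<Sum>a\<in>B. f (u a))"
    if f: "bounded_operator ?V Z f" and f0: "\<And>x. x \<in> points ?E \<Longrightarrow> q x = 0 \<Longrightarrow> f x = 0" and B: "finite B"
    for Z :: "'z::real_vector qspace" and f B
  proof -
    have lin: "linear_operator ?V Z f" using f by (simp add: bounded_operator_def)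
    have su: "(\<Sum>a\<in>B. u a) \<in> points ?V" by (intro V.sum_mem uV)
    have "q (\<Sum>a\<in>B. u a) = sum rademacher B"
      using E.linear_operator_sum[OF qlin, of B u] u by simp
    then have "q (w B - (\<Sum>a\<in>B. u a)) = 0"
      using E.linear_operator_diff[OF qlin w(1)[OF B], of "\<Sum>a\<in>B. u a"] E.sum_mem[of B u] u(1) w(2)[OF B]
      by simp
    then have "f (w B - (\<Sum>a\<in>B. u a)) = 0"
      using w(1)[OF B] u(1) by (intro f0 E.diff_mem E.sum_mem) auto
    then show ?thesis
      using V.linear_operator_diff[OF lin wV[OF B] su] V.linear_operator_sum[OF lin, of B u] uV by simp
  qed
  have countable_f: "countable {a. f (u a) \<noteq> 0}"
    if f: "bounded_operator ?V Z f" and f0: "\<And>x. x \<in> points ?E \<Longrightarrow> q x = 0 \<Longrightarrow> f x = 0"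
      and Z: "p_space p Z" and N: "countable N" "N \<subseteq> points Z"
      and near: "\<And>a e. 0 < e \<Longrightarrow> \<exists>z\<in>N. npow p Z (f (u a) - z) < e"
    for Z :: "'z::real_vector qspace" and f N
  proof -
    interpret Z: p_space p Z by (rule Z)
    obtain B where B: "0 < B" "\<And>x. x \<in> points ?V \<Longrightarrow> npow p Z (f x) \<le> B * npow p ?V x"
      using bounded_operatorE[OF V Z f] by blast
    show ?thesis
    proof (rule Z.countable_nonzero[OF bounded_operatorD(1)[OF f uV] _ N near])
      fix A :: "'k set" assume A: "finite A" "A \<noteq> {}"
      have "npow p Z (\<Sum>a\<in>A. f (u a)) \<le> B * npow p ?E (w A)"
        using B(2)[OF wV[OF A(1)]] sum_lift[OF f f0 A(1)] by simp
      also have "\<dots> \<le> B * (2 * C * real (card A) powr (p / 2))"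
        using B(1) w_le[OF A] by (intro mult_left_mono) auto
      finally show "npow p Z (\<Sum>a\<in>A. f (u a)) \<le> B * (2 * C) * real (card A) powr (p / 2)"
        by (simp add: mult_ac)
    qed
  qed

  \<comment> \<open>Countability of the nonzero defects\<close>
  have cQ: "countable {a. Q i (u a) \<noteq> 0}" for i
  proof -
    obtain N where N: "countable N" "N \<subseteq> points ?E"
      "\<And>x e. x \<in> points ?E \<Longrightarrow> {k. x k \<noteq> 0} \<subseteq> A' i \<Longrightarrow> 0 < e \<Longrightarrow> \<exists>z\<in>N. npow p ?E (x - z) < e"
      using ell_p_countable_dense[OF p A'] by blast
    have qN: "countable (q ` N)" "q ` N \<subseteq> points ?L" using N qD(1) by auto
    show ?thesis
    proof (rule countable_f[OF Q Q0 L qN])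
      fix a and e :: real assume e: "0 < e"
      let ?s = "slice i (D' (u a))"
      have s: "?s \<in> points ?E" by (rule bounded_operatorD(1)[OF slice_D' uV])
      \<comment> \<open>All of D vanishes at (i, k) for k outside \<open>A' i\<close>, and D' keeps
        these zeros. The values of \<open>Q i\<close> are thus images under q of vectors supported
        in a fixed countable set, approximable from \<open>q\<close> followed by the countable set
        N.\<close>
      have "{k. ?s k \<noteq> 0} \<subseteq> A' i"
        using D'_supp[of "u a" "(i, _)"] D_supp uV[of a] by (auto simp: slice_def)
      then obtain z where z: "z \<in> N" "npow p ?E (?s - z) < e / Cq"
        using N(3)[OF s, of "e / Cq"] e Cq(1) by auto
      have zE: "z \<in> points ?E" using z N(2) by blast
      have "npow p ?L (Q i (u a) - q z) \<le> Cq * npow p ?E (?s - z)"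
        using Cq(2)[OF E.diff_mem[OF s zE]] E.linear_operator_diff[OF qlin s zE] by (simp add: Q_def)
      also have "\<dots> < e" using z(2) Cq(1) by (simp add: field_simps)
      finally show "\<exists>z\<in>q ` N. npow p ?L (Q i (u a) - z) < e" using z(1) by blast
    qed
  qed
  have cU: "countable {a. U (u a) b \<noteq> 0}" for b
  proof -
    \<comment> \<open>A single coordinate of U is treated as an operator into l_p, so that the same
      countability argument applies to it.\<close>
    have f: "bounded_operator ?V ?E (\<lambda>x. coord_restrict {b} (U x))"
      by (rule bounded_operator_comp[OF V E E U bounded_operator_coord_restrict[OF p]])
    obtain N where N: "countable N" "N \<subseteq> points ?E"
      "\<And>x e. x \<in> points ?E \<Longrightarrow> {k. x k \<noteq> 0} \<subseteq> {b} \<Longrightarrow> 0 < e \<Longrightarrow> \<exists>z\<in>N. npow p ?E (x - z) < e"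
      using ell_p_countable_dense[OF p, of "{b}"] by auto
    have "countable {a. coord_restrict {b} (U (u a)) \<noteq> 0}"
    proof (rule countable_f[OF f _ E N(1,2)])
      show "coord_restrict {b} (U x) = 0" if "x \<in> points ?E" "q x = 0" for x
        using U0[OF that] by (auto simp: coord_restrict_def)
      show "\<exists>z\<in>N. npow p ?E (coord_restrict {b} (U (u a)) - z) < e" if "0 < e" for a e
        using that by (intro N(3) bounded_operatorD(1)[OF f uV]) (auto simp: coord_restrict_def)
    qed
    also have "{a. coord_restrict {b} (U (u a)) \<noteq> 0} = {a. U (u a) b \<noteq> 0}"
      by (auto simp: coord_restrict_def fun_eq_iff)
    finally show ?thesis .
  qed

  \<comment> \<open>The tags \<open>Inl\<close> and \<open>Inr\<close> let one disjointness
    condition govern slices and coordinates together.\<close>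
  define M where "M a = Inl ` {i. Q i (u a) \<noteq> 0} \<union> Inr ` {b. U (u a) b \<noteq> 0}" for a
  have cM: "countable (M a)" for a
  proof -
    have "{i. Q i (u a) \<noteq> 0} \<subseteq> fst ` {ib. D' (u a) ib \<noteq> 0}"
    proof (rule subsetI, rule ccontr)
      fix i assume i: "i \<in> {i. Q i (u a) \<noteq> 0}" and "i \<notin> fst ` {ib. D' (u a) ib \<noteq> 0}"
      then have "slice i (D' (u a)) = 0" by (force simp: slice_def)
      then show False using i E.linear_operator_0[OF qlin] by (simp add: Q_def)
    qed
    then have "countable {i. Q i (u a) \<noteq> 0}"
      by (rule countable_subset) (intro countable_image countable_support[OF bounded_operatorD(1)[OF D' uV]])
    then show ?thesis
      unfolding M_def using countable_support[OF bounded_operatorD(1)[OF U uV]] by blast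
  qed
  have pM: "countable {a. s \<in> M a}" for s
    using cQ cU by (cases s) (auto simp: M_def image_iff)

  \<comment> \<open>Rademacher functions with disjoint defects\<close>
  obtain B1 where B1: "0 < B1" "\<And>x. x \<in> points ?V \<Longrightarrow> npow p ?G (D' x) \<le> B1 * npow p ?V x"
    using bounded_operatorE[OF V G D'] by blast
  obtain B2 where B2: "0 < B2" "\<And>x. x \<in> points ?V \<Longrightarrow> npow p ?E (U x) \<le> B2 * npow p ?V x"
    using bounded_operatorE[OF V E U] by blast
  \<comment> \<open>The factors come from the final chain of estimates: q costs \<open>Cq\<close>,
    D' and U together \<open>B1 + B2\<close>, and the lift \<open>2 * C\<close>. In the choice of n
    below, exponent 1/2 covers p/2 because p \<le> 1 and n \<ge> 1.\<close>
  define c where "c = Cq * (B1 + B2) * (2 * C)"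
  obtain n :: nat where n: "0 < n" "c * real n powr (1 / 2) + 2 < real n powr 1 * 1"
    using exists_powr_dominates[of 1 1 c] by auto
  obtain B where B: "finite B" "card B = n" "disjoint_family_on M B"
    using exists_disjoint_family[OF assms(1) cM pM] by blast
  have Bne: "B \<noteq> {}" using B n by auto
  define v where "v = w B"
  have v: "v \<in> points ?V" using wV[OF B(1)] by (simp add: v_def)
  define I' where "I' a = {i. Q i (u a) \<noteq> 0} \<times> (UNIV :: 'k set)" for a
  define J where "J a = {b. U (u a) b \<noteq> 0}" for a
  have disjI: "disjoint_family_on I' B" and disjJ: "disjoint_family_on J B"
    using B(3) by (fastforce simp: disjoint_family_on_def M_def I'_def J_def)+
  have Dv: "D' v \<in> points ?G" and Uv: "U v \<in> points ?E"
    by (rule bounded_operatorD(1)[OF D' v] bounded_operatorD(1)[OF U v])+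
  have Qv: "Q i v = Q i (u a)" if a: "a \<in> B" and "Q i (u a) \<noteq> 0" for a i
  proof -
    have "Q i (u l) = 0" if "l \<in> B - {a}" for l
      using B(3) a that \<open>Q i (u a) \<noteq> 0\<close> by (fastforce simp: disjoint_family_on_def M_def)
    then have "(\<Sum>l\<in>B. Q i (u l)) = (\<Sum>l\<in>{a}. Q i (u l))"
      using B(1) a by (intro sum.mono_neutral_right) auto
    then show ?thesis using sum_lift[OF Q Q0 B(1)] by (simp add: v_def)
  qed
  have Uu: "U (u a) = coord_restrict (J a) (U v)" if a: "a \<in> B" for a
  proof
    fix b
    show "U (u a) b = coord_restrict (J a) (U v) b"
    proof (cases "U (u a) b = 0")
      case False
      have "U (u l) b = 0" if "l \<in> B - {a}" for l
        using B(3) a that False by (fastforce simp: disjoint_family_on_def M_def)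
      then have "(\<Sum>l\<in>B. U (u l) b) = (\<Sum>l\<in>{a}. U (u l) b)"
        using B(1) a by (intro sum.mono_neutral_right) auto
      then show ?thesis using False sum_lift[OF U U0 B(1)] by (simp add: v_def coord_restrict_def J_def sum_fun_apply)
    qed (simp add: coord_restrict_def J_def)
  qed
  \<comment> \<open>The slices of \<open>D' (u a)\<close> can be replaced by those of its
    counterpart \<open>?y\<close> cut out of \<open>D' v\<close>: where \<open>Q i (u a)\<close> is
    nonzero it equals \<open>Q i v\<close>, and elsewhere both slices are killed by q. Hence the
    Rademacher function a is recovered from \<open>?y\<close> and \<open>U (u a)\<close>, the latter
    being a restriction of \<open>U v\<close>; its norm 1 bounds these two parts from below.\<close>
  have main: "1 \<le> Cq * (npow p ?G (coord_restrict (I' a) (D' v)) + npow p ?E (coord_restrict (J a) (U v)))" if a: "a \<in> B" for a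
  proof -
    let ?y = "coord_restrict (I' a) (D' v)"
    have y: "?y \<in> points ?G" by (rule coord_restrict_mem[OF p(1) Dv])
    have Du: "D' (u a) \<in> points ?G" by (rule bounded_operatorD(1)[OF D' uV])
    have sE: "slice i z \<in> points ?E" if "z \<in> points ?G" for i z by (rule slice_mem(1)[OF p(1) that])
    have "q (sum_slices (D' (u a) - ?y)) = 0"
    proof (rule operator_sum_slices_eq_0[OF p L q G.diff_mem[OF Du y]])
      fix i
      have "slice i (D' (u a) - ?y) = slice i (D' (u a)) - slice i ?y"
        by (auto simp: slice_def)
      then have "q (slice i (D' (u a) - ?y)) = Q i (u a) - q (slice i ?y)"
        using E.linear_operator_diff[OF qlin sE[OF Du] sE[OF y], of i i] by (simp only: Q_def)
      also have "slice i ?y = (if Q i (u a) \<noteq> 0 then slice i (D' v) else 0)"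
        by (auto simp: slice_def coord_restrict_def I'_def)
      also have "q \<dots> = Q i (u a)"
        using Qv[OF a] E.linear_operator_0[OF qlin] by (auto simp: Q_def)
      finally show "q (slice i (D' (u a) - ?y)) = 0" by (simp only: diff_self)
    qed
    moreover have "sum_slices (D' (u a) - ?y) = sum_slices (D' (u a)) - sum_slices ?y"
      by (rule sum_slices_diff[OF p Du y])
    ultimately have eq: "q (sum_slices (D' (u a))) = q (sum_slices ?y)"
      using E.linear_operator_diff[OF qlin sum_slices_mem(1)[OF p Du] sum_slices_mem(1)[OF p y]] by simp
    have Ua: "U (u a) \<in> points ?E" by (rule bounded_operatorD(1)[OF U uV])
    have "rademacher a = q (sum_slices (D' (u a)) - U (u a))" using u(2) by (simp add: U_def)
    also have "\<dots> = q (sum_slices ?y) - q (U (u a))"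
      using E.linear_operator_diff[OF qlin sum_slices_mem(1)[OF p Du] Ua] eq by simp
    finally have "npow p ?L (rademacher a) \<le> npow p ?L (q (sum_slices ?y)) + npow p ?L (q (U (u a)))"
      using L.npow_diff[OF qD(1)[OF sum_slices_mem(1)[OF p y]] qD(1)[OF Ua]] by simp
    also have "\<dots> \<le> Cq * npow p ?E (sum_slices ?y) + Cq * npow p ?E (U (u a))"
      by (intro add_mono Cq sum_slices_mem[OF p y] Ua)
    also have "\<dots> \<le> Cq * npow p ?G ?y + Cq * npow p ?E (coord_restrict (J a) (U v))"
      using Cq(1) sum_slices_mem(2)[OF p y] by (intro add_mono mult_left_mono) (auto simp flip: Uu[OF a])
    finally show ?thesis by (simp add: npow_rademacher[OF p(1)] distrib_left)
  qed

  \<comment> \<open>Comparison of n with its square root\<close>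
  have "real n = (\<Sum>a\<in>B. 1)" using B by simp
  also have "\<dots> \<le> (\<Sum>a\<in>B. Cq * (npow p ?G (coord_restrict (I' a) (D' v)) + npow p ?E (coord_restrict (J a) (U v))))"
    by (rule sum_mono) (rule main)
  also have "\<dots> = Cq * ((\<Sum>a\<in>B. npow p ?G (coord_restrict (I' a) (D' v))) + (\<Sum>a\<in>B. npow p ?E (coord_restrict (J a) (U v))))"
    by (simp add: sum_distrib_left sum.distrib distrib_left)
  also have "\<dots> \<le> Cq * (npow p ?G (D' v) + npow p ?E (U v))"
    using Cq(1) sum_npow_coord_restrict_le[OF p(1) Dv B(1) disjI] sum_npow_coord_restrict_le[OF p(1) Uv B(1) disjJ]
    by (intro mult_left_mono add_mono) auto
  also have "\<dots> \<le> Cq * ((B1 + B2) * npow p ?E v)"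
    using Cq(1) B1(2)[OF v] B2(2)[OF v] by (intro mult_left_mono) (auto simp: distrib_right)
  also have "\<dots> \<le> Cq * ((B1 + B2) * (2 * C * real n powr (p / 2)))"
    using Cq(1) B1(1) B2(1) w_le[OF B(1) Bne] B(2) by (intro mult_left_mono) (auto simp: v_def)
  also have "\<dots> = c * real n powr (p / 2)" by (simp add: c_def mult_ac)
  also have "\<dots> \<le> c * real n powr (1 / 2)"
    using n(1) p Cq(1) B1(1) B2(1) C by (intro mult_left_mono powr_mono) (auto simp: c_def)
  finally show False using n(2) by simp
qed

end
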